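(* Let $\Lambda$ be a finitely generated Dedekind domain. For any finitely generated $\Lambda$-module $M$, there exists an injective map of sets \[ \mathcal{Y}_{\Lambda,M} \colon \mathcal{G}_{\Lambda}(M) \hookrightarrow \operatorname{Cl}(\Lambda) \] from the $\Lambda$-profinite genus of $M$ into the ideal class group of $\Lambda$.
   Context: Rings are commutative. A commutative ring $\Lambda$ is called finitely generated if it is finitely generated as a $\mathbb{Z}$-algebra. A Dedekind domain is an integrally closed Noetherian domain of dimension one; $\operatorname{Cl}(\Lambda)$ denotes its ideal class group. For a $\Lambda$-module $M$, $\widehat{M}$ denotes the $\Lambda$-profinite completion of $M$, i.e. the topological $\Lambda$-module given by the inverse limit of the finite (as sets) quotient $\Lambda$-modules of $M$, each taken with the discrete topology; isomorphisms of profinite completions are isomorphisms of profinite (topological) $\Lambda$-modules. A $\Lambda$-module $M$ is residually finite if the canonical map $M \to \widehat{M}$ is injective. For a finitely generated residually finite $\Lambda$-module $M$, the $\Lambda$-profinite genus $\mathcal{G}_\Lambda(M)$ is the set of isomorphism classes of finitely generated residually finite $\Lambda$-modules $N$ with $\widehat{M} \cong \widehat{N}$. (Finitely generated modules over a finitely generated Noetherian domain are automatically residually finite.) *)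

theory Defs
  imports
    "HOL-Library.Extended_Nat"
    "HOL-Analysis.Function_Topology"
    "HOL-Algebra.Module"
    "HOL-Algebra.Ideal_Product"
    "HOL-Algebra.Ring_Divisibility"
    "HOL-Algebra.Generated_Rings"
    "HOL-Algebra.Polynomials"
begin

section \<open>Dedekind domains\<close>

definition finitely_generated_ring :: "('a, 'r) ring_scheme \<Rightarrow> bool" where
  "finitely_generated_ring R \<longleftrightarrow>
     (\<exists>A. finite A \<and> A \<subseteq> carrier R \<and> carrier R = generate_ring R A)"

definition krull_dimension :: "('a, 'r) ring_scheme \<Rightarrow> enat" where
  "krull_dimension R =
     (SUP Ps \<in> {Ps. Ps \<noteq> [] \<and> (\<forall>P\<in>set Ps. primeideal P R) \<and> sorted_wrt (\<subset>) Ps}.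
        enat (length Ps - 1))"

definition frac_pairs :: "('a, 'r) ring_scheme \<Rightarrow> ('a \<times> 'a) set" where
  "frac_pairs R = carrier R \<times> (carrier R - {\<zero>\<^bsub>R\<^esub>})"

definition frac_rel :: "('a, 'r) ring_scheme \<Rightarrow> (('a \<times> 'a) \<times> ('a \<times> 'a)) set" where
  "frac_rel R = {((a, b), (c, d)).
     (a, b) \<in> frac_pairs R \<and> (c, d) \<in> frac_pairs R \<and> a \<otimes>\<^bsub>R\<^esub> d = c \<otimes>\<^bsub>R\<^esub> b}"

definition fraction :: "('a, 'r) ring_scheme \<Rightarrow> 'a \<Rightarrow> 'a \<Rightarrow> ('a \<times> 'a) set" where
  "fraction R a b = frac_rel R `` {(a, b)}"

definition frac_field :: "('a, 'r) ring_scheme \<Rightarrow> ('a \<times> 'a) set ring" where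
  "frac_field R =
     \<lparr> carrier = frac_pairs R // frac_rel R,
       monoid.mult = (\<lambda>U V. \<Union>p\<in>U. \<Union>q\<in>V. fraction R (fst p \<otimes>\<^bsub>R\<^esub> fst q) (snd p \<otimes>\<^bsub>R\<^esub> snd q)),
       one = fraction R \<one>\<^bsub>R\<^esub> \<one>\<^bsub>R\<^esub>,
       zero = fraction R \<zero>\<^bsub>R\<^esub> \<one>\<^bsub>R\<^esub>,
       add = (\<lambda>U V. \<Union>p\<in>U. \<Union>q\<in>V.
                fraction R ((fst p \<otimes>\<^bsub>R\<^esub> snd q) \<oplus>\<^bsub>R\<^esub> (fst q \<otimes>\<^bsub>R\<^esub> snd p)) (snd p \<otimes>\<^bsub>R\<^esub> snd q)) \<rparr>"

definition frac_embed :: "('a, 'r) ring_scheme \<Rightarrow> 'a \<Rightarrow> ('a \<times> 'a) set" where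
  "frac_embed R a = fraction R a \<one>\<^bsub>R\<^esub>"

lemma (in domain) equiv_frac_rel: "equiv (frac_pairs R) (frac_rel R)"
proof (rule equivI)
  show "frac_rel R \<subseteq> frac_pairs R \<times> frac_pairs R"
    by (auto simp: frac_rel_def)
  show "refl_on (frac_pairs R) (frac_rel R)"
    by (auto simp: refl_on_def frac_rel_def)
  show "sym (frac_rel R)"
    by (auto simp: sym_def frac_rel_def)
  show "trans (frac_rel R)"
  proof (rule transI)
    fix p q r assume "(p, q) \<in> frac_rel R" "(q, r) \<in> frac_rel R"
    moreover obtain a b c d e f where p: "p = (a, b)" "q = (c, d)" "r = (e, f)"
      by (metis surj_pair)
    ultimately have c: "a \<in> carrier R" "b \<in> carrier R" "b \<noteq> \<zero>" "c \<in> carrier R" "d \<in> carrier R"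
        "d \<noteq> \<zero>" "e \<in> carrier R" "f \<in> carrier R" "f \<noteq> \<zero>"
      and eq: "a \<otimes> d = c \<otimes> b" "c \<otimes> f = e \<otimes> d"
      by (auto simp: frac_rel_def frac_pairs_def)
    have "d \<otimes> (a \<otimes> f) = (a \<otimes> d) \<otimes> f"
      using c by (simp add: m_ac)
    also have "\<dots> = (c \<otimes> f) \<otimes> b"
      using c by (simp add: eq(1) m_ac)
    also have "\<dots> = d \<otimes> (e \<otimes> b)"
      using c by (simp add: eq(2) m_ac)
    finally have "a \<otimes> f = e \<otimes> b"
      using c m_lcancel by auto
    then show "(p, r) \<in> frac_rel R"
      using c by (auto simp: p frac_rel_def frac_pairs_def)
  qed
qed

lemma (in domain) fraction_eq_iff:
  assumes "(a, b) \<in> frac_pairs R" "(c, d) \<in> frac_pairs R"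
  shows "fraction R a b = fraction R c d \<longleftrightarrow> a \<otimes> d = c \<otimes> b"
  using eq_equiv_class_iff[OF equiv_frac_rel assms] assms
  by (auto simp: fraction_def frac_rel_def)

lemma fraction_closed:
  "(a, b) \<in> frac_pairs R \<Longrightarrow> fraction R a b \<in> carrier (frac_field R)"
  by (auto simp: fraction_def frac_field_def intro: quotientI)

lemma frac_field_cases:
  assumes "x \<in> carrier (frac_field R)"
  obtains a b where "(a, b) \<in> frac_pairs R" "x = fraction R a b"
  using assms unfolding frac_field_def fraction_def quotient_def by auto

lemma (in domain) fraction_ops:
  assumes ab: "(a, b) \<in> frac_pairs R" and cd: "(c, d) \<in> frac_pairs R"
  shows "fraction R a b \<otimes>\<^bsub>frac_field R\<^esub> fraction R c d = fraction R (a \<otimes> c) (b \<otimes> d)"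
    and "fraction R a b \<oplus>\<^bsub>frac_field R\<^esub> fraction R c d
         = fraction R ((a \<otimes> d) \<oplus> (c \<otimes> b)) (b \<otimes> d)"
proof -
  have U: "(\<Union>p\<in>fraction R a b. \<Union>q\<in>fraction R c d. h p q) = h (a, b) (c, d)"
    if "\<And>p q. p \<in> fraction R a b \<Longrightarrow> q \<in> fraction R c d \<Longrightarrow> h p q = h (a, b) (c, d)"
    for h :: "'a \<times> 'a \<Rightarrow> 'a \<times> 'a \<Rightarrow> ('a \<times> 'a) set"
  proof -
    have "(a, b) \<in> fraction R a b" "(c, d) \<in> fraction R c d"
      using ab cd equiv_class_self[OF equiv_frac_rel] by (auto simp: fraction_def)
    with that show ?thesis by blast
  qed
  have D: "fst p \<in> carrier R" "snd p \<in> carrier R" "snd p \<noteq> \<zero>" "fst p \<otimes> s = r \<otimes> snd p"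
    if "p \<in> fraction R r s" for p r s
    using that by (auto simp: fraction_def frac_rel_def frac_pairs_def)
  have c: "a \<in> carrier R" "b \<in> carrier R" "b \<noteq> \<zero>" "c \<in> carrier R" "d \<in> carrier R" "d \<noteq> \<zero>"
    using ab cd by (auto simp: frac_pairs_def)
  have 1: "fraction R (fst p \<otimes> fst q) (snd p \<otimes> snd q) = fraction R (a \<otimes> c) (b \<otimes> d)"
    if p: "p \<in> fraction R a b" and q: "q \<in> fraction R c d" for p q
  proof -
    note D = D[OF p] D[OF q]
    have "fst p \<otimes> fst q \<otimes> (b \<otimes> d) = (fst p \<otimes> b) \<otimes> (fst q \<otimes> d)"
      using c D(1-3,5-7) by (simp add: m_ac)
    also have "\<dots> = a \<otimes> c \<otimes> (snd p \<otimes> snd q)"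
      unfolding D using c D(1-3,5-7) by (simp add: m_ac)
    finally show ?thesis
      using c D by (subst fraction_eq_iff) (auto simp: frac_pairs_def integral_iff)
  qed
  have 2: "fraction R (fst p \<otimes> snd q \<oplus> fst q \<otimes> snd p) (snd p \<otimes> snd q)
           = fraction R (a \<otimes> d \<oplus> c \<otimes> b) (b \<otimes> d)"
    if p: "p \<in> fraction R a b" and q: "q \<in> fraction R c d" for p q
  proof -
    note D = D[OF p] D[OF q]
    have "(fst p \<otimes> snd q \<oplus> fst q \<otimes> snd p) \<otimes> (b \<otimes> d)
          = (fst p \<otimes> b) \<otimes> (snd q \<otimes> d) \<oplus> (fst q \<otimes> d) \<otimes> (snd p \<otimes> b)"
      using c D(1-3,5-7) by (simp add: m_ac l_distr r_distr)
    also have "\<dots> = (a \<otimes> d \<oplus> c \<otimes> b) \<otimes> (snd p \<otimes> snd q)"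
      unfolding D using c D(1-3,5-7) by (simp add: m_ac l_distr r_distr)
    finally show ?thesis
      using c D by (subst fraction_eq_iff) (auto simp: frac_pairs_def integral_iff)
  qed
  show "fraction R a b \<otimes>\<^bsub>frac_field R\<^esub> fraction R c d = fraction R (a \<otimes> c) (b \<otimes> d)"
    unfolding frac_field_def monoid.simps using 1 by (subst U) auto
  show "fraction R a b \<oplus>\<^bsub>frac_field R\<^esub> fraction R c d
         = fraction R ((a \<otimes> d) \<oplus> (c \<otimes> b)) (b \<otimes> d)"
    unfolding frac_field_def ring.simps using 2 by (subst U) auto
qed

lemma frac_field_zero_one:
  "\<zero>\<^bsub>frac_field R\<^esub> = fraction R \<zero>\<^bsub>R\<^esub> \<one>\<^bsub>R\<^esub>" "\<one>\<^bsub>frac_field R\<^esub> = fraction R \<one>\<^bsub>R\<^esub> \<one>\<^bsub>R\<^esub>"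
  by (simp_all add: frac_field_def)

lemma (in domain) frac_pairs_intros:
  "a \<in> carrier R \<Longrightarrow> b \<in> carrier R \<Longrightarrow> b \<noteq> \<zero> \<Longrightarrow> (a, b) \<in> frac_pairs R"
  by (auto simp: frac_pairs_def)

lemma (in domain) field_frac_field: "field (frac_field R)"
proof -
  note simps = fraction_ops fraction_eq_iff frac_field_zero_one frac_pairs_intros integral_iff
  have cr: "cring (frac_field R)"
  proof (intro cringI abelian_groupI comm_monoidI)
    fix x y assume "x \<in> carrier (frac_field R)" "y \<in> carrier (frac_field R)"
    then obtain a b c d where "(a, b) \<in> frac_pairs R" "x = fraction R a b"
      "(c, d) \<in> frac_pairs R" "y = fraction R c d" by (elim frac_field_cases) blast
    then have xy: "a \<in> carrier R" "b \<in> carrier R" "b \<noteq> \<zero>" "c \<in> carrier R" "d \<in> carrier R" "d \<noteq> \<zero>"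
      "x = fraction R a b" "y = fraction R c d" by (auto simp: frac_pairs_def)
    show "x \<oplus>\<^bsub>frac_field R\<^esub> y \<in> carrier (frac_field R)"
      "x \<otimes>\<^bsub>frac_field R\<^esub> y \<in> carrier (frac_field R)"
      using xy by (auto simp: simps intro!: fraction_closed)
    show "x \<oplus>\<^bsub>frac_field R\<^esub> y = y \<oplus>\<^bsub>frac_field R\<^esub> x"
      using xy by (simp add: simps m_ac a_ac)
    show "x \<otimes>\<^bsub>frac_field R\<^esub> y = y \<otimes>\<^bsub>frac_field R\<^esub> x"
      using xy by (simp add: simps m_ac)
    show "\<zero>\<^bsub>frac_field R\<^esub> \<oplus>\<^bsub>frac_field R\<^esub> x = x"
      using xy by (simp add: simps)
    show "\<one>\<^bsub>frac_field R\<^esub> \<otimes>\<^bsub>frac_field R\<^esub> x = x"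
      using xy by (simp add: simps)
    have "fraction R (\<ominus> a) b \<in> carrier (frac_field R)"
      using xy by (auto simp: simps intro!: fraction_closed)
    moreover have "fraction R (\<ominus> a) b \<oplus>\<^bsub>frac_field R\<^esub> x = \<zero>\<^bsub>frac_field R\<^esub>"
      using xy by (simp add: simps l_minus l_neg)
    ultimately show "\<exists>y\<in>carrier (frac_field R). y \<oplus>\<^bsub>frac_field R\<^esub> x = \<zero>\<^bsub>frac_field R\<^esub>"
      by blast
    fix z assume "z \<in> carrier (frac_field R)"
    then obtain e f where "(e, f) \<in> frac_pairs R" "z = fraction R e f"
      by (elim frac_field_cases)
    then have z: "e \<in> carrier R" "f \<in> carrier R" "f \<noteq> \<zero>" "z = fraction R e f"
      by (auto simp: frac_pairs_def)
    show "x \<oplus>\<^bsub>frac_field R\<^esub> y \<oplus>\<^bsub>frac_field R\<^esub> z = x \<oplus>\<^bsub>frac_field R\<^esub> (y \<oplus>\<^bsub>frac_field R\<^esub> z)"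
      using xy z by (simp add: simps m_ac a_ac l_distr r_distr)
    show "x \<otimes>\<^bsub>frac_field R\<^esub> y \<otimes>\<^bsub>frac_field R\<^esub> z = x \<otimes>\<^bsub>frac_field R\<^esub> (y \<otimes>\<^bsub>frac_field R\<^esub> z)"
      using xy z by (simp add: simps m_ac)
    show "(x \<oplus>\<^bsub>frac_field R\<^esub> y) \<otimes>\<^bsub>frac_field R\<^esub> z
          = x \<otimes>\<^bsub>frac_field R\<^esub> z \<oplus>\<^bsub>frac_field R\<^esub> y \<otimes>\<^bsub>frac_field R\<^esub> z"
      using xy z by (simp add: simps m_ac a_ac l_distr r_distr)
  qed (auto simp: simps intro!: fraction_closed)
  show ?thesis
  proof (rule cring.cring_fieldI2[OF cr])
    show "\<zero>\<^bsub>frac_field R\<^esub> \<noteq> \<one>\<^bsub>frac_field R\<^esub>"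
      by (simp add: simps)
    fix x assume "x \<in> carrier (frac_field R)" "x \<noteq> \<zero>\<^bsub>frac_field R\<^esub>"
    then obtain a b where "(a, b) \<in> frac_pairs R" "x = fraction R a b"
      "fraction R a b \<noteq> \<zero>\<^bsub>frac_field R\<^esub>" by (elim frac_field_cases) blast
    then have x: "a \<in> carrier R" "b \<in> carrier R" "b \<noteq> \<zero>" "a \<noteq> \<zero>" "x = fraction R a b"
      by (auto simp: frac_pairs_def simps)
    then have "x \<otimes>\<^bsub>frac_field R\<^esub> fraction R b a = \<one>\<^bsub>frac_field R\<^esub>"
      by (simp add: simps m_ac)
    then show "\<exists>y\<in>carrier (frac_field R). x \<otimes>\<^bsub>frac_field R\<^esub> y = \<one>\<^bsub>frac_field R\<^esub>"
      using x by (auto intro!: bexI[of _ "fraction R b a"] fraction_closed frac_pairs_intros)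
  qed
qed

lemma (in domain) frac_embed_hom: "frac_embed R \<in> ring_hom R (frac_field R)"
  by (rule ring_hom_memI)
     (auto simp: frac_embed_def fraction_ops frac_field_zero_one frac_pairs_intros
           intro!: fraction_closed)

lemma (in domain) inj_frac_embed: "inj_on (frac_embed R) (carrier R)"
  by (auto simp: inj_on_def frac_embed_def fraction_eq_iff frac_pairs_intros)

definition integral_over :: "('k, 'r) ring_scheme \<Rightarrow> 'k set \<Rightarrow> 'k \<Rightarrow> bool" where
  "integral_over K S x \<longleftrightarrow>
     (\<exists>p \<in> carrier (univ_poly K S). p \<noteq> [] \<and> lead_coeff p = \<one>\<^bsub>K\<^esub> \<and> ring.eval K p x = \<zero>\<^bsub>K\<^esub>)"

definition integrally_closed :: "('a, 'r) ring_scheme \<Rightarrow> bool" where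
  "integrally_closed R \<longleftrightarrow>
     (\<forall>x \<in> carrier (frac_field R).
        integral_over (frac_field R) (frac_embed R ` carrier R) x \<longrightarrow> x \<in> frac_embed R ` carrier R)"

locale dedekind_domain = noetherian_domain +
  assumes integrally_closed: "integrally_closed R"
    and dimension_one: "krull_dimension R = 1"


section \<open>The ideal class group\<close>

definition fractional_ideals :: "('a, 'r) ring_scheme \<Rightarrow> ('a \<times> 'a) set set set" where
  "fractional_ideals R =
     {I. additive_subgroup I (frac_field R) \<and>
         (\<forall>r\<in>carrier R. \<forall>x\<in>I. frac_embed R r \<otimes>\<^bsub>frac_field R\<^esub> x \<in> I) \<and>
         I \<noteq> {\<zero>\<^bsub>frac_field R\<^esub>} \<and>
         (\<exists>d\<in>carrier R - {\<zero>\<^bsub>R\<^esub>}.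
            \<forall>x\<in>I. frac_embed R d \<otimes>\<^bsub>frac_field R\<^esub> x \<in> frac_embed R ` carrier R)}"

definition principal_fractional_ideals :: "('a, 'r) ring_scheme \<Rightarrow> ('a \<times> 'a) set set set" where
  "principal_fractional_ideals R =
     {(\<lambda>r. frac_embed R r \<otimes>\<^bsub>frac_field R\<^esub> x) ` carrier R | x.
        x \<in> carrier (frac_field R) - {\<zero>\<^bsub>frac_field R\<^esub>}}"

definition fractional_ideal_group :: "('a, 'r) ring_scheme \<Rightarrow> ('a \<times> 'a) set set monoid" where
  "fractional_ideal_group R =
     \<lparr> carrier = fractional_ideals R,
       monoid.mult = ideal_prod (frac_field R),
       one = frac_embed R ` carrier R \<rparr>"

definition ideal_class_group :: "('a, 'r) ring_scheme \<Rightarrow> ('a \<times> 'a) set set set monoid" where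
  "ideal_class_group R = fractional_ideal_group R Mod principal_fractional_ideals R"


section \<open>Modules and their profinite completions\<close>

definition submodule_span ::
  "('a, 'r) ring_scheme \<Rightarrow> ('a, 'm, 'e) module_scheme \<Rightarrow> 'm set \<Rightarrow> 'm set" where
  "submodule_span R M A = \<Inter>{H. submodule H R M \<and> A \<subseteq> H}"

definition finitely_generated_module ::
  "('a, 'r) ring_scheme \<Rightarrow> ('a, 'm, 'e) module_scheme \<Rightarrow> bool" where
  "finitely_generated_module R M \<longleftrightarrow>
     Module.module R M \<and>
     (\<exists>A. finite A \<and> A \<subseteq> carrier M \<and> carrier M = submodule_span R M A)"

definition mod_iso ::
  "('a, 'r) ring_scheme \<Rightarrow> ('a, 'm, 'e) module_scheme \<Rightarrow> ('a, 'n, 'f) module_scheme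
     \<Rightarrow> ('m \<Rightarrow> 'n) set" where
  "mod_iso R M N =
     {h \<in> iso (add_monoid M) (add_monoid N).
        \<forall>r\<in>carrier R. \<forall>x\<in>carrier M. h (r \<odot>\<^bsub>M\<^esub> x) = r \<odot>\<^bsub>N\<^esub> h x}"

definition mod_isomorphic ::
  "('a, 'r) ring_scheme \<Rightarrow> ('a, 'm, 'e) module_scheme \<Rightarrow> ('a, 'n, 'f) module_scheme \<Rightarrow> bool" where
  "mod_isomorphic R M N \<longleftrightarrow> mod_iso R M N \<noteq> {}"

text \<open>The ring multiplication and unit that the library's module record inherits play no role
  in a module; they are left undefined below.\<close>

definition quot_module :: "('a, 'm, 'e) module_scheme \<Rightarrow> 'm set \<Rightarrow> ('a, 'm set) module" where
  "quot_module M H =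
     \<lparr> carrier = a_rcosets\<^bsub>M\<^esub> H, monoid.mult = undefined, one = undefined,
       zero = H, add = set_add M,
       smult = (\<lambda>r C. \<Union>x\<in>C. H +>\<^bsub>M\<^esub> (r \<odot>\<^bsub>M\<^esub> x)) \<rparr>"

definition cofinite_submodules ::
  "('a, 'r) ring_scheme \<Rightarrow> ('a, 'm, 'e) module_scheme \<Rightarrow> 'm set set" where
  "cofinite_submodules R M =
     {H. submodule H R M \<and> finite (carrier (quot_module M H))}"

text \<open>For \<open>H \<subseteq> K\<close> the transition map from \<open>M/H\<close> to \<open>M/K\<close> is
  \<open>C \<mapsto> K + C\<close>.\<close>

definition completion_carrier ::
  "('a, 'r) ring_scheme \<Rightarrow> ('a, 'm, 'e) module_scheme \<Rightarrow> ('m set \<Rightarrow> 'm set) set" where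
  "completion_carrier R M =
     {x \<in> (\<Pi>\<^sub>E H \<in> cofinite_submodules R M. carrier (quot_module M H)).
        \<forall>H\<in>cofinite_submodules R M. \<forall>K\<in>cofinite_submodules R M.
          H \<subseteq> K \<longrightarrow> K <+>\<^bsub>M\<^esub> x H = x K}"

definition completion ::
  "('a, 'r) ring_scheme \<Rightarrow> ('a, 'm, 'e) module_scheme \<Rightarrow> ('a, 'm set \<Rightarrow> 'm set) module" where
  "completion R M =
     \<lparr> carrier = completion_carrier R M, monoid.mult = undefined, one = undefined,
       zero = (\<lambda>H\<in>cofinite_submodules R M. \<zero>\<^bsub>quot_module M H\<^esub>),
       add = (\<lambda>x y. \<lambda>H\<in>cofinite_submodules R M. x H \<oplus>\<^bsub>quot_module M H\<^esub> y H),
       smult = (\<lambda>r x. \<lambda>H\<in>cofinite_submodules R M. r \<odot>\<^bsub>quot_module M H\<^esub> x H) \<rparr>"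

definition completion_topology ::
  "('a, 'r) ring_scheme \<Rightarrow> ('a, 'm, 'e) module_scheme \<Rightarrow> ('m set \<Rightarrow> 'm set) topology" where
  "completion_topology R M =
     subtopology
       (product_topology (\<lambda>H. discrete_topology (carrier (quot_module M H)))
          (cofinite_submodules R M))
       (completion_carrier R M)"

definition completion_map ::
  "('a, 'r) ring_scheme \<Rightarrow> ('a, 'm, 'e) module_scheme \<Rightarrow> 'm \<Rightarrow> 'm set \<Rightarrow> 'm set" where
  "completion_map R M m = (\<lambda>H\<in>cofinite_submodules R M. H +>\<^bsub>M\<^esub> m)"

definition residually_finite ::
  "('a, 'r) ring_scheme \<Rightarrow> ('a, 'm, 'e) module_scheme \<Rightarrow> bool" where
  "residually_finite R M \<longleftrightarrow> inj_on (completion_map R M) (carrier M)"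

definition completions_isomorphic ::
  "('a, 'r) ring_scheme \<Rightarrow> ('a, 'm, 'e) module_scheme \<Rightarrow> ('a, 'n, 'f) module_scheme \<Rightarrow> bool" where
  "completions_isomorphic R M N \<longleftrightarrow>
     (\<exists>h \<in> mod_iso R (completion R M) (completion R N).
        homeomorphic_map (completion_topology R M) (completion_topology R N) h)"


lemma submodule_abelian_subgroup:
  assumes "Module.module R M" "submodule H R M"
  shows "abelian_subgroup H M"
proof -
  interpret Module.module R M by fact
  interpret submodule H R M by fact
  show ?thesis
    by (intro abelian_subgroupI3 additive_subgroupI subgroup_axioms abelian_group_axioms)
qed

lemma quot_module_smult:
  assumes "Module.module R M" "submodule H R M" "r \<in> carrier R" "x \<in> carrier M"
  shows "r \<odot>\<^bsub>quot_module M H\<^esub> (H +>\<^bsub>M\<^esub> x) = H +>\<^bsub>M\<^esub> (r \<odot>\<^bsub>M\<^esub> x)"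
proof -
  interpret Module.module R M by fact
  interpret H: abelian_subgroup H M by (rule submodule_abelian_subgroup[OF assms(1,2)])
  have "H +>\<^bsub>M\<^esub> (r \<odot>\<^bsub>M\<^esub> y) = H +>\<^bsub>M\<^esub> (r \<odot>\<^bsub>M\<^esub> x)" if y: "y \<in> H +>\<^bsub>M\<^esub> x" for y
  proof -
    obtain h where h: "h \<in> H" "y = h \<oplus>\<^bsub>M\<^esub> x"
      using y by (auto simp: a_r_coset_def')
    then have hM: "h \<in> carrier M" by (intro H.a_Hcarr)
    then have "r \<odot>\<^bsub>M\<^esub> y = r \<odot>\<^bsub>M\<^esub> h \<oplus>\<^bsub>M\<^esub> r \<odot>\<^bsub>M\<^esub> x"
      unfolding h(2) using assms(3,4) by (intro smult_r_distr)
    moreover have "r \<odot>\<^bsub>M\<^esub> h \<in> H"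
      by (rule submodule.smult_closed[OF assms(2,3) h(1)])
    ultimately have "r \<odot>\<^bsub>M\<^esub> y \<in> H +>\<^bsub>M\<^esub> (r \<odot>\<^bsub>M\<^esub> x)"
      unfolding a_r_coset_def' by blast
    then show ?thesis
      using M.a_repr_independence[OF _ smult_closed[OF assms(3,4)] H.a_subgroup] by simp
  qed
  moreover have "x \<in> H +>\<^bsub>M\<^esub> x"
    by (rule H.a_rcos_self[OF assms(4)])
  ultimately have "(\<Union>y\<in>H +>\<^bsub>M\<^esub> x. H +>\<^bsub>M\<^esub> (r \<odot>\<^bsub>M\<^esub> y)) = H +>\<^bsub>M\<^esub> (r \<odot>\<^bsub>M\<^esub> x)"
    by (metis (no_types, lifting) UN_constant_eq)
  then show ?thesis
    by (simp add: quot_module_def)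
qed

lemma quot_module_sel:
  "carrier (quot_module M H) = a_rcosets\<^bsub>M\<^esub> H"
  "\<zero>\<^bsub>quot_module M H\<^esub> = H"
  "x \<oplus>\<^bsub>quot_module M H\<^esub> y = x <+>\<^bsub>M\<^esub> y"
  by (simp_all add: quot_module_def)

lemma module_quot_module:
  assumes "Module.module R M" "submodule H R M"
  shows "Module.module R (quot_module M H)"
proof -
  interpret Module.module R M by fact
  interpret H: abelian_subgroup H M by (rule submodule_abelian_subgroup[OF assms])
  note sm = quot_module_smult[OF assms]
  have cases: "\<exists>x\<in>carrier M. C = H +>\<^bsub>M\<^esub> x" if "C \<in> a_rcosets\<^bsub>M\<^esub> H" for C
    using that by (auto simp: A_RCOSETS_def')
  have mem: "H +>\<^bsub>M\<^esub> x \<in> a_rcosets\<^bsub>M\<^esub> H" if "x \<in> carrier M" for x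
    using that by (auto simp: A_RCOSETS_def')
  note sum = H.a_rcos_sum
  have z: "H +>\<^bsub>M\<^esub> \<zero>\<^bsub>M\<^esub> = H"
    by (simp add: H.a_subset M.a_coset_add_zero)
  note qs = quot_module_sel
  show ?thesis
  proof (intro moduleI abelian_groupI)
    show "cring R" by (rule is_cring)
    show "\<zero>\<^bsub>quot_module M H\<^esub> \<in> carrier (quot_module M H)"
      using mem[OF M.zero_closed] z by (simp add: qs)
  next
    fix C D assume "C \<in> carrier (quot_module M H)" "D \<in> carrier (quot_module M H)"
    then show "C \<oplus>\<^bsub>quot_module M H\<^esub> D \<in> carrier (quot_module M H)"
      unfolding qs by (auto dest!: cases simp: sum mem)
  next
    fix C D E assume "C \<in> carrier (quot_module M H)" "D \<in> carrier (quot_module M H)"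
      "E \<in> carrier (quot_module M H)"
    then show "C \<oplus>\<^bsub>quot_module M H\<^esub> D \<oplus>\<^bsub>quot_module M H\<^esub> E
        = C \<oplus>\<^bsub>quot_module M H\<^esub> (D \<oplus>\<^bsub>quot_module M H\<^esub> E)"
      unfolding qs by (auto dest!: cases simp: sum M.a_assoc)
  next
    fix C D assume "C \<in> carrier (quot_module M H)" "D \<in> carrier (quot_module M H)"
    then show "C \<oplus>\<^bsub>quot_module M H\<^esub> D = D \<oplus>\<^bsub>quot_module M H\<^esub> C"
      unfolding qs by (auto dest!: cases simp: sum M.a_comm)
  next
    fix C assume "C \<in> carrier (quot_module M H)"
    then show "\<zero>\<^bsub>quot_module M H\<^esub> \<oplus>\<^bsub>quot_module M H\<^esub> C = C"
      using sum[OF M.zero_closed] z unfolding qs by (auto dest!: cases)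
  next
    fix C assume "C \<in> carrier (quot_module M H)"
    then obtain x where x: "x \<in> carrier M" "C = H +>\<^bsub>M\<^esub> x"
      unfolding qs by (auto dest!: cases)
    then have "(H +>\<^bsub>M\<^esub> \<ominus>\<^bsub>M\<^esub> x) <+>\<^bsub>M\<^esub> C = H"
      using sum[of "\<ominus>\<^bsub>M\<^esub> x" x] z by (simp add: M.l_neg)
    then show "\<exists>D\<in>carrier (quot_module M H). D \<oplus>\<^bsub>quot_module M H\<^esub> C = \<zero>\<^bsub>quot_module M H\<^esub>"
      unfolding qs using x mem[OF M.a_inv_closed] by blast
  next
    fix r C assume "r \<in> carrier R" "C \<in> carrier (quot_module M H)"
    then show "r \<odot>\<^bsub>quot_module M H\<^esub> C \<in> carrier (quot_module M H)"
      unfolding qs by (auto dest!: cases simp: sm mem)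
  next
    fix r s C assume "r \<in> carrier R" "s \<in> carrier R" "C \<in> carrier (quot_module M H)"
    then show "(r \<oplus>\<^bsub>R\<^esub> s) \<odot>\<^bsub>quot_module M H\<^esub> C
        = r \<odot>\<^bsub>quot_module M H\<^esub> C \<oplus>\<^bsub>quot_module M H\<^esub> s \<odot>\<^bsub>quot_module M H\<^esub> C"
      unfolding qs by (auto dest!: cases simp: sm sum smult_l_distr)
  next
    fix r C D assume "r \<in> carrier R" "C \<in> carrier (quot_module M H)" "D \<in> carrier (quot_module M H)"
    then show "r \<odot>\<^bsub>quot_module M H\<^esub> (C \<oplus>\<^bsub>quot_module M H\<^esub> D)
        = r \<odot>\<^bsub>quot_module M H\<^esub> C \<oplus>\<^bsub>quot_module M H\<^esub> r \<odot>\<^bsub>quot_module M H\<^esub> D"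
      unfolding qs by (auto dest!: cases simp: sm sum smult_r_distr)
  next
    fix r s C assume "r \<in> carrier R" "s \<in> carrier R" "C \<in> carrier (quot_module M H)"
    then show "r \<otimes>\<^bsub>R\<^esub> s \<odot>\<^bsub>quot_module M H\<^esub> C
        = r \<odot>\<^bsub>quot_module M H\<^esub> (s \<odot>\<^bsub>quot_module M H\<^esub> C)"
      unfolding qs by (auto dest!: cases simp: sm smult_assoc1)
  next
    fix C assume "C \<in> carrier (quot_module M H)"
    then show "\<one>\<^bsub>R\<^esub> \<odot>\<^bsub>quot_module M H\<^esub> C = C"
      unfolding qs by (auto dest!: cases simp: sm)
  qed
qed

lemma transition_map:
  assumes "Module.module R M" "submodule H R M" "submodule K R M" "H \<subseteq> K" "x \<in> carrier M"
  shows "K <+>\<^bsub>M\<^esub> (H +>\<^bsub>M\<^esub> x) = K +>\<^bsub>M\<^esub> x"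
proof -
  interpret Module.module R M by fact
  interpret H: abelian_subgroup H M by (rule submodule_abelian_subgroup[OF assms(1,2)])
  interpret K: abelian_subgroup K M by (rule submodule_abelian_subgroup[OF assms(1,3)])
  show ?thesis
  proof
    show "K <+>\<^bsub>M\<^esub> (H +>\<^bsub>M\<^esub> x) \<subseteq> K +>\<^bsub>M\<^esub> x"
    proof
      fix y assume "y \<in> K <+>\<^bsub>M\<^esub> (H +>\<^bsub>M\<^esub> x)"
      then obtain k h where kh: "k \<in> K" "h \<in> H" "y = k \<oplus>\<^bsub>M\<^esub> (h \<oplus>\<^bsub>M\<^esub> x)"
        by (auto simp: set_add_def' a_r_coset_def')
      then have "y = (k \<oplus>\<^bsub>M\<^esub> h) \<oplus>\<^bsub>M\<^esub> x"
        using assms K.a_Hcarr by (subst M.a_assoc) auto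
      moreover have "k \<oplus>\<^bsub>M\<^esub> h \<in> K"
        using kh assms by auto
      ultimately show "y \<in> K +>\<^bsub>M\<^esub> x"
        by (auto simp: a_r_coset_def')
    qed
    show "K +>\<^bsub>M\<^esub> x \<subseteq> K <+>\<^bsub>M\<^esub> (H +>\<^bsub>M\<^esub> x)"
    proof
      fix y assume "y \<in> K +>\<^bsub>M\<^esub> x"
      then obtain k where "k \<in> K" "y = k \<oplus>\<^bsub>M\<^esub> x"
        by (auto simp: a_r_coset_def')
      then show "y \<in> K <+>\<^bsub>M\<^esub> (H +>\<^bsub>M\<^esub> x)"
        using H.a_rcos_self[OF assms(5)] by (auto simp: set_add_def')
    qed
  qed
qed

lemma module_completion:
  assumes M: "Module.module R M"
  shows "Module.module R (completion R M)"
    and "m \<in> carrier M \<Longrightarrow> completion_map R M m \<in> carrier (completion R M)"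
proof -
  interpret Module.module R M by fact
  let ?I = "cofinite_submodules R M"
  have sub: "submodule H R M" if "H \<in> ?I" for H
    using that by (simp add: cofinite_submodules_def)
  note Q = module_quot_module[OF M sub]
  have add_zero: "H +>\<^bsub>M\<^esub> \<zero>\<^bsub>M\<^esub> = H" if "H \<in> ?I" for H
    using submoduleE(1)[OF sub[OF that]] by (rule M.a_coset_add_zero)
  have tr0: "K <+>\<^bsub>M\<^esub> H = K" if "H \<in> ?I" "K \<in> ?I" "H \<subseteq> K" for H K
    using transition_map[OF M sub[OF that(1)] sub[OF that(2)] that(3) M.zero_closed]
      add_zero[OF that(1)] add_zero[OF that(2)] by simp
  have E: "x \<in> (\<Pi>\<^sub>E H \<in> ?I. carrier (quot_module M H))" "H \<in> ?I \<Longrightarrow> x H \<in> carrier (quot_module M H)"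
    if "x \<in> completion_carrier R M" for x H
    using that by (auto simp: completion_carrier_def)
  have rep: "\<exists>a\<in>carrier M. x H = H +>\<^bsub>M\<^esub> a \<and> x K = K +>\<^bsub>M\<^esub> a"
    if x: "x \<in> completion_carrier R M" and HK: "H \<in> ?I" "K \<in> ?I" "H \<subseteq> K" for x H K
  proof -
    obtain a where a: "a \<in> carrier M" "x H = H +>\<^bsub>M\<^esub> a"
      using E(2)[OF x HK(1)] by (auto simp: quot_module_sel A_RCOSETS_def')
    moreover have "x K = K <+>\<^bsub>M\<^esub> x H"
      using x HK by (auto simp: completion_carrier_def)
    ultimately show ?thesis
      using transition_map[OF M sub[OF HK(1)] sub[OF HK(2)] HK(3)] by auto
  qed
  note sum = abelian_subgroup.a_rcos_sum[OF submodule_abelian_subgroup[OF M sub]]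
  have add_closed: "(\<lambda>H\<in>?I. x H \<oplus>\<^bsub>quot_module M H\<^esub> y H) \<in> completion_carrier R M"
    if xy: "x \<in> completion_carrier R M" "y \<in> completion_carrier R M" for x y
    unfolding completion_carrier_def
  proof (intro CollectI conjI ballI impI)
    show "(\<lambda>H\<in>?I. x H \<oplus>\<^bsub>quot_module M H\<^esub> y H) \<in> (\<Pi>\<^sub>E H \<in> ?I. carrier (quot_module M H))"
      using xy E(2) by (auto intro!: abelian_groupE(1) module.axioms(2) Q)
    fix H K assume HK: "H \<in> ?I" "K \<in> ?I" "H \<subseteq> K"
    obtain a b where ab: "a \<in> carrier M" "b \<in> carrier M"
      "x H = H +>\<^bsub>M\<^esub> a" "x K = K +>\<^bsub>M\<^esub> a" "y H = H +>\<^bsub>M\<^esub> b" "y K = K +>\<^bsub>M\<^esub> b"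
      using rep[OF xy(1) HK] rep[OF xy(2) HK] by auto
    show "K <+>\<^bsub>M\<^esub> (\<lambda>H\<in>?I. x H \<oplus>\<^bsub>quot_module M H\<^esub> y H) H
        = (\<lambda>H\<in>?I. x H \<oplus>\<^bsub>quot_module M H\<^esub> y H) K"
      using HK ab transition_map[OF M sub[OF HK(1)] sub[OF HK(2)] HK(3)]
      by (simp add: quot_module_sel sum)
  qed
  have smult_closed: "(\<lambda>H\<in>?I. r \<odot>\<^bsub>quot_module M H\<^esub> x H) \<in> completion_carrier R M"
    if x: "x \<in> completion_carrier R M" and r: "r \<in> carrier R" for x r
    unfolding completion_carrier_def
  proof (intro CollectI conjI ballI impI)
    show "(\<lambda>H\<in>?I. r \<odot>\<^bsub>quot_module M H\<^esub> x H) \<in> (\<Pi>\<^sub>E H \<in> ?I. carrier (quot_module M H))"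
      using x r E(2) by (auto intro!: module.smult_closed Q)
    fix H K assume HK: "H \<in> ?I" "K \<in> ?I" "H \<subseteq> K"
    obtain a where a: "a \<in> carrier M" "x H = H +>\<^bsub>M\<^esub> a" "x K = K +>\<^bsub>M\<^esub> a"
      using rep[OF x HK] by auto
    show "K <+>\<^bsub>M\<^esub> (\<lambda>H\<in>?I. r \<odot>\<^bsub>quot_module M H\<^esub> x H) H = (\<lambda>H\<in>?I. r \<odot>\<^bsub>quot_module M H\<^esub> x H) K"
      using HK a r transition_map[OF M sub[OF HK(1)] sub[OF HK(2)] HK(3)]
      by (simp add: quot_module_smult[OF M sub])
  qed
  have zero_closed: "(\<lambda>H\<in>?I. \<zero>\<^bsub>quot_module M H\<^esub>) \<in> completion_carrier R M"
    unfolding completion_carrier_def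
  proof (intro CollectI conjI ballI impI)
    show "(\<lambda>H\<in>?I. \<zero>\<^bsub>quot_module M H\<^esub>) \<in> (\<Pi>\<^sub>E H \<in> ?I. carrier (quot_module M H))"
      using abelian_groupE(2)[OF module.axioms(2)[OF Q]] by simp
    fix H K assume "H \<in> ?I" "K \<in> ?I" "H \<subseteq> K"
    then show "K <+>\<^bsub>M\<^esub> (\<lambda>H\<in>?I. \<zero>\<^bsub>quot_module M H\<^esub>) H = (\<lambda>H\<in>?I. \<zero>\<^bsub>quot_module M H\<^esub>) K"
      using tr0 by (simp add: quot_module_sel(2))
  qed
  have ext: "x = y" if "x \<in> completion_carrier R M" "y \<in> extensional ?I"
    "\<And>H. H \<in> ?I \<Longrightarrow> x H = y H" for x y
    using that by (intro extensionalityI[of x ?I y]) (auto simp: completion_carrier_def PiE_def)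
  note qs = module.smult_l_distr[OF Q] module.smult_r_distr[OF Q] module.smult_assoc1[OF Q]
    module.smult_one[OF Q] module.smult_closed[OF Q]
    abelian_groupE(1,3,4,5)[OF module.axioms(2)[OF Q]] 
  show "Module.module R (completion R M)"
  proof (intro moduleI abelian_groupI)
    fix x assume "x \<in> carrier (completion R M)"
    then have x: "x \<in> completion_carrier R M"
      by (simp add: completion_def)
    have "(\<lambda>H\<in>?I. (\<ominus>\<^bsub>R\<^esub> \<one>\<^bsub>R\<^esub>) \<odot>\<^bsub>quot_module M H\<^esub> x H) \<in> completion_carrier R M"
      using x by (intro smult_closed) auto
    moreover have "(\<lambda>H\<in>?I. (\<ominus>\<^bsub>R\<^esub> \<one>\<^bsub>R\<^esub>) \<odot>\<^bsub>quot_module M H\<^esub> x H) \<oplus>\<^bsub>completion R M\<^esub> x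
        = \<zero>\<^bsub>completion R M\<^esub>"
    proof -
      have "(\<ominus>\<^bsub>R\<^esub> \<one>\<^bsub>R\<^esub>) \<odot>\<^bsub>quot_module M H\<^esub> x H \<oplus>\<^bsub>quot_module M H\<^esub> x H = \<zero>\<^bsub>quot_module M H\<^esub>"
        if H: "H \<in> ?I" for H
      proof -
        interpret Q: Module.module R "quot_module M H" by (rule Q[OF H])
        show ?thesis
          using E(2)[OF x H] Q.smult_l_minus[of "\<one>\<^bsub>R\<^esub>" "x H"] by (simp add: Q.M.l_neg)
      qed
      then show ?thesis
        by (simp add: completion_def cong: restrict_cong)
    qed
    ultimately show "\<exists>y\<in>carrier (completion R M). y \<oplus>\<^bsub>completion R M\<^esub> x = \<zero>\<^bsub>completion R M\<^esub>"
      unfolding completion_def[of R M, THEN arg_cong[of _ _ carrier], simplified] by blast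
  next
    fix x assume "x \<in> carrier (completion R M)"
    then have x: "x \<in> completion_carrier R M"
      by (simp add: completion_def)
    show "\<zero>\<^bsub>completion R M\<^esub> \<oplus>\<^bsub>completion R M\<^esub> x = x"
      by (rule ext[symmetric])
         (use x E(2)[OF x] in \<open>auto simp: completion_def abelian_groupE(5)[OF module.axioms(2)[OF Q]]\<close>)
    show "\<one>\<^bsub>R\<^esub> \<odot>\<^bsub>completion R M\<^esub> x = x"
      by (rule ext[symmetric]) (use x E(2)[OF x] in \<open>auto simp: completion_def qs\<close>)
  next
    fix x y z assume "x \<in> carrier (completion R M)" "y \<in> carrier (completion R M)"
      "z \<in> carrier (completion R M)"
    then have "x H \<in> carrier (quot_module M H)" "y H \<in> carrier (quot_module M H)"
      "z H \<in> carrier (quot_module M H)" if "H \<in> ?I" for H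
      using E(2) that by (auto simp: completion_def)
    then show "x \<oplus>\<^bsub>completion R M\<^esub> y \<oplus>\<^bsub>completion R M\<^esub> z
        = x \<oplus>\<^bsub>completion R M\<^esub> (y \<oplus>\<^bsub>completion R M\<^esub> z)"
      by (simp add: completion_def abelian_groupE(3)[OF module.axioms(2)[OF Q]] cong: restrict_cong)
  qed (auto simp: completion_def add_closed smult_closed zero_closed E qs is_cring
         cong: restrict_cong)
  show "completion_map R M m \<in> carrier (completion R M)" if m: "m \<in> carrier M"
    using m transition_map[OF M sub sub]
    by (auto simp: completion_map_def completion_def completion_carrier_def quot_module_sel
        A_RCOSETS_def')
qed

lemma mod_isomorphic_refl: "mod_isomorphic R M M"
proof -
  have "id \<in> mod_iso R M M"
    by (auto simp: mod_iso_def iso_def hom_def)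
  then show ?thesis
    by (auto simp: mod_isomorphic_def)
qed

lemma mod_isomorphic_sym:
  assumes M: "Module.module R M" and "mod_isomorphic R M N"
  shows "mod_isomorphic R N M"
proof -
  interpret Module.module R M by fact
  obtain h where h: "h \<in> mod_iso R M N"
    using assms by (auto simp: mod_isomorphic_def)
  then have iso: "h \<in> iso (add_monoid M) (add_monoid N)" and bij: "bij_betw h (carrier M) (carrier N)"
    and smult: "\<And>r x. r \<in> carrier R \<Longrightarrow> x \<in> carrier M \<Longrightarrow> h (r \<odot>\<^bsub>M\<^esub> x) = r \<odot>\<^bsub>N\<^esub> h x"
    by (auto simp: mod_iso_def iso_def)
  let ?g = "inv_into (carrier M) h"
  have "?g \<in> iso (add_monoid N) (add_monoid M)"
    using group.iso_set_sym[OF M.a_group iso] by simp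
  moreover have "?g (r \<odot>\<^bsub>N\<^esub> y) = r \<odot>\<^bsub>M\<^esub> ?g y" if "r \<in> carrier R" "y \<in> carrier N" for r y
  proof -
    have y: "?g y \<in> carrier M" "h (?g y) = y"
      using that bij by (auto simp: bij_betw_def inv_into_into f_inv_into_f)
    then have "r \<odot>\<^bsub>N\<^esub> y = h (r \<odot>\<^bsub>M\<^esub> ?g y)"
      using smult that by simp
    then show ?thesis
      using bij y that by (simp add: bij_betw_def)
  qed
  ultimately show ?thesis
    by (auto simp: mod_isomorphic_def mod_iso_def)
qed

lemma mod_isomorphic_trans:
  assumes "mod_isomorphic R L M" "mod_isomorphic R M N"
  shows "mod_isomorphic R L N"
proof -
  obtain g h where gh: "g \<in> mod_iso R L M" "h \<in> mod_iso R M N"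
    using assms by (auto simp: mod_isomorphic_def)
  then have "h \<circ> g \<in> iso (add_monoid L) (add_monoid N)"
    using iso_set_trans by (auto simp: mod_iso_def)
  then have "h \<circ> g \<in> mod_iso R L N"
    using gh by (auto simp: mod_iso_def iso_def hom_def Pi_iff)
  then show ?thesis
    by (auto simp: mod_isomorphic_def)
qed


section \<open>A universe for finitely generated modules\<close>

definition transported_module ::
  "('a, 'm, 'e) module_scheme \<Rightarrow> ('m \<Rightarrow> 'n) \<Rightarrow> ('a, 'n) module" where
  "transported_module M f =
     \<lparr> carrier = f ` carrier M, monoid.mult = undefined, one = undefined,
       zero = f \<zero>\<^bsub>M\<^esub>,
       add = (\<lambda>u v. f (inv_into (carrier M) f u \<oplus>\<^bsub>M\<^esub> inv_into (carrier M) f v)),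
       smult = (\<lambda>r u. f (r \<odot>\<^bsub>M\<^esub> inv_into (carrier M) f u)) \<rparr>"

lemma transported_module:
  assumes M: "Module.module R M" and f: "inj_on f (carrier M)"
  shows "Module.module R (transported_module M f)"
    and "f \<in> mod_iso R M (transported_module M f)"
proof -
  interpret Module.module R M by fact
  let ?N = "transported_module M f"
  have sel: "carrier ?N = f ` carrier M" "\<zero>\<^bsub>?N\<^esub> = f \<zero>\<^bsub>M\<^esub>"
    by (simp_all add: transported_module_def)
  have ops: "f x \<oplus>\<^bsub>?N\<^esub> f y = f (x \<oplus>\<^bsub>M\<^esub> y)" "r \<odot>\<^bsub>?N\<^esub> f x = f (r \<odot>\<^bsub>M\<^esub> x)"
    if "x \<in> carrier M" "y \<in> carrier M" for x y r
    using that f by (simp_all add: transported_module_def)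
  show "Module.module R ?N"
  proof (intro moduleI abelian_groupI)
    fix u assume "u \<in> carrier ?N"
    then obtain x where x: "x \<in> carrier M" "u = f x"
      by (auto simp: sel)
    then have "f (\<ominus>\<^bsub>M\<^esub> x) \<oplus>\<^bsub>?N\<^esub> u = \<zero>\<^bsub>?N\<^esub>"
      by (simp add: ops sel M.l_neg)
    then show "\<exists>v\<in>carrier ?N. v \<oplus>\<^bsub>?N\<^esub> u = \<zero>\<^bsub>?N\<^esub>"
      using x by (metis M.a_inv_closed imageI sel(1))
  qed (auto simp: sel ops M.a_ac smult_l_distr smult_r_distr smult_assoc1 is_cring)
  show "f \<in> mod_iso R M ?N"
    using f by (auto simp: mod_iso_def iso_def hom_def bij_betw_def sel ops)
qed

lemma finitely_generated_module_iso:
  assumes M: "finitely_generated_module R M" and N: "Module.module R N" and f: "f \<in> mod_iso R M N"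
  shows "finitely_generated_module R N"
proof -
  interpret M: Module.module R M using M by (simp add: finitely_generated_module_def)
  interpret N: Module.module R N by fact
  obtain A where A: "finite A" "A \<subseteq> carrier M" "carrier M = submodule_span R M A"
    using M by (auto simp: finitely_generated_module_def)
  have f': "f ` carrier M = carrier N" "f (x \<oplus>\<^bsub>M\<^esub> y) = f x \<oplus>\<^bsub>N\<^esub> f y"
    "f (r \<odot>\<^bsub>M\<^esub> x) = r \<odot>\<^bsub>N\<^esub> f x" "f x \<in> carrier N"
    if "x \<in> carrier M" "y \<in> carrier M" "r \<in> carrier R" for x y r
    using f that by (auto simp: mod_iso_def iso_def hom_def bij_betw_def)
  have surj: "f ` carrier M = carrier N"
    using f by (auto simp: mod_iso_def iso_def bij_betw_def)
  have f0: "f \<zero>\<^bsub>M\<^esub> = \<zero>\<^bsub>N\<^esub>"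
    using f'(3,4)[OF M.M.zero_closed M.M.zero_closed M.R.zero_closed] by simp
  have "carrier N = submodule_span R N (f ` A)"
  proof
    show "submodule_span R N (f ` A) \<subseteq> carrier N"
      unfolding submodule_span_def using N.carrier_is_submodule A(2) surj by blast
    show "carrier N \<subseteq> submodule_span R N (f ` A)"
      unfolding submodule_span_def
    proof (rule Inter_greatest)
      fix H assume "H \<in> {H. submodule H R N \<and> f ` A \<subseteq> H}"
      then have H: "submodule H R N" "f ` A \<subseteq> H" by auto
      have "submodule {x \<in> carrier M. f x \<in> H} R M"
      proof (rule M.submoduleI)
        have z: "\<zero>\<^bsub>N\<^esub> \<in> H"
          using subgroup.one_closed[OF submodule.axioms(1)[OF H(1)]] by simp
        then show "\<zero>\<^bsub>M\<^esub> \<in> {x \<in> carrier M. f x \<in> H}"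
          by (simp add: f0)
        show sm: "r \<odot>\<^bsub>M\<^esub> x \<in> {x \<in> carrier M. f x \<in> H}"
          if "r \<in> carrier R" "x \<in> {x \<in> carrier M. f x \<in> H}" for r x
          using that N.submoduleE(4)[OF H(1)] by (auto simp: f')
        show "x \<oplus>\<^bsub>M\<^esub> y \<in> {x \<in> carrier M. f x \<in> H}"
          if "x \<in> {x \<in> carrier M. f x \<in> H}" "y \<in> {x \<in> carrier M. f x \<in> H}" for x y
          using that N.submoduleE(5)[OF H(1)] f'(2)[OF _ _ M.R.zero_closed] by auto
        show "\<ominus>\<^bsub>M\<^esub> x \<in> {x \<in> carrier M. f x \<in> H}" if "x \<in> {x \<in> carrier M. f x \<in> H}" for x
          using sm[OF M.R.a_inv_closed[OF M.R.one_closed] that] that M.smult_l_minus[of "\<one>\<^bsub>R\<^esub>" x]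
          by simp
      qed auto
      moreover have "A \<subseteq> {x \<in> carrier M. f x \<in> H}"
        using A(2) H(2) by auto
      ultimately have "submodule_span R M A \<subseteq> {x \<in> carrier M. f x \<in> H}"
        unfolding submodule_span_def by (intro Inter_lower) simp
      then have "f ` carrier M \<subseteq> H"
        unfolding A(3)[symmetric] by auto
      then show "carrier N \<subseteq> H"
        by (simp only: surj)
    qed
  qed
  then show ?thesis
    unfolding finitely_generated_module_def using N A(1,2) surj by blast
qed

fun lincomb :: "('a, 'm, 'e) module_scheme \<Rightarrow> 'a list \<Rightarrow> 'm list \<Rightarrow> 'm" where
  "lincomb M (r # rs) (x # xs) = r \<odot>\<^bsub>M\<^esub> x \<oplus>\<^bsub>M\<^esub> lincomb M rs xs"
| "lincomb M _ _ = \<zero>\<^bsub>M\<^esub>"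

context Module.module
begin

lemma lincomb_closed [simp]:
  "set rs \<subseteq> carrier R \<Longrightarrow> set xs \<subseteq> carrier M \<Longrightarrow> lincomb M rs xs \<in> carrier M"
  by (induction rs xs rule: list_induct2') auto

lemma lincomb_add:
  "set rs \<subseteq> carrier R \<Longrightarrow> set ss \<subseteq> carrier R \<Longrightarrow> set xs \<subseteq> carrier M \<Longrightarrow>
     \<exists>ts. set ts \<subseteq> carrier R \<and> lincomb M ts xs = lincomb M rs xs \<oplus>\<^bsub>M\<^esub> lincomb M ss xs"
proof (induction xs arbitrary: rs ss)
  case Nil
  then show ?case by (intro exI[of _ "[]"]) auto
next
  case (Cons x xs)
  show ?case
  proof (cases "rs = [] \<or> ss = []")
    case True
    then show ?thesis
      using Cons.prems lincomb_closed[of rs "x # xs"] lincomb_closed[of ss "x # xs"]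
      by (auto simp del: lincomb_closed)
  next
    case False
    then obtain r rs' s ss' where rs: "rs = r # rs'" "ss = s # ss'"
      by (meson neq_Nil_conv)
    then obtain ts where "set ts \<subseteq> carrier R"
      "lincomb M ts xs = lincomb M rs' xs \<oplus>\<^bsub>M\<^esub> lincomb M ss' xs"
      using Cons.IH[of rs' ss'] Cons.prems by auto
    then show ?thesis
      using rs Cons.prems
      by (intro exI[of _ "(r \<oplus> s) # ts"]) (auto simp: smult_l_distr M.a_ac)
  qed
qed

lemma lincomb_smult:
  "r \<in> carrier R \<Longrightarrow> set rs \<subseteq> carrier R \<Longrightarrow> set xs \<subseteq> carrier M \<Longrightarrow>
     lincomb M (map ((\<otimes>) r) rs) xs = r \<odot>\<^bsub>M\<^esub> lincomb M rs xs"
  by (induction rs xs rule: list_induct2') (auto simp: smult_r_distr smult_assoc1)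

lemma lincomb_unit:
  "x \<in> set xs \<Longrightarrow> set xs \<subseteq> carrier M \<Longrightarrow> \<exists>rs. set rs \<subseteq> carrier R \<and> lincomb M rs xs = x"
proof (induction xs)
  case (Cons y ys)
  show ?case
  proof (cases "x = y")
    case True
    then show ?thesis
      using Cons.prems by (intro exI[of _ "[\<one>]"]) auto
  next
    case False
    then obtain rs where "set rs \<subseteq> carrier R" "lincomb M rs ys = x"
      using Cons by auto
    then show ?thesis
      using Cons.prems False by (intro exI[of _ "\<zero> # rs"]) auto
  qed
qed auto

lemma submodule_lincombs:
  assumes xs: "set xs \<subseteq> carrier M"
  shows "submodule {lincomb M rs xs | rs. set rs \<subseteq> carrier R} R M"
proof (rule submoduleI)
  let ?L = "{lincomb M rs xs | rs. set rs \<subseteq> carrier R}"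
  show sub: "?L \<subseteq> carrier M"
    using xs by auto
  show "\<zero>\<^bsub>M\<^esub> \<in> ?L"
    by (auto intro!: exI[of _ "[]"])
  show sm: "r \<odot>\<^bsub>M\<^esub> x \<in> ?L" if "r \<in> carrier R" "x \<in> ?L" for r x
  proof -
    obtain rs where rs: "set rs \<subseteq> carrier R" "x = lincomb M rs xs"
      using \<open>x \<in> ?L\<close> by auto
    have "r \<odot>\<^bsub>M\<^esub> x = lincomb M (map ((\<otimes>) r) rs) xs"
      using lincomb_smult[OF \<open>r \<in> carrier R\<close> rs(1) xs] rs by simp
    moreover have "set (map ((\<otimes>) r) rs) \<subseteq> carrier R"
      using \<open>r \<in> carrier R\<close> rs by auto
    ultimately show ?thesis by blast
  qed
  show "x \<oplus>\<^bsub>M\<^esub> y \<in> ?L" if "x \<in> ?L" "y \<in> ?L" for x y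
  proof -
    obtain rs ss where "set rs \<subseteq> carrier R" "x = lincomb M rs xs"
      "set ss \<subseteq> carrier R" "y = lincomb M ss xs"
      using \<open>x \<in> ?L\<close> \<open>y \<in> ?L\<close> by auto
    then obtain ts where "set ts \<subseteq> carrier R" "lincomb M ts xs = x \<oplus>\<^bsub>M\<^esub> y"
      using lincomb_add[OF _ _ xs] by blast
    then show ?thesis
      by (intro CollectI exI[of _ ts]) simp
  qed
  show "\<ominus>\<^bsub>M\<^esub> x \<in> ?L" if "x \<in> ?L" for x
  proof -
    have "x \<in> carrier M"
      using sub that by blast
    then have "\<ominus>\<^bsub>M\<^esub> x = (\<ominus> \<one>) \<odot>\<^bsub>M\<^esub> x"
      using smult_l_minus[of \<one> x] by simp
    with sm[OF R.a_inv_closed[OF R.one_closed] that] show ?thesis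
      by (simp only:)
  qed
qed

end

lemma finitely_generated_module_representative:
  fixes R :: "('a, 'r) ring_scheme" and M :: "('a, 'm, 'e) module_scheme"
  assumes M: "finitely_generated_module R M"
  shows "\<exists>N :: ('a, 'a list set) module. finitely_generated_module R N \<and> mod_isomorphic R M N"
proof -
  have mod: "Module.module R M"
    using M by (simp add: finitely_generated_module_def)
  interpret Module.module R M by fact
  obtain A where A: "finite A" "A \<subseteq> carrier M" "carrier M = submodule_span R M A"
    using M by (auto simp: finitely_generated_module_def)
  obtain xs where xs: "set xs = A"
    using A(1) finite_list by blast
  have "submodule {lincomb M rs xs | rs. set rs \<subseteq> carrier R} R M"
    using A xs by (intro submodule_lincombs) auto
  moreover have "A \<subseteq> {lincomb M rs xs | rs. set rs \<subseteq> carrier R}"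
    using lincomb_unit[of _ xs] A xs by blast
  ultimately have "submodule_span R M A \<subseteq> {lincomb M rs xs | rs. set rs \<subseteq> carrier R}"
    unfolding submodule_span_def by (intro Inter_lower) simp
  then have gen: "carrier M \<subseteq> {lincomb M rs xs | rs. set rs \<subseteq> carrier R}"
    unfolding A(3)[symmetric] .
  define f where "f m = {rs. set rs \<subseteq> carrier R \<and> lincomb M rs xs = m}" for m
  have "inj_on f (carrier M)"
  proof (rule inj_onI)
    fix x y assume "x \<in> carrier M" "y \<in> carrier M" "f x = f y"
    moreover obtain rs where "rs \<in> f x"
      using gen \<open>x \<in> carrier M\<close> by (auto simp: f_def)
    ultimately show "x = y"
      by (auto simp: f_def)
  qed
  note T = transported_module[OF mod this]
  have "mod_isomorphic R M (transported_module M f)"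
    using T(2) by (auto simp: mod_isomorphic_def)
  with finitely_generated_module_iso[OF M T] show ?thesis by blast
qed


section \<open>The profinite genus\<close>

text \<open>The type \<open>'n\<close> of the elements of the modules \<open>N\<close> is a parameter, independent of
  \<open>'m\<close>. By \<open>finitely_generated_module_representative\<close>, for \<open>'n = 'a list set\<close>
  every finitely generated module over \<open>R\<close> has an isomorphic copy among the \<open>N\<close>, so this
  instance is the whole genus; a statement for arbitrary \<open>'n\<close> covers it.\<close>

definition genus_modules ::
  "('a, 'r) ring_scheme \<Rightarrow> ('a, 'm, 'e) module_scheme \<Rightarrow> ('a, 'n) module set" where
  "genus_modules R M =
     {N. finitely_generated_module R N \<and> residually_finite R N \<and> completions_isomorphic R M N}"

definition profinite_genus ::
  "('a, 'r) ring_scheme \<Rightarrow> ('a, 'm, 'e) module_scheme \<Rightarrow> ('a, 'n) module set set" where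
  "profinite_genus R M =
     genus_modules R M //
       {(N, N'). N \<in> genus_modules R M \<and> N' \<in> genus_modules R M \<and> mod_isomorphic R N N'}"

lemma equiv_genus:
  "equiv (genus_modules R M)
     {(N, N'). N \<in> genus_modules R M \<and> N' \<in> genus_modules R M \<and> mod_isomorphic R N N'}"
  by (rule equivI)
     (auto simp: refl_on_def sym_def trans_def mod_isomorphic_refl genus_modules_def
        finitely_generated_module_def intro: mod_isomorphic_sym mod_isomorphic_trans)

end

theory Submission imports Defs
begin

text \<open>
  A finitely generated module \<open>N\<close> over a Dedekind domain \<open>R\<close> is its torsion submodule plus
  \<open>R\<^sup>n\<^sup>-\<^sup>1\<close> plus an ideal \<open>I\<close> (Steinitz), where \<open>n\<close> is the rank; for
  \<open>n = 0\<close> it is torsion. Isomorphic ideals give isomorphic modules. So once the torsion submodule and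
  the rank are known to be the same for all modules of a genus, the class of \<open>I\<close> determines the
  module, and choosing one \<open>I\<close> for each isomorphism class of the genus gives an injection into the
  class group: two modules with the same value have ideals in the same class and are therefore
  isomorphic.

  The normal form rests on the fact that nonzero ideals are invertible
  (\<open>nonzero_ideal_invertible\<close>). Invertibility makes them projective
  (\<open>section_of_functional\<close>), so that functionals split off ideals as direct summands
  (\<open>peels\<close>, \<open>exists_peels\<close>), and it makes it possible to move an ideal within its class so that it
  becomes coprime to another one (\<open>functional_with_coprime_image\<close>). The latter turns a sum
  \<open>A \<oplus> B\<close> of two ideals into \<open>R \<oplus> A'\<close> (\<open>peels_first_ideal_to_ring\<close>,
  \<open>peels_steinitz\<close>). Two modules with the same list of ideals and isomorphic torsion are isomorphic
  (\<open>isomorphism_from_peels\<close>).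

  The completion determines the torsion submodule and the rank by the following arguments, which use
  that the modules of a genus are residually finite. A torsion element of such a module has an annihilator
  of finite index, so the torsion submodule is finite (\<open>cofinite_ideal_if_intersection\<close>,
  \<open>finite_torsion\<close>). It is recovered from the completion as the set of elements that are killed
  by a nonzero ideal of finite index (\<open>completion_map_torsion\<close>). For the rank, let \<open>J\<close> be a
  nonzero proper ideal of finite index. The number of elements of \<open>N / J N\<close> depends only on the
  completion, because \<open>N\<close> is dense in it
  (\<open>card_reduction_le_if_completions_isomorphic\<close>), and it is the number of elements of
  \<open>T / J T\<close>, where \<open>T\<close> is the torsion submodule, times the \<open>n\<close>-th power of the
  number of elements of \<open>R / J\<close> (\<open>card_reduction_peels\<close>, \<open>peels_length_unique\<close>).
\<close>

section \<open>Ideals in noetherian rings and in domains of dimension one\<close>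

lemma (in cring) ideal_by_closure:
  assumes "I \<subseteq> carrier R" "\<zero> \<in> I" "\<And>a b. a \<in> I \<Longrightarrow> b \<in> I \<Longrightarrow> a \<oplus> b \<in> I"
    "\<And>r a. r \<in> carrier R \<Longrightarrow> a \<in> I \<Longrightarrow> r \<otimes> a \<in> I"
  shows "ideal I R"
proof (rule idealI)
  show "ring R" by (rule ring_axioms)
  have neg: "\<ominus> a \<in> I" if "a \<in> I" for a
    using assms(4)[of "\<ominus> \<one>" a] assms(1) that by (auto simp: l_minus)
  show "subgroup I (add_monoid R)"
    using assms neg by (intro subgroup.intro) (auto simp: a_inv_def)
  show "x \<otimes> a \<in> I" if "a \<in> I" "x \<in> carrier R" for a x
    using assms that by blast
  show "a \<otimes> x \<in> I" if "a \<in> I" "x \<in> carrier R" for a x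
    using assms that m_comm[of a x] by (auto simp: subset_iff)
qed

lemma (in cring) ideal_closure:
  assumes "ideal I R"
  shows "I \<subseteq> carrier R" "\<zero> \<in> I" "\<And>a b. a \<in> I \<Longrightarrow> b \<in> I \<Longrightarrow> a \<oplus> b \<in> I"
    "\<And>r a. r \<in> carrier R \<Longrightarrow> a \<in> I \<Longrightarrow> r \<otimes> a \<in> I"
    "\<And>r a. r \<in> carrier R \<Longrightarrow> a \<in> I \<Longrightarrow> a \<otimes> r \<in> I"
    "\<And>a. a \<in> I \<Longrightarrow> \<ominus> a \<in> I" "\<And>a b. a \<in> I \<Longrightarrow> b \<in> I \<Longrightarrow> a \<ominus> b \<in> I"
proof -
  interpret ideal I R by fact
  show "I \<subseteq> carrier R" "\<zero> \<in> I" "\<And>a b. a \<in> I \<Longrightarrow> b \<in> I \<Longrightarrow> a \<oplus> b \<in> I"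
    "\<And>r a. r \<in> carrier R \<Longrightarrow> a \<in> I \<Longrightarrow> r \<otimes> a \<in> I"
    "\<And>r a. r \<in> carrier R \<Longrightarrow> a \<in> I \<Longrightarrow> a \<otimes> r \<in> I"
    "\<And>a. a \<in> I \<Longrightarrow> \<ominus> a \<in> I"  "\<And>a b. a \<in> I \<Longrightarrow> b \<in> I \<Longrightarrow> a \<ominus> b \<in> I"
    using a_subset I_l_closed I_r_closed by (auto simp: a_minus_def)
qed

lemma (in noetherian_ring) maximal_among_ideals:
  assumes "S \<noteq> {}" "S \<subseteq> {I. ideal I R}"
  shows "\<exists>I\<in>S. \<forall>J\<in>S. I \<subseteq> J \<longrightarrow> J = I"
proof (rule subset_Zorn_nonempty)
  fix C assume C: "C \<noteq> {}" "subset.chain S C"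
  then have "subset.chain {I. ideal I R} C"
    using assms(2) by (auto simp: pred_on.chain_def)
  from ideal_chain_is_trivial[OF C(1) this] show "\<Union>C \<in> S"
    using C(2) by (auto simp: pred_on.chain_def)
qed fact

lemma (in noetherian_ring) noetherian_induct [consumes 1, case_names step]:
  assumes "ideal I R" "\<And>I. ideal I R \<Longrightarrow> (\<And>J. ideal J R \<Longrightarrow> I \<subset> J \<Longrightarrow> P J) \<Longrightarrow> P I"
  shows "P I"
proof (rule ccontr)
  assume "\<not> P I"
  then have "{I. ideal I R \<and> \<not> P I} \<noteq> {}"
    using assms(1) by auto
  from maximal_among_ideals[OF this] obtain J where J: "ideal J R" "\<not> P J"
    "\<And>K. ideal K R \<Longrightarrow> \<not> P K \<Longrightarrow> J \<subseteq> K \<Longrightarrow> K = J"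
    by auto
  with assms(2)[of J] show False
    by auto
qed

lemma (in noetherian_ring) exists_maximalideal:
  assumes "ideal I R" "I \<noteq> carrier R"
  shows "\<exists>P. maximalideal P R \<and> I \<subseteq> P"
proof -
  have "\<exists>P\<in>{J. ideal J R \<and> I \<subseteq> J \<and> J \<noteq> carrier R}.
      \<forall>J\<in>{J. ideal J R \<and> I \<subseteq> J \<and> J \<noteq> carrier R}. P \<subseteq> J \<longrightarrow> J = P"
    using assms by (intro maximal_among_ideals) auto
  then obtain P where P: "ideal P R" "I \<subseteq> P" "P \<noteq> carrier R"
    "\<And>J. ideal J R \<Longrightarrow> I \<subseteq> J \<Longrightarrow> J \<noteq> carrier R \<Longrightarrow> P \<subseteq> J \<Longrightarrow> J = P"
    unfolding Bex_def Ball_def mem_Collect_eq by metis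
  have "maximalideal P R"
  proof (rule maximalidealI)
    fix J assume J: "ideal J R" "P \<subseteq> J" "J \<subseteq> carrier R"
    show "J = P \<or> J = carrier R"
      using P(4)[OF J(1) _ _ J(2)] P(2) J(2) by auto
  qed (use P in auto)
  with P show ?thesis by blast
qed

lemma enat_le_krull_dimension:
  assumes "Ps \<noteq> []" "\<And>P. P \<in> set Ps \<Longrightarrow> primeideal P R" "sorted_wrt (\<subset>) Ps"
  shows "enat (length Ps - 1) \<le> krull_dimension R"
  unfolding krull_dimension_def using assms by (intro SUP_upper) auto

context dedekind_domain
begin

text \<open>A nonzero prime \<open>P\<close> strictly below a maximal ideal \<open>Q\<close> would give
a chain \<open>{\<zero>} \<subset> P \<subset> Q\<close> of length two.\<close>

lemma nonzero_prime_is_maximal: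
  assumes "primeideal P R" "P \<noteq> {\<zero>}"
  shows "maximalideal P R"
proof -
  have P: "ideal P R" "P \<noteq> carrier R" "\<zero> \<in> P"
    using assms(1) ideal_closure(2) by (auto simp: primeideal_def primeideal_axioms_def)
  then obtain Q where Q: "maximalideal Q R" "P \<subseteq> Q"
    using exists_maximalideal by blast
  have "P = Q"
  proof (rule ccontr)
    assume "P \<noteq> Q"
    then have "sorted_wrt (\<subset>) [{\<zero>}, P, Q]"
      using Q assms P by auto
    moreover have "primeideal Q R"
      using Q(1) by (rule maximalideal_prime)
    ultimately have "enat (length [{\<zero>}, P, Q] - 1) \<le> krull_dimension R"
      using assms zeroprimeideal by (intro enat_le_krull_dimension) auto
    then show False
      by (simp add: dimension_one one_enat_def)
  qed
  with Q show ?thesis by simp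
qed

text \<open>A ring without such an ideal has \<open>{\<zero>}\<close> as its only prime, hence dimension
zero. Used to replace the zero ideal by a nonzero one when counting cosets.\<close>

lemma exists_nonzero_proper_ideal: "\<exists>P. ideal P R \<and> P \<noteq> {\<zero>} \<and> P \<noteq> carrier R"
proof (rule ccontr)
  assume *: "\<not> ?thesis"
  have "krull_dimension R \<le> 0"
    unfolding krull_dimension_def
  proof (rule SUP_least)
    fix Ps assume "Ps \<in> {Ps. Ps \<noteq> [] \<and> (\<forall>P\<in>set Ps. primeideal P R) \<and> sorted_wrt (\<subset>) Ps}"
    then have Ps: "\<And>P. P \<in> set Ps \<Longrightarrow> primeideal P R" "sorted_wrt (\<subset>) Ps"
      by auto
    have zero: "P = {\<zero>}" if "P \<in> set Ps" for P
      using Ps(1)[OF that] * by (auto simp: primeideal_def primeideal_axioms_def)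
    have "length Ps \<le> 1"
    proof (rule ccontr)
      assume "\<not> length Ps \<le> 1"
      then have "Ps ! 0 \<subset> Ps ! 1" "Ps ! 0 \<in> set Ps" "Ps ! 1 \<in> set Ps"
        using sorted_wrt_nth_less[OF Ps(2), of 0 1] by (auto intro!: nth_mem)
      then show False
        using zero by (metis less_irrefl)
    qed
    then show "enat (length Ps - 1) \<le> 0"
      by (simp add: enat_0)
  qed
  then show False
    by (simp add: dimension_one)
qed

text \<open>Noetherian induction: if \<open>C\<close> is proper and not prime, then some product
\<open>a \<otimes> b\<close> lies in \<open>C\<close> while \<open>a\<close> and \<open>b\<close> do
not, and every prime over \<open>C\<close> lies over one of the larger ideals \<open>C + (a)\<close>
and \<open>C + (b)\<close>. If \<open>C\<close> is prime, it is maximal.\<close>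

lemma finite_primes_over:
  assumes "ideal C R" "C \<noteq> {\<zero>}"
  shows "finite {P. primeideal P R \<and> C \<subseteq> P}"
  using assms
proof (induction rule: noetherian_induct)
  case (step C)
  note id = step(1)
  consider "C = carrier R" | "primeideal C R" | "C \<noteq> carrier R" "\<not> primeideal C R" by blast
  then show ?case
  proof cases
    case 1
    then have "\<not> C \<subseteq> P" if "primeideal P R" for P
      using that ideal_closure(1)[of P] by (auto simp: primeideal_def primeideal_axioms_def)
    then have "{P. primeideal P R \<and> C \<subseteq> P} = {}"
      by blast
    then show ?thesis by (simp only: finite.emptyI)
  next
    case 2
    then have "P = C" if "primeideal P R" "C \<subseteq> P" for P
      using nonzero_prime_is_maximal[OF 2 step(3)] that
      by (auto simp: primeideal_def primeideal_axioms_def maximalideal_def maximalideal_axioms_def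
          dest: ideal_closure(1))
    then have "{P. primeideal P R \<and> C \<subseteq> P} \<subseteq> {C}" by auto
    then show ?thesis
      using finite_subset by blast
  next
    case 3
    then obtain a b where ab: "a \<in> carrier R" "b \<in> carrier R" "a \<otimes> b \<in> C" "a \<notin> C" "b \<notin> C"
      using ideal.primeidealCD[OF id is_cring] by auto
    have fin: "finite {P. primeideal P R \<and> C <+>\<^bsub>R\<^esub> PIdl c \<subseteq> P}" if c: "c \<in> carrier R" "c \<notin> C" for c
    proof (rule step(2))
      show id': "ideal (C <+>\<^bsub>R\<^esub> PIdl c) R"
        using add_ideals[OF id cgenideal_ideal[OF c(1)]] .
      have "x \<in> C <+>\<^bsub>R\<^esub> PIdl c" if "x \<in> C" for x
      proof -
        have "x \<oplus> \<zero> \<in> C <+>\<^bsub>R\<^esub> PIdl c"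
          using that ideal_closure(2)[OF cgenideal_ideal[OF c(1)]] by (auto simp: set_add_def')
        then show ?thesis
          using that ideal_closure(1)[OF id] by (auto simp: subset_iff)
      qed
      moreover have "\<zero> \<oplus> c \<in> C <+>\<^bsub>R\<^esub> PIdl c"
        using cgenideal_self[OF c(1)] ideal_closure(2)[OF id] by (auto simp: set_add_def')
      ultimately show "C \<subset> C <+>\<^bsub>R\<^esub> PIdl c"
        using c by auto
      then show "C <+>\<^bsub>R\<^esub> PIdl c \<noteq> {\<zero>}"
        using step.prems ideal_closure(2)[OF id] by auto
    qed
    have sub: "C <+>\<^bsub>R\<^esub> PIdl c \<subseteq> P" if P: "primeideal P R" "C \<subseteq> P" "c \<in> P" for c P
    proof -
      interpret P: primeideal P R by fact
      show ?thesis
        using P(2) cgenideal_minimal[OF P.is_ideal P(3)] P.a_closed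
        by (auto simp: set_add_def')
    qed
    have "{P. primeideal P R \<and> C \<subseteq> P}
        \<subseteq> {P. primeideal P R \<and> C <+>\<^bsub>R\<^esub> PIdl a \<subseteq> P} \<union> {P. primeideal P R \<and> C <+>\<^bsub>R\<^esub> PIdl b \<subseteq> P}"
    proof
      fix P assume "P \<in> {P. primeideal P R \<and> C \<subseteq> P}"
      then have P: "primeideal P R" "C \<subseteq> P" by auto
      then have "a \<in> P \<or> b \<in> P"
        using ab primeideal.I_prime[OF P(1), of a b] by auto
      then show "P \<in> {P. primeideal P R \<and> C <+>\<^bsub>R\<^esub> PIdl a \<subseteq> P}
          \<union> {P. primeideal P R \<and> C <+>\<^bsub>R\<^esub> PIdl b \<subseteq> P}"
        using sub[OF P] P(1) by blast
    qed
    then show ?thesis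
      using fin[OF ab(1,4)] fin[OF ab(2,5)] by (meson finite_Un finite_subset)
  qed
qed

end

section \<open>Invertibility of ideals\<close>

lemma (in ring) eval_map_mult:
  assumes "set q \<subseteq> carrier R" "r \<in> carrier R" "x \<in> carrier R"
  shows "eval (map ((\<otimes>) r) q) x = r \<otimes> eval q x"
  using assms by (induction q) (auto simp: r_distr m_assoc eval_in_carrier)

lemma (in ring) eval_map2_add:
  assumes "length p = length q" "set p \<subseteq> carrier R" "set q \<subseteq> carrier R" "x \<in> carrier R"
  shows "eval (map2 (\<oplus>) p q) x = eval p x \<oplus> eval q x"
  using assms
proof (induction p q rule: list_induct2)
  case (Cons a p b q)
  then have "eval (map2 (\<oplus>) (a # p) (b # q)) x
      = (a \<otimes> x [^] length q \<oplus> b \<otimes> x [^] length q) \<oplus> (eval p x \<oplus> eval q x)"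
    by (simp add: l_distr)
  also have "\<dots> = eval (a # p) x \<oplus> eval (b # q) x"
    using Cons by (simp add: eval_in_carrier a_ac)
  finally show ?case .
qed simp

context dedekind_domain
begin

text \<open>In the fraction field, \<open>x = b / d\<close> satisfies
\<open>x A \<subseteq> A\<close>, and this forces \<open>x\<close> to be integral over
\<open>R\<close>. Fix \<open>a0 \<noteq> \<zero>\<close> in \<open>A\<close>; then
\<open>x^k a0\<close> lies in \<open>A\<close> for every \<open>k\<close>. The elements of
\<open>R\<close> of the form \<open>q(x) a0\<close>, where \<open>q\<close> has \<open>k\<close>
coefficients in \<open>R\<close>, form an ideal \<open>U k\<close>. These ideals ascend, so
\<open>U (k + 1) = U k\<close> for some \<open>k\<close>, and then \<open>x^k a0\<close>, which
lies in \<open>U (k + 1)\<close>, equals \<open>q(x) a0\<close> with \<open>q\<close> of degree less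
than \<open>k\<close>. Cancelling \<open>a0\<close> leaves a monic equation for
\<open>x\<close>.\<close>

lemma multiplier_of_ideal_in_ring:
  assumes A: "ideal A R" "A \<noteq> {\<zero>}" and b: "b \<in> carrier R" and d: "d \<in> carrier R" "d \<noteq> \<zero>"
    and mult: "\<And>a. a \<in> A \<Longrightarrow> \<exists>a'\<in>A. d \<otimes> a' = b \<otimes> a"
  shows "\<exists>c\<in>carrier R. b = d \<otimes> c"
proof -
  define K where "K = frac_field R"
  define e where "e = frac_embed R"
  interpret K: field K unfolding K_def by (rule field_frac_field)
  interpret e: ring_hom_ring R K e
    unfolding K_def e_def using K.ring_axioms[unfolded K_def] frac_embed_hom
    by (intro ring_hom_ringI2 ring_axioms)
  have e_inj: "e u = e v \<longleftrightarrow> u = v" if "u \<in> carrier R" "v \<in> carrier R" for u v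
    using inj_frac_embed that by (auto simp: e_def inj_on_def)
  define S where "S = e ` carrier R"
  have S: "S \<subseteq> carrier K" by (auto simp: S_def)
  define x where "x = fraction R b d"
  have x: "x \<in> carrier K" "e d \<otimes>\<^bsub>K\<^esub> x = e b"
    using b d by (auto simp: x_def K_def e_def frac_embed_def fraction_ops frac_pairs_intros
        fraction_eq_iff m_ac intro!: fraction_closed)
  have ed: "e d \<in> carrier K" "e d \<noteq> \<zero>\<^bsub>K\<^esub>"
    using d e_inj[of d \<zero>] by auto
  obtain a0 where a0: "a0 \<in> A" "a0 \<noteq> \<zero>"
    using A ideal_closure(2) by blast
  obtain f where f: "\<And>a. a \<in> A \<Longrightarrow> f a \<in> A \<and> d \<otimes> f a = b \<otimes> a"
    using mult by metis
  define a where "a k = (f ^^ k) a0" for k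
  have a: "a k \<in> A" for k
    by (induction k) (auto simp: a_def a0 f)
  have AR: "A \<subseteq> carrier R" using A ideal_closure by auto
  then have aR: "a k \<in> carrier R" for k using a by auto
  have ea0: "e a0 \<in> carrier K" "e a0 \<noteq> \<zero>\<^bsub>K\<^esub>"
    using a0 e_inj[of a0 \<zero>] AR by auto
  \<comment> \<open>\<open>a k\<close> is \<open>x^k a0\<close>, computed inside \<open>A\<close>\<close>
  have ea: "e (a k) = x [^]\<^bsub>K\<^esub> k \<otimes>\<^bsub>K\<^esub> e a0" for k
  proof (induction k)
    case 0
    then show ?case using ea0 by (simp add: a_def)
  next
    case (Suc k)
    have "e d \<otimes>\<^bsub>K\<^esub> e (a (Suc k)) = e (d \<otimes> f (a k))"
      using aR[of "Suc k"] d by (simp add: a_def)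
    also have "\<dots> = e (b \<otimes> a k)"
      using f[OF a[of k]] by simp
    also have "\<dots> = e b \<otimes>\<^bsub>K\<^esub> e (a k)"
      using b aR[of k] by simp
    also have "\<dots> = e d \<otimes>\<^bsub>K\<^esub> (x [^]\<^bsub>K\<^esub> Suc k \<otimes>\<^bsub>K\<^esub> e a0)"
      unfolding x(2)[symmetric] Suc using x(1) ed ea0
      by (simp only: K.m_ac K.m_closed K.nat_pow_closed K.nat_pow_Suc)
    finally show ?case
      using ed x ea0 aR[of "Suc k"] by (subst (asm) K.m_lcancel) auto
  qed
  define U where "U k = {y \<in> carrier R.
      \<exists>q. set q \<subseteq> S \<and> length q = k \<and> e y = K.eval q x \<otimes>\<^bsub>K\<^esub> e a0}" for k
  have U_I: "y \<in> U k" if "y \<in> carrier R" "set q \<subseteq> S" "length q = k"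
    "e y = K.eval q x \<otimes>\<^bsub>K\<^esub> e a0" for y q k
    using that unfolding U_def by blast
  have eS: "\<zero>\<^bsub>K\<^esub> \<in> S" "\<one>\<^bsub>K\<^esub> \<in> S"
    using imageI[of \<zero> "carrier R" e] imageI[of \<one> "carrier R" e] by (auto simp: S_def)
  have ev: "K.eval q x \<in> carrier K" if "set q \<subseteq> S" for q
    using that S x by (intro K.eval_in_carrier) auto
  have U: "ideal (U k) R" for k
  proof (rule ideal_by_closure)
    show "U k \<subseteq> carrier R" by (auto simp: U_def)
    have "K.eval (replicate k \<zero>\<^bsub>K\<^esub>) x = \<zero>\<^bsub>K\<^esub>"
      using x by (induction k) auto
    then show "\<zero> \<in> U k"
      using ea0 eS by (intro U_I[where q = "replicate k \<zero>\<^bsub>K\<^esub>"]) (simp_all add: set_replicate_conv_if)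
    show "y \<oplus> z \<in> U k" if yz: "y \<in> U k" "z \<in> U k" for y z
    proof -
      obtain p q where pq: "set p \<subseteq> S" "length p = k" "e y = K.eval p x \<otimes>\<^bsub>K\<^esub> e a0"
        "set q \<subseteq> S" "length q = k" "e z = K.eval q x \<otimes>\<^bsub>K\<^esub> e a0"
        using yz by (auto simp: U_def)
      have yzR: "y \<in> carrier R" "z \<in> carrier R" using yz by (auto simp: U_def)
      have "u \<oplus>\<^bsub>K\<^esub> v \<in> S" if "u \<in> S" "v \<in> S" for u v
        using that by (auto simp: S_def simp flip: e.hom_add)
      then have "set (map2 (\<oplus>\<^bsub>K\<^esub>) p q) \<subseteq> S"
        using pq(1,4) by (auto simp: subset_iff) (meson set_zip_leftD set_zip_rightD)
      moreover have "K.eval (map2 (\<oplus>\<^bsub>K\<^esub>) p q) x \<otimes>\<^bsub>K\<^esub> e a0 = e (y \<oplus> z)"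
        using pq S x ea0 yzR ev
        by (subst K.eval_map2_add) (auto simp: K.l_distr)
      ultimately show ?thesis
        using yzR pq by (intro U_I[where q = "map2 (\<oplus>\<^bsub>K\<^esub>) p q"]) simp_all
    qed
    show "r \<otimes> y \<in> U k" if r: "r \<in> carrier R" and y: "y \<in> U k" for r y
    proof -
      obtain p where p: "set p \<subseteq> S" "length p = k" "e y = K.eval p x \<otimes>\<^bsub>K\<^esub> e a0"
        using y by (auto simp: U_def)
      have yR: "y \<in> carrier R" using y by (auto simp: U_def)
      have "e r \<otimes>\<^bsub>K\<^esub> u \<in> S" if "u \<in> S" for u
        using that r by (auto simp: S_def simp flip: e.hom_mult)
      then have "set (map ((\<otimes>\<^bsub>K\<^esub>) (e r)) p) \<subseteq> S"
        using p by auto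
      moreover have "K.eval (map ((\<otimes>\<^bsub>K\<^esub>) (e r)) p) x \<otimes>\<^bsub>K\<^esub> e a0 = e (r \<otimes> y)"
        using p S x ea0 yR ev r
        by (subst K.eval_map_mult) (auto simp: K.m_assoc)
      ultimately show ?thesis
        using yR p r by (intro U_I[where q = "map ((\<otimes>\<^bsub>K\<^esub>) (e r)) p"]) simp_all
    qed
  qed
  have U_mono: "U k \<subseteq> U (Suc k)" for k
  proof
    fix y assume "y \<in> U k"
    then obtain q where q: "set q \<subseteq> S" "length q = k" "e y = K.eval q x \<otimes>\<^bsub>K\<^esub> e a0" "y \<in> carrier R"
      by (auto simp: U_def)
    then show "y \<in> U (Suc k)"
      using ev[OF q(1)] eS x by (intro U_I[where q = "\<zero>\<^bsub>K\<^esub> # q"]) simp_all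
  qed
  \<comment> \<open>the monomial of degree \<open>k\<close> has \<open>Suc k\<close> coefficients\<close>
  have aU: "a k \<in> U (Suc k)" for k
  proof -
    have "K.eval (replicate k \<zero>\<^bsub>K\<^esub>) x = \<zero>\<^bsub>K\<^esub>"
      using x by (induction k) auto
    then show ?thesis
      using aR[of k] ea[of k] eS x
      by (intro U_I[where q = "\<one>\<^bsub>K\<^esub> # replicate k \<zero>\<^bsub>K\<^esub>"]) (simp_all add: set_replicate_conv_if)
  qed
  have "\<exists>I\<in>range U. \<forall>J\<in>range U. I \<subseteq> J \<longrightarrow> J = I"
    using U by (intro maximal_among_ideals) auto
  then obtain k where "\<forall>J\<in>range U. U k \<subseteq> J \<longrightarrow> J = U k"
    by (elim bexE rangeE) simp
  then have "U (Suc k) = U k"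
    using U_mono by simp
  then obtain q where q: "set q \<subseteq> S" "length q = k" "e (a k) = K.eval q x \<otimes>\<^bsub>K\<^esub> e a0"
    using aU[of k] by (auto simp: U_def)
  then have xk: "x [^]\<^bsub>K\<^esub> k = K.eval q x"
    using ea[of k] ea0 ev[OF q(1)] x by (auto simp: K.m_rcancel)
  define q' where "q' = map ((\<otimes>\<^bsub>K\<^esub>) (e (\<ominus> \<one>))) q"
  have "e (\<ominus> \<one>) \<otimes>\<^bsub>K\<^esub> u \<in> S" if "u \<in> S" for u
    using that by (auto simp: S_def simp del: e.hom_a_inv simp flip: e.hom_mult)
  then have q'S: "set q' \<subseteq> S"
    using q by (auto simp: q'_def)
  have "K.eval q' x = e (\<ominus> \<one>) \<otimes>\<^bsub>K\<^esub> K.eval q x"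
    unfolding q'_def using q(1) S x by (intro K.eval_map_mult) auto
  then have "K.eval (\<one>\<^bsub>K\<^esub> # q') x = \<zero>\<^bsub>K\<^esub>"
    using xk q(2) ev[OF q(1)] x by (simp add: q'_def K.l_minus K.r_neg)
  then have "integral_over K S x"
    using q'S eS unfolding integral_over_def
    by (intro bexI[of _ "\<one>\<^bsub>K\<^esub> # q'"]) (auto simp: univ_poly_def polynomial_def)
  then have "x \<in> S"
    using integrally_closed x by (auto simp: integrally_closed_def K_def S_def e_def)
  then obtain c where c: "c \<in> carrier R" "x = e c"
    by (auto simp: S_def)
  then have "e (d \<otimes> c) = e b"
    using x d by simp
  then have "d \<otimes> c = b"
    using e_inj[of "d \<otimes> c" b] c d b by simp
  then show ?thesis
    using c by blast
qed

end

lemma (in cring) mem_PIdl_iff: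
  assumes "d \<in> carrier R"
  shows "x \<in> PIdl d \<longleftrightarrow> (\<exists>c\<in>carrier R. x = d \<otimes> c)"
  using assms by (auto simp: cgenideal_def m_comm)

lemma (in cring) PIdl_ideal_prod:
  assumes "d \<in> carrier R" "e \<in> carrier R"
  shows "(PIdl d) \<cdot> (PIdl e) = PIdl (d \<otimes> e)"
proof
  have de: "d \<otimes> e \<in> carrier R" using assms by simp
  note c = ideal_closure[OF cgenideal_ideal[OF de]]
  show "(PIdl d) \<cdot> (PIdl e) \<subseteq> PIdl (d \<otimes> e)"
  proof
    fix x assume "x \<in> (PIdl d) \<cdot> (PIdl e)"
    then show "x \<in> PIdl (d \<otimes> e)"
    proof induction
      case (prod i j)
      then obtain r s where rs: "r \<in> carrier R" "s \<in> carrier R" "i = d \<otimes> r" "j = e \<otimes> s"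
        using assms by (auto simp: mem_PIdl_iff)
      have "i \<otimes> j = (d \<otimes> e) \<otimes> (r \<otimes> s)"
        unfolding rs(3,4) using rs(1,2) assms by (simp add: m_ac)
      then show ?case
        using rs(1,2) mem_PIdl_iff[OF de] by blast
    qed (rule c(3))
  qed
  show "PIdl (d \<otimes> e) \<subseteq> (PIdl d) \<cdot> (PIdl e)"
  proof
    fix x assume "x \<in> PIdl (d \<otimes> e)"
    then obtain r where r: "r \<in> carrier R" "x = d \<otimes> (e \<otimes> r)"
      using assms by (auto simp: mem_PIdl_iff m_assoc)
    then show "x \<in> (PIdl d) \<cdot> (PIdl e)"
      using assms mem_PIdl_iff cgenideal_self by (auto intro!: ideal_prod.prod)
  qed
qed

context dedekind_domain
begin

text \<open>The element is found at a maximal ideal \<open>P\<close> over \<open>A\<close>: among the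
ideals \<open>Q b = (dR : b)\<close> contained in \<open>P\<close> choose a maximal one. It is
prime, because replacing \<open>b\<close> by a multiple that enlarges \<open>Q b\<close> leads out of
\<open>P\<close>. It contains \<open>d\<close>, so in dimension one it is \<open>P\<close> itself, and
\<open>A \<subseteq> P = (dR : b)\<close>. The fraction \<open>b / d\<close> then belongs to the
inverse of \<open>A\<close> but not to \<open>R\<close>.\<close>

lemma exists_multiplier_outside_ring:
  assumes A: "ideal A R" "A \<noteq> carrier R" and d: "d \<in> A" "d \<noteq> \<zero>"
  shows "\<exists>b\<in>carrier R. b \<notin> PIdl d \<and> (\<forall>a\<in>A. a \<otimes> b \<in> PIdl d)"
proof -
  have dR: "d \<in> carrier R" using A d ideal_closure by auto
  define D where "D = PIdl d"
  have D: "ideal D R" unfolding D_def by (rule cgenideal_ideal[OF dR])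
  note Dc = ideal_closure[OF D]
  obtain P where P: "maximalideal P R" "A \<subseteq> P"
    using exists_maximalideal[OF A] by blast
  then interpret P: primeideal P R by (intro maximalideal_prime)
  define Q where "Q b = {r \<in> carrier R. r \<otimes> b \<in> D}" for b
  have Q: "ideal (Q b) R" if "b \<in> carrier R" for b
    using that Dc by (intro ideal_by_closure) (auto simp: Q_def l_distr m_assoc)
  have Q_mono: "Q b \<subseteq> Q (b \<otimes> s)" if "b \<in> carrier R" "s \<in> carrier R" for b s
    using that Dc(5) unfolding Q_def by (simp add: subset_iff m_assoc[symmetric])
  have mem: "x \<in> Q (b \<otimes> s) \<longleftrightarrow> x \<otimes> s \<in> Q b"
    if "b \<in> carrier R" "s \<in> carrier R" "x \<in> carrier R" for b s x
    using that by (simp add: Q_def m_ac)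
  have "D \<subseteq> P"
    using P d unfolding D_def by (intro cgenideal_minimal) (auto simp: P.is_ideal)
  then have one: "Q \<one> \<subseteq> P"
    by (auto simp: Q_def)
  define W where "W = {b \<in> carrier R. Q b \<subseteq> P}"
  have "\<exists>I\<in>Q ` W. \<forall>J\<in>Q ` W. I \<subseteq> J \<longrightarrow> J = I"
  proof (rule maximal_among_ideals)
    show "Q ` W \<noteq> {}" using one by (auto simp: W_def)
    show "Q ` W \<subseteq> {I. ideal I R}" using Q by (auto simp: W_def)
  qed
  then have "\<exists>b\<in>W. \<forall>c\<in>W. Q b \<subseteq> Q c \<longrightarrow> Q c = Q b"
    by simp
  then obtain b where bX: "b \<in> W" and maxX: "\<forall>c\<in>W. Q b \<subseteq> Q c \<longrightarrow> Q c = Q b" ..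
  have b: "b \<in> carrier R" "Q b \<subseteq> P"
    using bX by (simp_all add: W_def)
  have max: "Q c = Q b" if "c \<in> carrier R" "Q c \<subseteq> P" "Q b \<subseteq> Q c" for c
    using maxX that by (simp add: W_def)
  \<comment> \<open>by maximality, a proper enlargement of \<open>Q b\<close> contains an element outside \<open>P\<close>\<close>
  have leave: "\<exists>s\<in>carrier R - P. s \<otimes> x \<in> Q b" if "x \<in> carrier R" "y \<in> carrier R"
    "y \<otimes> x \<in> Q b" "y \<notin> Q b" for x y
  proof -
    have "Q (b \<otimes> x) \<noteq> Q b"
      using that mem[of b x y] b by auto
    then have "\<not> Q (b \<otimes> x) \<subseteq> P"
      using max[of "b \<otimes> x"] Q_mono[of b x] that b by auto
    then obtain s where "s \<in> Q (b \<otimes> x)" "s \<notin> P" "s \<in> carrier R"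
      by (auto simp: Q_def)
    then show ?thesis
      using mem b that by blast
  qed
  have "primeideal (Q b) R"
  proof (rule primeidealI)
    show "ideal (Q b) R" "cring R" using Q b is_cring by auto
    show "carrier R \<noteq> Q b" using b P.I_notcarr P.a_subset by blast
    fix x y assume xy: "x \<in> carrier R" "y \<in> carrier R" "x \<otimes> y \<in> Q b"
    show "x \<in> Q b \<or> y \<in> Q b"
    proof (rule ccontr)
      assume n: "\<not> (x \<in> Q b \<or> y \<in> Q b)"
      have "y \<otimes> x \<in> Q b" using xy by (simp add: m_comm)
      then obtain s where s: "s \<in> carrier R" "s \<notin> P" "s \<otimes> x \<in> Q b"
        using leave[of x y] xy n by auto
      have "x \<otimes> s \<in> Q b" using s xy by (simp add: m_comm)
      then obtain t where t: "t \<in> carrier R" "t \<notin> P" "t \<otimes> s \<in> Q b"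
        using leave[of s x] xy n s by auto
      then show False
        using b P.I_prime[of t s] s by auto
    qed
  qed
  moreover have "d \<in> Q b"
    using dR b cgenideal_self[OF dR] Dc(5) by (auto simp: Q_def D_def)
  ultimately have "maximalideal (Q b) R"
    using d by (intro nonzero_prime_is_maximal) auto
  then have "Q b = P"
    using b P.is_ideal P.I_notcarr P.a_subset
    by (auto simp: maximalideal_def maximalideal_axioms_def)
  then have "\<forall>a\<in>A. a \<otimes> b \<in> D"
    using P by (auto simp: Q_def)
  moreover have "b \<notin> D"
  proof
    assume "b \<in> D"
    then have "\<one> \<in> Q b" using b by (auto simp: Q_def)
    then show False using b P.one_imp_carrier P.I_notcarr by auto
  qed
  ultimately show ?thesis
    using b by (auto simp: D_def)
qed

text \<open>Invertibility is expressed inside \<open>R\<close>: \<open>d\<^sup>-\<^sup>1 B\<close> is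
the inverse of \<open>A\<close>. Noetherian induction on \<open>A\<close>. With
\<open>d \<in> A\<close> and \<open>B = (dR : A)\<close>, the ideal
\<open>C = d\<^sup>-\<^sup>1 A B\<close> plays the role of \<open>A A\<^sup>-\<^sup>1\<close> and
contains \<open>A\<close>. If \<open>C\<close> is larger than \<open>A\<close>, it is invertible by
induction and so is its divisor \<open>A\<close>. If \<open>C = A\<close>, then every
\<open>b / d\<close> with \<open>b \<in> B\<close> maps \<open>A\<close> into itself and hence lies
in \<open>R\<close>, contrary to \<open>exists_multiplier_outside_ring\<close> for proper
\<open>A\<close>.\<close>

theorem nonzero_ideal_invertible:
  assumes "ideal A R" "A \<noteq> {\<zero>}"
  shows "\<exists>B d. ideal B R \<and> d \<in> carrier R - {\<zero>} \<and> A \<cdot> B = PIdl d"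
  using assms
proof (induction rule: noetherian_induct)
  case (step A)
  show ?case
  proof (cases "A = carrier R")
    case True
    have "carrier R \<cdot> carrier R = PIdl \<one>"
      using ideal_prod_one[OF oneideal] cgenideal_eq_genideal genideal_one by simp
    then show ?thesis
      using True oneideal by (intro exI[of _ "carrier R"] exI[of _ \<one>]) auto
  next
    case False
    note Ac = ideal_closure[OF step(1)]
    obtain d where d: "d \<in> A" "d \<noteq> \<zero>"
      using step.prems Ac(2) by blast
    then have dR: "d \<in> carrier R" using Ac by auto
    define D where "D = PIdl d"
    have D: "ideal D R" unfolding D_def by (rule cgenideal_ideal[OF dR])
    note Dc = ideal_closure[OF D]
    have D_iff: "x \<in> D \<longleftrightarrow> (\<exists>c\<in>carrier R. x = d \<otimes> c)" for x
      unfolding D_def by (rule mem_PIdl_iff[OF dR])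
    define B where "B = {b \<in> carrier R. \<forall>a\<in>A. a \<otimes> b \<in> D}"
    have B: "ideal B R"
    proof (rule ideal_by_closure)
      show "r \<otimes> b \<in> B" if "r \<in> carrier R" "b \<in> B" for r b
      proof -
        have "a \<otimes> (r \<otimes> b) = r \<otimes> (a \<otimes> b)" if "a \<in> A" for a
          using that \<open>r \<in> carrier R\<close> \<open>b \<in> B\<close> Ac by (auto simp: B_def m_ac subset_iff)
        then show ?thesis
          using that Dc by (auto simp: B_def)
      qed
    qed (use Dc Ac in \<open>auto simp: B_def r_distr subset_iff\<close>)
    have AB: "ideal (A \<cdot> B) R"
      by (rule ideal_prod_is_ideal[OF step(1) B])
    note ABc = ideal_closure[OF AB]
    have AB_D: "A \<cdot> B \<subseteq> D"
    proof
      fix x assume "x \<in> A \<cdot> B"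
      then show "x \<in> D"
        by induction (auto simp: B_def Dc)
    qed
    define C where "C = {c \<in> carrier R. d \<otimes> c \<in> A \<cdot> B}"
    have C: "ideal C R"
      using ABc dR by (intro ideal_by_closure) (auto simp: C_def r_distr m_lcomm)
    have dB: "d \<in> B"
      using dR Ac by (auto simp: B_def D_iff m_comm subset_iff)
    have AC: "A \<subseteq> C"
      using ideal_prod.prod[OF _ dB, of _ A R] dR Ac by (auto simp: C_def m_comm subset_iff)
    have AB_eq: "A \<cdot> B = D \<cdot> C"
    proof
      show "A \<cdot> B \<subseteq> D \<cdot> C"
      proof
        fix x assume x: "x \<in> A \<cdot> B"
        then obtain c where "c \<in> carrier R" "x = d \<otimes> c"
          using AB_D D_iff by blast
        then show "x \<in> D \<cdot> C"
          using x cgenideal_self[OF dR] by (auto simp: C_def D_def intro: ideal_prod.prod)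
      qed
      show "D \<cdot> C \<subseteq> A \<cdot> B"
      proof
        fix x assume "x \<in> D \<cdot> C"
        then show "x \<in> A \<cdot> B"
        proof induction
          case (prod i c)
          then obtain r where r: "r \<in> carrier R" "i = d \<otimes> r" by (auto simp: D_iff)
          then have "i \<otimes> c = r \<otimes> (d \<otimes> c)"
            using prod dR by (auto simp: C_def m_ac)
          then show ?case
            using prod ABc(4)[OF r(1)] by (auto simp: C_def)
        qed (rule ABc(3))
      qed
    qed
    have "A \<noteq> C"
    proof
      assume "A = C"
      obtain b where b: "b \<in> B" "b \<notin> D" "b \<in> carrier R"
        using exists_multiplier_outside_ring[OF step(1) False d] by (auto simp: B_def D_def)
      have "\<exists>a'\<in>A. d \<otimes> a' = b \<otimes> a" if a: "a \<in> A" for a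
      proof -
        obtain c where c: "c \<in> carrier R" "a \<otimes> b = d \<otimes> c"
          using a b by (auto simp: B_def D_iff)
        moreover have "c \<in> C"
          using c ideal_prod.prod[OF a b(1), of R] by (auto simp: C_def)
        ultimately show ?thesis
          using \<open>A = C\<close> a b Ac by (auto simp: m_comm subset_iff)
      qed
      from multiplier_of_ideal_in_ring[OF step(1) step.prems b(3) dR d(2) this]
      show False using b by (auto simp: D_iff)
    qed
    then have "A \<subset> C" using AC by blast
    moreover from this have "C \<noteq> {\<zero>}" using step.prems Ac(2) by auto
    ultimately obtain E e where E: "ideal E R" "e \<in> carrier R - {\<zero>}" "C \<cdot> E = PIdl e"
      using step(2)[OF C] by auto
    have "A \<cdot> (B \<cdot> E) = D \<cdot> (C \<cdot> E)"
      using ideal_prod_assoc[OF step(1) B E(1)] ideal_prod_assoc[OF D C E(1)] AB_eq by simp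
    also have "\<dots> = PIdl (d \<otimes> e)"
      using E dR by (simp add: D_def PIdl_ideal_prod)
    finally have "A \<cdot> (B \<cdot> E) = PIdl (d \<otimes> e)" .
    moreover have "d \<otimes> e \<in> carrier R - {\<zero>}"
    proof -
      have "e \<in> carrier R" "e \<noteq> \<zero>" using E(2) by simp_all
      then show ?thesis
        using dR d(2) integral[of d e] m_closed[of d e] by (metis DiffI singletonD)
    qed
    ultimately show ?thesis
      by (intro exI[of _ "B \<cdot> E"] exI[of _ "d \<otimes> e"] conjI ideal_prod_is_ideal[OF B E(1)])
  qed
qed

end

section \<open>Linear maps between submodules\<close>

text \<open>The domain is a set \<open>H\<close> rather than a module, so that kernels and other
submodules of a fixed module can be used as domains without changing the module record.\<close>

definition linear_on ::
  "('a, 'r) ring_scheme \<Rightarrow> ('a, 'm, 'e) module_scheme \<Rightarrow> ('a, 'n, 'f) module_scheme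
     \<Rightarrow> 'm set \<Rightarrow> ('m \<Rightarrow> 'n) \<Rightarrow> bool" where
  "linear_on R M N H f \<longleftrightarrow>
     f \<in> H \<rightarrow> carrier N \<and>
     (\<forall>x\<in>H. \<forall>y\<in>H. f (x \<oplus>\<^bsub>M\<^esub> y) = f x \<oplus>\<^bsub>N\<^esub> f y) \<and>
     (\<forall>r\<in>carrier R. \<forall>x\<in>H. f (r \<odot>\<^bsub>M\<^esub> x) = r \<odot>\<^bsub>N\<^esub> f x)"

lemma linear_onI:
  assumes "\<And>x. x \<in> H \<Longrightarrow> f x \<in> carrier N"
    "\<And>x y. x \<in> H \<Longrightarrow> y \<in> H \<Longrightarrow> f (x \<oplus>\<^bsub>M\<^esub> y) = f x \<oplus>\<^bsub>N\<^esub> f y"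
    "\<And>r x. r \<in> carrier R \<Longrightarrow> x \<in> H \<Longrightarrow> f (r \<odot>\<^bsub>M\<^esub> x) = r \<odot>\<^bsub>N\<^esub> f x"
  shows "linear_on R M N H f"
  using assms by (simp add: linear_on_def)

lemma linear_onD:
  assumes "linear_on R M N H f"
  shows "x \<in> H \<Longrightarrow> f x \<in> carrier N"
    "x \<in> H \<Longrightarrow> y \<in> H \<Longrightarrow> f (x \<oplus>\<^bsub>M\<^esub> y) = f x \<oplus>\<^bsub>N\<^esub> f y"
    "r \<in> carrier R \<Longrightarrow> x \<in> H \<Longrightarrow> f (r \<odot>\<^bsub>M\<^esub> x) = r \<odot>\<^bsub>N\<^esub> f x"
  using assms unfolding linear_on_def by auto

lemma linear_on_subset: "linear_on R M N H f \<Longrightarrow> K \<subseteq> H \<Longrightarrow> linear_on R M N K f"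
  unfolding linear_on_def by blast

lemma linear_on_comp:
  assumes "linear_on R L M H f" "linear_on R M N K g" "f ` H \<subseteq> K"
  shows "linear_on R L N H (\<lambda>x. g (f x))"
  using linear_onD[OF assms(1)] linear_onD[OF assms(2)] assms(3)
  by (intro linear_onI) (simp_all add: image_subset_iff)

text \<open>The ring as a module over itself: its submodules are the ideals, and linear maps into it are
functionals.\<close>

definition regular_module :: "('a, 'r) ring_scheme \<Rightarrow> ('a, 'a) module" where
  "regular_module R =
     \<lparr> carrier = carrier R, monoid.mult = monoid.mult R, one = \<one>\<^bsub>R\<^esub>, zero = \<zero>\<^bsub>R\<^esub>,
       add = add R, smult = monoid.mult R \<rparr>"

lemma regular_module_sel [simp]:
  "carrier (regular_module R) = carrier R"
  "\<zero>\<^bsub>regular_module R\<^esub> = \<zero>\<^bsub>R\<^esub>"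
  "x \<oplus>\<^bsub>regular_module R\<^esub> y = x \<oplus>\<^bsub>R\<^esub> y"
  "r \<odot>\<^bsub>regular_module R\<^esub> x = r \<otimes>\<^bsub>R\<^esub> x"
  "\<ominus>\<^bsub>regular_module R\<^esub> x = \<ominus>\<^bsub>R\<^esub> x"
  "x \<ominus>\<^bsub>regular_module R\<^esub> y = x \<ominus>\<^bsub>R\<^esub> y"
  by (simp_all add: regular_module_def a_minus_def a_inv_def m_inv_def)

lemma (in cring) module_regular_module: "Module.module R (regular_module R)"
proof (rule moduleI)
  show "abelian_group (regular_module R)"
  proof (rule abelian_groupI)
    fix x assume "x \<in> carrier (regular_module R)"
    then show "\<exists>y\<in>carrier (regular_module R). y \<oplus>\<^bsub>regular_module R\<^esub> x = \<zero>\<^bsub>regular_module R\<^esub>"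
      by (intro bexI[of _ "\<ominus> x"]) (simp_all add: l_neg)
  qed (simp_all add: a_ac)
qed (simp_all add: is_cring l_distr r_distr m_assoc)

context Module.module
begin

lemma submodule_closure:
  assumes "submodule H R M"
  shows "H \<subseteq> carrier M" "\<zero>\<^bsub>M\<^esub> \<in> H" "\<And>x y. x \<in> H \<Longrightarrow> y \<in> H \<Longrightarrow> x \<oplus>\<^bsub>M\<^esub> y \<in> H"
    "\<And>r x. r \<in> carrier R \<Longrightarrow> x \<in> H \<Longrightarrow> r \<odot>\<^bsub>M\<^esub> x \<in> H"
    "\<And>x. x \<in> H \<Longrightarrow> \<ominus>\<^bsub>M\<^esub> x \<in> H" "\<And>x y. x \<in> H \<Longrightarrow> y \<in> H \<Longrightarrow> x \<ominus>\<^bsub>M\<^esub> y \<in> H"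
    "\<And>x. x \<in> H \<Longrightarrow> x \<in> carrier M"
proof -
  show "\<zero>\<^bsub>M\<^esub> \<in> H"
    using subgroup.one_closed[OF submodule.axioms(1)[OF assms]] by simp
qed (use submoduleE[OF assms] in \<open>auto simp: a_minus_def\<close>)

lemma submodule_by_closure:
  assumes "H \<subseteq> carrier M" "\<zero>\<^bsub>M\<^esub> \<in> H" "\<And>x y. x \<in> H \<Longrightarrow> y \<in> H \<Longrightarrow> x \<oplus>\<^bsub>M\<^esub> y \<in> H"
    "\<And>r x. r \<in> carrier R \<Longrightarrow> x \<in> H \<Longrightarrow> r \<odot>\<^bsub>M\<^esub> x \<in> H"
  shows "submodule H R M"
proof (rule submoduleI)
  show "\<ominus>\<^bsub>M\<^esub> x \<in> H" if "x \<in> H" for x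
    using assms(4)[OF R.a_inv_closed[OF R.one_closed] that] assms(1) that smult_l_minus[of "\<one>" x]
    by auto
qed (use assms in auto)

end

lemma linear_on_arith:
  assumes M: "Module.module R M" and N: "Module.module R N"
    and H: "submodule H R M" and f: "linear_on R M N H f"
  shows "f \<zero>\<^bsub>M\<^esub> = \<zero>\<^bsub>N\<^esub>"
    "\<And>x. x \<in> H \<Longrightarrow> f (\<ominus>\<^bsub>M\<^esub> x) = \<ominus>\<^bsub>N\<^esub> f x"
    "\<And>x y. x \<in> H \<Longrightarrow> y \<in> H \<Longrightarrow> f (x \<ominus>\<^bsub>M\<^esub> y) = f x \<ominus>\<^bsub>N\<^esub> f y"
proof -
  interpret M: Module.module R M by fact
  interpret N: Module.module R N by fact
  note Hc = M.submodule_closure[OF H] and fD = linear_onD[OF f]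
  show "f \<zero>\<^bsub>M\<^esub> = \<zero>\<^bsub>N\<^esub>"
    using fD(3)[OF M.R.zero_closed Hc(2)] Hc(2) fD(1)[OF Hc(2)] by simp
  show neg: "f (\<ominus>\<^bsub>M\<^esub> x) = \<ominus>\<^bsub>N\<^esub> f x" if x: "x \<in> H" for x
  proof -
    have "f ((\<ominus>\<^bsub>R\<^esub> \<one>\<^bsub>R\<^esub>) \<odot>\<^bsub>M\<^esub> x) = (\<ominus>\<^bsub>R\<^esub> \<one>\<^bsub>R\<^esub>) \<odot>\<^bsub>N\<^esub> f x"
      by (rule fD(3)) (simp_all add: x)
    then show ?thesis
      using M.smult_l_minus[of "\<one>\<^bsub>R\<^esub>" x] N.smult_l_minus[of "\<one>\<^bsub>R\<^esub>" "f x"] Hc(7)[OF x] fD(1)[OF x]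
      by simp
  qed
  show "f (x \<ominus>\<^bsub>M\<^esub> y) = f x \<ominus>\<^bsub>N\<^esub> f y" if "x \<in> H" "y \<in> H" for x y
    using that fD(2)[of x "\<ominus>\<^bsub>M\<^esub> y"] neg[of y] Hc(5)[of y] by (simp add: a_minus_def)
qed

lemma submodule_kernel:
  assumes M: "Module.module R M" and N: "Module.module R N"
    and H: "submodule H R M" and f: "linear_on R M N H f"
  shows "submodule {x \<in> H. f x = \<zero>\<^bsub>N\<^esub>} R M"
proof -
  interpret M: Module.module R M by fact
  interpret N: Module.module R N by fact
  note Hc = M.submodule_closure[OF H] and fD = linear_onD[OF f]
  show ?thesis
  proof (rule M.submodule_by_closure)
    show "r \<odot>\<^bsub>M\<^esub> x \<in> {x \<in> H. f x = \<zero>\<^bsub>N\<^esub>}" if "r \<in> carrier R" "x \<in> {x \<in> H. f x = \<zero>\<^bsub>N\<^esub>}" for r x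
      using that fD(3)[of r x] Hc(4) by simp
    show "x \<oplus>\<^bsub>M\<^esub> y \<in> {x \<in> H. f x = \<zero>\<^bsub>N\<^esub>}"
      if "x \<in> {x \<in> H. f x = \<zero>\<^bsub>N\<^esub>}" "y \<in> {x \<in> H. f x = \<zero>\<^bsub>N\<^esub>}" for x y
      using that fD(2)[of x y] Hc(3) by simp
  qed (use Hc linear_on_arith[OF assms] in auto)
qed

lemma submodule_image:
  assumes M: "Module.module R M" and N: "Module.module R N"
    and H: "submodule H R M" and f: "linear_on R M N H f"
  shows "submodule (f ` H) R N"
proof -
  interpret M: Module.module R M by fact
  interpret N: Module.module R N by fact
  note Hc = M.submodule_closure[OF H] and fD = linear_onD[OF f]
  show ?thesis
  proof (rule N.submodule_by_closure)
    show "f ` H \<subseteq> carrier N" using fD(1) by auto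
    show "\<zero>\<^bsub>N\<^esub> \<in> f ` H"
      using imageI[OF Hc(2), of f] linear_on_arith(1)[OF assms] by simp
    show "x \<oplus>\<^bsub>N\<^esub> y \<in> f ` H" if xy: "x \<in> f ` H" "y \<in> f ` H" for x y
    proof -
      obtain u v where "u \<in> H" "v \<in> H" "x = f u" "y = f v" using xy by auto
      then show ?thesis using imageI[OF Hc(3)[of u v], of f] fD(2)[of u v] by simp
    qed
    show "r \<odot>\<^bsub>N\<^esub> x \<in> f ` H" if r: "r \<in> carrier R" and x: "x \<in> f ` H" for r x
    proof -
      obtain u where "u \<in> H" "x = f u" using x by auto
      then show ?thesis using imageI[OF Hc(4)[OF r, of u], of f] fD(3)[OF r, of u] by simp
    qed
  qed
qed

lemma (in cring) submodule_regular_iff: "submodule A R (regular_module R) \<longleftrightarrow> ideal A R"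
proof -
  interpret S: Module.module R "regular_module R" by (rule module_regular_module)
  show ?thesis
  proof
    assume "submodule A R (regular_module R)"
    from S.submodule_closure[OF this] show "ideal A R"
      by (intro ideal_by_closure) auto
  next
    assume "ideal A R"
    from ideal_closure[OF this] show "submodule A R (regular_module R)"
      by (intro S.submodule_by_closure) auto
  qed
qed

abbreviation functional_on ::
  "('a, 'r) ring_scheme \<Rightarrow> ('a, 'm, 'e) module_scheme \<Rightarrow> 'm set \<Rightarrow> ('m \<Rightarrow> 'a) \<Rightarrow> bool" where
  "functional_on R M H f \<equiv> linear_on R M (regular_module R) H f"

section \<open>Ideals as projective modules\<close>

context dedekind_domain
begin

text \<open>An element \<open>b / d\<close> of the inverse of \<open>A\<close> acts on
\<open>A\<close> as the functional \<open>a \<mapsto> a b / d\<close>. This replaces computations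
with fractional ideals by computations with functionals.\<close>

lemma functional_of_multiplier:
  assumes A: "ideal A R" and d: "d \<in> carrier R - {\<zero>}" and b: "b \<in> carrier R"
    and mult: "\<And>a. a \<in> A \<Longrightarrow> a \<otimes> b \<in> PIdl d"
  shows "\<exists>q. functional_on R (regular_module R) A q \<and> (\<forall>a\<in>A. d \<otimes> q a = a \<otimes> b)"
proof -
  note Ac = ideal_closure[OF A]
  have d': "d \<in> carrier R" "d \<noteq> \<zero>" using d by auto
  have "\<forall>a\<in>A. \<exists>c. c \<in> carrier R \<and> d \<otimes> c = a \<otimes> b"
    using mult mem_PIdl_iff[OF d'(1)] by (metis)
  then obtain q where q: "\<And>a. a \<in> A \<Longrightarrow> q a \<in> carrier R" "\<And>a. a \<in> A \<Longrightarrow> d \<otimes> q a = a \<otimes> b"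
    by metis
  have eqI: "u = v" if "d \<otimes> u = d \<otimes> v" "u \<in> carrier R" "v \<in> carrier R" for u v
    using m_lcancel[OF d'(2,1) that(2,3)] that(1) by simp
  have "functional_on R (regular_module R) A q"
  proof (rule linear_onI)
    show "q x \<in> carrier (regular_module R)" if "x \<in> A" for x using q that by simp
    show "q (x \<oplus>\<^bsub>regular_module R\<^esub> y) = q x \<oplus>\<^bsub>regular_module R\<^esub> q y" if xy: "x \<in> A" "y \<in> A" for x y
    proof -
      have c: "x \<in> carrier R" "y \<in> carrier R" "x \<oplus> y \<in> A" using xy Ac by auto
      have "d \<otimes> q (x \<oplus> y) = d \<otimes> (q x \<oplus> q y)"
        using xy c d' b q by (simp add: r_distr l_distr)
      from eqI[OF this] show ?thesis using q c xy by simp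
    qed
    show "q (r \<odot>\<^bsub>regular_module R\<^esub> x) = r \<odot>\<^bsub>regular_module R\<^esub> q x" if r: "r \<in> carrier R" and x: "x \<in> A" for r x
    proof -
      have c: "x \<in> carrier R" "r \<otimes> x \<in> A" using r x Ac by auto
      have "d \<otimes> (r \<otimes> q x) = r \<otimes> (d \<otimes> q x)"
        by (rule m_lcomm[OF d'(1) r q(1)[OF x]])
      also have "\<dots> = d \<otimes> q (r \<otimes> x)"
        using q(2)[OF x] q(2)[OF c(2)] r c b by (simp add: m_assoc)
      finally have "d \<otimes> q (r \<otimes> x) = d \<otimes> (r \<otimes> q x)" by simp
      from eqI[OF this] show ?thesis using q c x r by simp
    qed
  qed
  with q show ?thesis by blast
qed

text \<open>The image \<open>A\<close> is an invertible ideal and therefore projective. From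
\<open>A B = dR\<close>, write \<open>d\<close> as a sum of products
\<open>f(x\<^sub>i) b\<^sub>i\<close>; then
\<open>a \<mapsto> \<Sum> (a b\<^sub>i / d) x\<^sub>i\<close> is a section of \<open>f\<close>.
The induction over the elements \<open>e\<close> of \<open>A B\<close> builds a map \<open>s\<close>
with \<open>f \<circ> s\<close> equal to multiplication by \<open>e / d\<close>.\<close>

lemma section_of_functional:
  assumes M: "Module.module R M" and H: "submodule H R M"
    and f: "functional_on R M H f" and nz: "f ` H \<noteq> {\<zero>}"
  shows "\<exists>s. linear_on R (regular_module R) M (f ` H) s \<and> s ` f ` H \<subseteq> H \<and> (\<forall>a\<in>f ` H. f (s a) = a)"
proof -
  interpret M: Module.module R M by fact
  define A where "A = f ` H"
  have A: "ideal A R"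
    using submodule_image[OF M module_regular_module H f] by (simp add: A_def submodule_regular_iff)
  note Ac = ideal_closure[OF A] and Hc = M.submodule_closure[OF H] and fD = linear_onD[OF f, simplified]
  obtain B d where B: "ideal B R" and d: "d \<in> carrier R - {\<zero>}" and AB: "A \<cdot> B = PIdl d"
    using nonzero_ideal_invertible[OF A] nz unfolding A_def by blast
  note Bc = ideal_closure[OF B]
  have d': "d \<in> carrier R" "d \<noteq> \<zero>" using d by auto
  have "\<exists>s. linear_on R (regular_module R) M A s \<and> s ` A \<subseteq> H \<and> (\<forall>a\<in>A. d \<otimes> f (s a) = e \<otimes> a)"
    if "e \<in> A \<cdot> B" for e
    using that
  proof induction
    case (prod i j)
    then obtain x where x: "x \<in> H" "i = f x" by (auto simp: A_def)
    have jR: "j \<in> carrier R" "i \<in> carrier R" using prod Bc Ac by auto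
    obtain q where q: "functional_on R (regular_module R) A q" "\<And>a. a \<in> A \<Longrightarrow> d \<otimes> q a = a \<otimes> j"
      using functional_of_multiplier[OF A d jR(1)] ideal_prod.prod[OF _ prod(2), of _ A R] AB by blast
    note qD = linear_onD[OF q(1), simplified]
    have "linear_on R (regular_module R) M A (\<lambda>a. q a \<odot>\<^bsub>M\<^esub> x)"
      using qD x Hc(7) by (intro linear_onI) (simp_all add: M.smult_l_distr M.smult_assoc1)
    moreover have "d \<otimes> f (q a \<odot>\<^bsub>M\<^esub> x) = i \<otimes> j \<otimes> a" if a: "a \<in> A" for a
    proof -
      have "d \<otimes> f (q a \<odot>\<^bsub>M\<^esub> x) = (d \<otimes> q a) \<otimes> i"
        using fD(3)[OF qD(1)[OF a] x(1)] x d' qD(1)[OF a] jR by (simp add: m_assoc)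
      also have "\<dots> = i \<otimes> j \<otimes> a"
        using q(2)[OF a] jR a Ac(1) by (auto simp: m_ac subset_iff)
      finally show ?thesis .
    qed
    moreover have "(\<lambda>a. q a \<odot>\<^bsub>M\<^esub> x) ` A \<subseteq> H"
      using Hc(4) qD(1) x by auto
    ultimately show ?case by blast
  next
    case (sum e1 e2)
    have "A \<cdot> B \<subseteq> carrier R" by (rule ideal_prod_in_carrier[OF A B])
    then have e: "e1 \<in> carrier R" "e2 \<in> carrier R" using sum by auto
    obtain s1 s2 where s: "linear_on R (regular_module R) M A s1" "s1 ` A \<subseteq> H" "\<forall>a\<in>A. d \<otimes> f (s1 a) = e1 \<otimes> a"
      "linear_on R (regular_module R) M A s2" "s2 ` A \<subseteq> H" "\<forall>a\<in>A. d \<otimes> f (s2 a) = e2 \<otimes> a"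
      using sum.IH by blast
    have sH: "s1 a \<in> H" "s2 a \<in> H" if "a \<in> A" for a using s that by auto
    have "linear_on R (regular_module R) M A (\<lambda>a. s1 a \<oplus>\<^bsub>M\<^esub> s2 a)"
      using linear_onD[OF s(1), simplified] linear_onD[OF s(4), simplified]
      by (intro linear_onI) (simp_all add: M.smult_r_distr M.M.a_ac)
    moreover have "(\<lambda>a. s1 a \<oplus>\<^bsub>M\<^esub> s2 a) ` A \<subseteq> H"
      using sH Hc(3) by auto
    moreover have "d \<otimes> f (s1 a \<oplus>\<^bsub>M\<^esub> s2 a) = (e1 \<oplus> e2) \<otimes> a" if "a \<in> A" for a
      using s(3,6) sH[OF that] fD d' e that Ac(1) by (auto simp: r_distr l_distr)
    ultimately show ?case by blast
  qed
  from this[of d] obtain s where s: "linear_on R (regular_module R) M A s" "s ` A \<subseteq> H"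
    "\<And>a. a \<in> A \<Longrightarrow> d \<otimes> f (s a) = d \<otimes> a"
    using AB cgenideal_self[OF d'(1)] by auto
  have "f (s a) = a" if a: "a \<in> A" for a
    using m_lcancel[OF d'(2,1), of "f (s a)" a] s(3)[OF a] fD(1)[of "s a"] s(2) a Ac(1) by auto
  with s show ?thesis unfolding A_def by blast
qed

section \<open>Functionals with prescribed coprime image\<close>

lemma maximalideal_props:
  assumes "maximalideal P R"
  shows "ideal P R" "primeideal P R" "P \<noteq> carrier R" "\<one> \<notin> P" "P \<subseteq> carrier R"
    "\<And>J. ideal J R \<Longrightarrow> P \<subseteq> J \<Longrightarrow> J = P \<or> J = carrier R"
proof -
  interpret maximalideal P R by fact
  show "ideal P R" "primeideal P R" "P \<noteq> carrier R" "\<one> \<notin> P" "P \<subseteq> carrier R"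
    using is_ideal maximalideal_prime[OF assms] I_notcarr one_imp_carrier a_subset by auto
  show "J = P \<or> J = carrier R" if "ideal J R" "P \<subseteq> J" for J
    using I_maximal[OF that] ideal_closure(1)[OF that(1)] by auto
qed

text \<open>Multiplying \<open>B \<subseteq> P B\<close> by \<open>A\<close> gives
\<open>d \<in> P d\<close>, that is \<open>\<one> \<in> P\<close>.\<close>

lemma nonzero_ideal_not_subset_prod:
  assumes P: "maximalideal P R" and A: "ideal A R" and B: "ideal B R"
    and d: "d \<in> carrier R - {\<zero>}" and AB: "A \<cdot> B = PIdl d"
  shows "\<not> B \<subseteq> P \<cdot> B"
proof
  assume sub: "B \<subseteq> P \<cdot> B"
  note Pp = maximalideal_props[OF P]
  have d': "d \<in> carrier R" "d \<noteq> \<zero>" using d by auto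
  have AP: "A \<cdot> (P \<cdot> B) = P \<cdot> (PIdl d)"
    using ideal_prod_assoc[OF A Pp(1) B] ideal_prod_assoc[OF Pp(1) A B] ideal_prod_commute[OF A Pp(1)] AB
    by simp
  have "d \<in> A \<cdot> B"
    using AB cgenideal_self[OF d'(1)] by simp
  then have "d \<in> P \<cdot> (PIdl d)"
    unfolding AP[symmetric]
  proof induction
    case (prod i j)
    then show ?case using sub by (intro ideal_prod.prod) auto
  qed (rule ideal_prod.sum)
  moreover have "\<exists>p\<in>P. x = d \<otimes> p" if "x \<in> P \<cdot> (PIdl d)" for x
    using that
  proof induction
    case (prod i j)
    then obtain c where c: "c \<in> carrier R" "j = d \<otimes> c"
      using mem_PIdl_iff[OF d'(1)] by auto
    have "i \<otimes> j = d \<otimes> (i \<otimes> c)"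
      unfolding c(2) using c(1) prod(1) d' Pp(5) by (intro m_lcomm) auto
    then show ?case
      using ideal_closure(5)[OF Pp(1) c(1) prod(1)] by blast
  next
    case (sum x y)
    then obtain p q where pq: "p \<in> P" "x = d \<otimes> p" "q \<in> P" "y = d \<otimes> q" by auto
    have "x \<oplus> y = d \<otimes> (p \<oplus> q)"
      unfolding pq(2,4) using pq(1,3) d' Pp(5) by (intro r_distr[symmetric]) auto
    then show ?case
      using ideal_closure(3)[OF Pp(1) pq(1,3)] by blast
  qed
  ultimately obtain p where p: "p \<in> P" "d = d \<otimes> p" by auto
  then have "p = \<one>"
    using m_lcancel[OF d'(2,1), of p \<one>] Pp(5) d' by auto
  with p Pp(4) show False by simp
qed

text \<open>For each \<open>Q \<in> S\<close> there is an element of \<open>Q\<close> outside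
\<open>P\<close>; the product of these elements works.\<close>

lemma element_avoiding_maximal_ideal:
  assumes "finite S" "\<And>Q. Q \<in> S \<Longrightarrow> maximalideal Q R" "maximalideal P R" "P \<notin> S"
  shows "\<exists>x\<in>carrier R - P. \<forall>Q\<in>S. x \<in> Q"
  using assms
proof induction
  case empty
  then show ?case
    using maximalideal_props(4)[of P] by (intro bexI[of _ \<one>]) auto
next
  case (insert Q S)
  then obtain x where x: "x \<in> carrier R" "x \<notin> P" "\<forall>Q\<in>S. x \<in> Q" by auto
  have Q: "maximalideal Q R" "Q \<noteq> P" using insert.prems by auto
  note Pp = maximalideal_props[OF \<open>maximalideal P R\<close>] and Qp = maximalideal_props[OF Q(1)]
  have "\<not> Q \<subseteq> P"
    using Qp(6)[OF Pp(1)] Q(2) Pp(3) by auto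
  then obtain y where y: "y \<in> Q" "y \<notin> P" by auto
  have yR: "y \<in> carrier R" using y Qp(5) by auto
  have "x \<otimes> y \<in> carrier R - P"
    using primeideal.I_prime[OF Pp(2) x(1) yR] x y yR by auto
  moreover have "x \<otimes> y \<in> Q'" if "Q' \<in> insert Q S" for Q'
  proof (cases "Q' = Q")
    case True
    then show ?thesis using ideal_closure(4)[OF Qp(1) x(1) y(1)] by simp
  next
    case False
    then have "Q' \<in> S" using that by simp
    then show ?thesis
      using ideal_closure(5)[OF maximalideal_props(1) yR] insert.prems(1) x(3) by auto
  qed
  ultimately show ?case by blast
qed

text \<open>One ideal at a time. If the element \<open>b\<close> found so far lies in
\<open>P B\<close>, add \<open>x \<otimes> b'\<close> with \<open>b' \<in> B\<close> outside
\<open>P B\<close> and \<open>x\<close> outside \<open>P\<close> but in all earlier ideals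
\<open>Q\<close>: the sum leaves \<open>P B\<close>, and modulo every \<open>Q B\<close> nothing
changes.\<close>

lemma element_avoiding_products:
  assumes A: "ideal A R" and B: "ideal B R"
    and d: "d \<in> carrier R - {\<zero>}" and AB: "A \<cdot> B = PIdl d"
    and "finite S" "\<And>P. P \<in> S \<Longrightarrow> maximalideal P R"
  shows "\<exists>b\<in>B. \<forall>P\<in>S. b \<notin> P \<cdot> B"
  using assms(5,6)
proof induction
  case empty
  then show ?case using ideal_closure(2)[OF B] by auto
next
  case (insert P S)
  note Bc = ideal_closure[OF B]
  have P: "maximalideal P R" using insert.prems by simp
  note Pp = maximalideal_props[OF P]
  note PBc = ideal_closure[OF ideal_prod_is_ideal[OF Pp(1) B]]
  obtain b where b: "b \<in> B" "\<forall>P\<in>S. b \<notin> P \<cdot> B"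
    using insert.IH insert.prems by auto
  show ?case
  proof (cases "b \<in> P \<cdot> B")
    case False
    with b show ?thesis by auto
  next
    case True
    obtain b' where b': "b' \<in> B" "b' \<notin> P \<cdot> B"
      using nonzero_ideal_not_subset_prod[OF P A B d AB] by auto
    have b'R: "b' \<in> carrier R" "b \<in> carrier R" using b' b Bc(1) by auto
    have "\<exists>x\<in>carrier R - P. \<forall>Q\<in>S. x \<in> Q"
      using insert.hyps insert.prems by (intro element_avoiding_maximal_ideal) auto
    then obtain x where x: "x \<in> carrier R" "x \<notin> P" "\<forall>Q\<in>S. x \<in> Q" by auto
    have "x \<otimes> b' \<notin> P \<cdot> B"
    proof
      assume xb: "x \<otimes> b' \<in> P \<cdot> B"
      have "ideal {r \<in> carrier R. r \<otimes> b' \<in> P \<cdot> B} R"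
        using PBc b'R by (intro ideal_by_closure) (simp_all add: subset_iff l_distr m_assoc)
      moreover have "P \<subseteq> {r \<in> carrier R. r \<otimes> b' \<in> P \<cdot> B}"
        using Pp(5) ideal_prod.prod[OF _ b'(1), of _ P R] by auto
      ultimately have "{r \<in> carrier R. r \<otimes> b' \<in> P \<cdot> B} = carrier R"
        using Pp(6) x xb by blast
      then have "\<one> \<otimes> b' \<in> P \<cdot> B" by auto
      then show False using b' b'R by simp
    qed
    then have nP: "b \<oplus> x \<otimes> b' \<notin> P \<cdot> B"
    proof -
      have "x \<otimes> b' = (b \<oplus> x \<otimes> b') \<ominus> b"
        using x b'R by (simp add: a_minus_def a_ac r_neg r_neg1 r_neg2)
      then show ?thesis
        using PBc(7)[OF _ True] \<open>x \<otimes> b' \<notin> P \<cdot> B\<close> by metis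
    qed
    have nS: "b \<oplus> x \<otimes> b' \<notin> Q \<cdot> B" if "Q \<in> S" for Q
    proof
      have Q: "ideal Q R" using insert.prems that maximalideal_props(1) by auto
      note QBc = ideal_closure[OF ideal_prod_is_ideal[OF Q B]]
      assume a: "b \<oplus> x \<otimes> b' \<in> Q \<cdot> B"
      have "x \<otimes> b' \<in> Q \<cdot> B"
        using x that b' by (intro ideal_prod.prod) auto
      from QBc(7)[OF a this] have "(b \<oplus> x \<otimes> b') \<ominus> x \<otimes> b' \<in> Q \<cdot> B" .
      moreover have "(b \<oplus> x \<otimes> b') \<ominus> x \<otimes> b' = b"
        using x b'R by (simp add: a_minus_def a_assoc r_neg)
      ultimately show False using b that by auto
    qed
    have "b \<oplus> x \<otimes> b' \<in> B"
      using Bc(3)[OF b(1) Bc(4)[OF x(1) b'(1)]] .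
    with nP nS show ?thesis by auto
  qed
qed

text \<open>Every ideal class contains an integral ideal coprime to a given \<open>C\<close>. Among the
elements \<open>b / d\<close> of the inverse of \<open>A\<close>, choose one that avoids
\<open>P A\<^sup>-\<^sup>1\<close> for each of the finitely many primes \<open>P\<close> over
\<open>C\<close>. If the ideal \<open>\<alpha>(A) + C\<close> were proper, it would lie in one of
these \<open>P\<close>, and \<open>\<alpha>(A) \<subseteq> P\<close> would put \<open>b / d\<close>
into \<open>P A\<^sup>-\<^sup>1\<close>.\<close>

lemma functional_with_coprime_image:
  assumes A: "ideal A R" "A \<noteq> {\<zero>}" and C: "ideal C R" "C \<noteq> {\<zero>}"
  shows "\<exists>\<alpha>. functional_on R (regular_module R) A \<alpha> \<and> (\<exists>a\<in>A. \<exists>c\<in>C. \<alpha> a \<oplus> c = \<one>)"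
proof -
  note Ac = ideal_closure[OF A(1)] and Cc = ideal_closure[OF C(1)]
  obtain B d where B: "ideal B R" and d: "d \<in> carrier R - {\<zero>}" and AB: "A \<cdot> B = PIdl d"
    using nonzero_ideal_invertible[OF A] by blast
  note Bc = ideal_closure[OF B]
  have d': "d \<in> carrier R" "d \<noteq> \<zero>" using d by auto
  define S where "S = {P. primeideal P R \<and> C \<subseteq> P}"
  have maxS: "maximalideal P R" if "P \<in> S" for P
    using that nonzero_prime_is_maximal[of P] C(2) Cc(2) by (auto simp: S_def)
  have "finite S"
    unfolding S_def by (rule finite_primes_over[OF C])
  then obtain b where b: "b \<in> B" "\<forall>P\<in>S. b \<notin> P \<cdot> B"
    using element_avoiding_products[OF A(1) B d AB _ maxS] by blast
  have bR: "b \<in> carrier R" using b Bc by auto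
  obtain \<alpha> where \<alpha>: "functional_on R (regular_module R) A \<alpha>" "\<And>a. a \<in> A \<Longrightarrow> d \<otimes> \<alpha> a = a \<otimes> b"
    using functional_of_multiplier[OF A(1) d bR] ideal_prod.prod[OF _ b(1), of _ A R] AB by blast
  note \<alpha>D = linear_onD[OF \<alpha>(1), simplified]
  define D where "D = {x. \<exists>a\<in>A. \<exists>c\<in>C. x = \<alpha> a \<oplus> c}"
  have D: "ideal D R"
  proof (rule ideal_by_closure)
    have "\<alpha> \<zero> = \<zero>"
      using linear_on_arith(1)[OF module_regular_module module_regular_module _ \<alpha>(1)] A(1)
      by (simp add: submodule_regular_iff)
    then show "\<zero> \<in> D"
      unfolding D_def using Ac(2) Cc(2) by (intro CollectI bexI[of _ \<zero>]) simp_all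
    show "D \<subseteq> carrier R" using \<alpha>D(1) Cc(1) by (auto simp: D_def)
    show "x \<oplus> y \<in> D" if xy: "x \<in> D" "y \<in> D" for x y
    proof -
      obtain a c a' c' where *: "a \<in> A" "c \<in> C" "x = \<alpha> a \<oplus> c" "a' \<in> A" "c' \<in> C" "y = \<alpha> a' \<oplus> c'"
        using xy unfolding D_def by blast
      have "c \<in> carrier R" "c' \<in> carrier R" using * Cc(1) by auto
      then have "x \<oplus> y = \<alpha> (a \<oplus> a') \<oplus> (c \<oplus> c')"
        using * \<alpha>D by (simp add: a_ac)
      then show ?thesis
        unfolding D_def using Ac(3)[OF *(1,4)] Cc(3)[OF *(2,5)] by blast
    qed
    show "r \<otimes> x \<in> D" if r: "r \<in> carrier R" and x: "x \<in> D" for r x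
    proof -
      obtain a c where *: "a \<in> A" "c \<in> C" "x = \<alpha> a \<oplus> c"
        using x unfolding D_def by blast
      have "c \<in> carrier R" using * Cc(1) by auto
      then have "r \<otimes> x = \<alpha> (r \<otimes> a) \<oplus> r \<otimes> c"
        using * \<alpha>D r by (simp add: r_distr)
      then show ?thesis
        unfolding D_def using Ac(4)[OF r *(1)] Cc(4)[OF r *(2)] by blast
    qed
  qed
  have "D = carrier R"
  proof (rule ccontr)
    assume "D \<noteq> carrier R"
    then obtain P where P: "maximalideal P R" "D \<subseteq> P"
      using exists_maximalideal[OF D] by blast
    note Pp = maximalideal_props[OF P(1)]
    have "\<alpha> \<zero> = \<zero>"
      using linear_on_arith(1)[OF module_regular_module module_regular_module _ \<alpha>(1)] A(1)
      by (simp add: submodule_regular_iff)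
    then have "c = \<alpha> \<zero> \<oplus> c" if "c \<in> C" for c
      using that Cc(1) by (simp add: subset_iff)
    then have "C \<subseteq> D"
      unfolding D_def using Ac(2) by blast
    then have "P \<in> S"
      using P Pp by (auto simp: S_def)
    have \<alpha>P: "\<alpha> a \<in> P" if "a \<in> A" for a
    proof -
      have "\<alpha> a \<oplus> \<zero> \<in> D" unfolding D_def using that Cc(2) by blast
      then show ?thesis using \<alpha>D(1)[OF that] P(2) by auto
    qed
    \<comment> \<open>for \<open>e = d\<close> this is the contradiction \<open>b \<in> P B\<close>\<close>
    have "\<exists>w\<in>P \<cdot> B. b \<otimes> e = d \<otimes> w" if "e \<in> A \<cdot> B" for e
      using that
    proof induction
      case (prod i j)
      have ij: "i \<in> carrier R" "j \<in> carrier R" "\<alpha> i \<in> carrier R" using prod Ac(1) Bc(1) \<alpha>D(1) by auto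
      have "b \<otimes> (i \<otimes> j) = (i \<otimes> b) \<otimes> j"
        using bR ij by (simp add: m_ac)
      also have "\<dots> = d \<otimes> (\<alpha> i \<otimes> j)"
        using \<alpha>(2)[OF prod(1)] ij d' bR by (simp flip: m_assoc)
      finally show ?case
        using ideal_prod.prod[OF \<alpha>P[OF prod(1)] prod(2)] by blast
    next
      case (sum x y)
      then obtain u v where uv: "u \<in> P \<cdot> B" "v \<in> P \<cdot> B" "b \<otimes> x = d \<otimes> u" "b \<otimes> y = d \<otimes> v" by blast
      have c: "u \<in> carrier R" "v \<in> carrier R" "x \<in> carrier R" "y \<in> carrier R"
        using uv sum ideal_prod_in_carrier[OF Pp(1) B] ideal_prod_in_carrier[OF A(1) B] by auto
      have "b \<otimes> (x \<oplus> y) = d \<otimes> (u \<oplus> v)"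
        using c uv(3,4) bR d' by (simp add: r_distr)
      then show ?case using ideal_prod.sum[OF uv(1,2)] by blast
    qed
    from this[of d] obtain w where w: "w \<in> P \<cdot> B" "b \<otimes> d = d \<otimes> w"
      using AB cgenideal_self[OF d'(1)] by auto
    have "w \<in> carrier R" using w ideal_prod_in_carrier[OF Pp(1) B] by auto
    then have "b = w"
      using w(2) m_lcancel[OF d'(2,1) bR, of w] m_comm[OF bR d'(1)] by simp
    with w b \<open>P \<in> S\<close> show False by blast
  qed
  then have "\<one> \<in> D" by simp
  then obtain a c where "a \<in> A" "c \<in> C" "\<one> = \<alpha> a \<oplus> c"
    unfolding D_def by blast
  with \<alpha>(1) show ?thesis
    by (intro exI[of _ \<alpha>] conjI bexI[of _ a] bexI[of _ c]) simp_all
qed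

end

section \<open>Peeling a module by functionals\<close>

definition torsion_elements :: "('a, 'r) ring_scheme \<Rightarrow> ('a, 'm, 'e) module_scheme \<Rightarrow> 'm set" where
  "torsion_elements R M =
     {x \<in> carrier M. \<exists>r\<in>carrier R - {\<zero>\<^bsub>R\<^esub>}. r \<odot>\<^bsub>M\<^esub> x = \<zero>\<^bsub>M\<^esub>}"

text \<open>Successive functionals map \<open>H\<close> onto the first ideal, the kernel onto the second
ideal, and so on, until the kernel is torsion. Since nonzero ideals are projective, this says that
\<open>H\<close> is isomorphic to its torsion submodule plus the direct sum of the ideals in the list,
and the length of the list is the rank. Recording only functionals and kernels keeps everything inside
the given module.\<close>

fun peels :: "('a, 'r) ring_scheme \<Rightarrow> ('a, 'm, 'e) module_scheme \<Rightarrow> 'm set \<Rightarrow> 'a set list \<Rightarrow> bool" where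
  "peels R M H [] \<longleftrightarrow> H \<subseteq> torsion_elements R M"
| "peels R M H (A # As) \<longleftrightarrow>
     (\<exists>f. functional_on R M H f \<and> f ` H = A \<and> A \<noteq> {\<zero>\<^bsub>R\<^esub>} \<and> peels R M {x \<in> H. f x = \<zero>\<^bsub>R\<^esub>} As)"

lemma (in Module.module) smult_left_commute:
  assumes "r \<in> carrier R" "s \<in> carrier R" "x \<in> carrier M"
  shows "r \<odot>\<^bsub>M\<^esub> (s \<odot>\<^bsub>M\<^esub> x) = s \<odot>\<^bsub>M\<^esub> (r \<odot>\<^bsub>M\<^esub> x)"
  using smult_assoc1[OF assms] smult_assoc1[OF assms(2,1,3)] R.m_comm[OF assms(1,2)] by simp

lemma (in domain) submodule_torsion_elements:
  assumes M: "Module.module R M"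
  shows "submodule (torsion_elements R M) R M"
proof -
  interpret M: Module.module R M by fact
  show ?thesis
  proof (rule M.submodule_by_closure)
    show "\<zero>\<^bsub>M\<^esub> \<in> torsion_elements R M"
      unfolding torsion_elements_def by (intro CollectI conjI bexI[of _ \<one>]) simp_all
    show "x \<oplus>\<^bsub>M\<^esub> y \<in> torsion_elements R M"
      if xy: "x \<in> torsion_elements R M" "y \<in> torsion_elements R M" for x y
    proof -
      obtain r s where *: "x \<in> carrier M" "r \<in> carrier R" "r \<noteq> \<zero>" "r \<odot>\<^bsub>M\<^esub> x = \<zero>\<^bsub>M\<^esub>"
        "y \<in> carrier M" "s \<in> carrier R" "s \<noteq> \<zero>" "s \<odot>\<^bsub>M\<^esub> y = \<zero>\<^bsub>M\<^esub>"
        using xy by (auto simp: torsion_elements_def)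
      have "(r \<otimes> s) \<odot>\<^bsub>M\<^esub> x = (s \<otimes> r) \<odot>\<^bsub>M\<^esub> x"
        using * by (simp add: m_comm)
      then have "(r \<otimes> s) \<odot>\<^bsub>M\<^esub> (x \<oplus>\<^bsub>M\<^esub> y) = \<zero>\<^bsub>M\<^esub>"
        using * by (simp add: M.smult_r_distr M.smult_assoc1)
      then show ?thesis
        using * integral[of r s] unfolding torsion_elements_def
        by (intro CollectI conjI bexI[of _ "r \<otimes> s"]) auto
    qed
    show "a \<odot>\<^bsub>M\<^esub> x \<in> torsion_elements R M"
      if a: "a \<in> carrier R" and x: "x \<in> torsion_elements R M" for a x
    proof -
      obtain r where *: "x \<in> carrier M" "r \<in> carrier R" "r \<noteq> \<zero>" "r \<odot>\<^bsub>M\<^esub> x = \<zero>\<^bsub>M\<^esub>"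
        using x by (auto simp: torsion_elements_def)
      have "r \<odot>\<^bsub>M\<^esub> (a \<odot>\<^bsub>M\<^esub> x) = a \<odot>\<^bsub>M\<^esub> (r \<odot>\<^bsub>M\<^esub> x)"
        using * a by (intro M.smult_left_commute)
      then show ?thesis
        using * a unfolding torsion_elements_def
        by (intro CollectI conjI bexI[of _ r]) auto
    qed
  qed (auto simp: torsion_elements_def)
qed

lemma (in domain) functional_kills_torsion:
  assumes M: "Module.module R M" and H: "submodule H R M" and f: "functional_on R M H f"
    and x: "x \<in> H" "x \<in> torsion_elements R M"
  shows "f x = \<zero>"
proof -
  interpret M: Module.module R M by fact
  obtain r where r: "r \<in> carrier R" "r \<noteq> \<zero>" "r \<odot>\<^bsub>M\<^esub> x = \<zero>\<^bsub>M\<^esub>"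
    using x by (auto simp: torsion_elements_def)
  have "r \<otimes> f x = \<zero>"
    using linear_onD(3)[OF f r(1) x(1)] linear_on_arith(1)[OF M module_regular_module H f] r(3) by simp
  then show ?thesis
    using integral[of r "f x"] r linear_onD(1)[OF f x(1)] by simp
qed

lemma (in domain) torsion_of_kernel:
  assumes "Module.module R M" "submodule H R M" "functional_on R M H f"
  shows "{x \<in> H. f x = \<zero>} \<inter> torsion_elements R M = H \<inter> torsion_elements R M"
  using functional_kills_torsion[OF assms] by auto

text \<open>If some nonzero multiple \<open>r x\<close> lies in \<open>W\<close>, then
\<open>r V \<subseteq> W\<close> and the functionals \<open>z \<mapsto> f(r z)\<close> work.
Otherwise \<open>V\<close> is the direct sum of \<open>W\<close> and the free module on
\<open>x\<close>; extend each functional by zero and add the coordinate \<open>\<rho>\<close> along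
\<open>x\<close>.\<close>

lemma (in domain) functionals_on_extension_by_generator:
  assumes M: "Module.module R M" and W: "submodule W R M" and x: "x \<in> carrier M"
    and fs: "\<And>f. f \<in> set fs \<Longrightarrow> functional_on R M W f"
    and ker: "\<And>w. w \<in> W \<Longrightarrow> (\<And>f. f \<in> set fs \<Longrightarrow> f w = \<zero>) \<Longrightarrow> w \<in> torsion_elements R M"
    and V: "submodule V R M" "\<And>z. z \<in> V \<Longrightarrow> \<exists>r\<in>carrier R. z \<ominus>\<^bsub>M\<^esub> r \<odot>\<^bsub>M\<^esub> x \<in> W"
  shows "\<exists>gs. (\<forall>g\<in>set gs. functional_on R M V g) \<and>
     (\<forall>z\<in>V. (\<forall>g\<in>set gs. g z = \<zero>) \<longrightarrow> z \<in> torsion_elements R M)"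
proof -
  interpret M: Module.module R M by fact
  note Wc = M.submodule_closure[OF W] and Vc = M.submodule_closure[OF V(1)]
  show ?thesis
  proof (cases "\<exists>r\<in>carrier R - {\<zero>}. r \<odot>\<^bsub>M\<^esub> x \<in> W")
    case True
    then obtain r where r: "r \<in> carrier R" "r \<noteq> \<zero>" "r \<odot>\<^bsub>M\<^esub> x \<in> W" by auto
    have rV: "r \<odot>\<^bsub>M\<^esub> z \<in> W" if z: "z \<in> V" for z
    proof -
      obtain s where s: "s \<in> carrier R" "z \<ominus>\<^bsub>M\<^esub> s \<odot>\<^bsub>M\<^esub> x \<in> W" using V(2)[OF z] by auto
      have "r \<odot>\<^bsub>M\<^esub> z = r \<odot>\<^bsub>M\<^esub> ((z \<ominus>\<^bsub>M\<^esub> s \<odot>\<^bsub>M\<^esub> x) \<oplus>\<^bsub>M\<^esub> s \<odot>\<^bsub>M\<^esub> x)"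
        using Vc(7)[OF z] s x by (simp add: a_minus_def M.M.a_assoc M.M.l_neg)
      also have "\<dots> = r \<odot>\<^bsub>M\<^esub> (z \<ominus>\<^bsub>M\<^esub> s \<odot>\<^bsub>M\<^esub> x) \<oplus>\<^bsub>M\<^esub> r \<odot>\<^bsub>M\<^esub> (s \<odot>\<^bsub>M\<^esub> x)"
        using Wc(7)[OF s(2)] s x r by (intro M.smult_r_distr) auto
      also have "r \<odot>\<^bsub>M\<^esub> (s \<odot>\<^bsub>M\<^esub> x) = s \<odot>\<^bsub>M\<^esub> (r \<odot>\<^bsub>M\<^esub> x)"
        using r s x by (intro M.smult_left_commute)
      finally show ?thesis
        using Wc(3)[OF Wc(4)[OF r(1) s(2)] Wc(4)[OF s(1) r(3)]] by simp
    qed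
    have lin: "linear_on R M M V (\<lambda>z. r \<odot>\<^bsub>M\<^esub> z)"
    proof (rule linear_onI)
      fix a z assume "a \<in> carrier R" "z \<in> V"
      then show "r \<odot>\<^bsub>M\<^esub> (a \<odot>\<^bsub>M\<^esub> z) = a \<odot>\<^bsub>M\<^esub> (r \<odot>\<^bsub>M\<^esub> z)"
        using r Vc(7) by (intro M.smult_left_commute)
    qed (use Vc(7) r in \<open>auto intro: M.smult_r_distr\<close>)
    define gs where "gs = map (\<lambda>f z. f (r \<odot>\<^bsub>M\<^esub> z)) fs"
    have "functional_on R M V g" if g: "g \<in> set gs" for g
    proof -
      obtain f where "f \<in> set fs" "g = (\<lambda>z. f (r \<odot>\<^bsub>M\<^esub> z))" using g by (auto simp: gs_def)
      then show ?thesis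
        using linear_on_comp[OF lin fs] rV by auto
    qed
    moreover have "z \<in> torsion_elements R M" if z: "z \<in> V" and g: "\<forall>g\<in>set gs. g z = \<zero>" for z
    proof -
      have "r \<odot>\<^bsub>M\<^esub> z \<in> torsion_elements R M"
        using g by (intro ker rV z) (auto simp: gs_def)
      then obtain s where s: "s \<in> carrier R" "s \<noteq> \<zero>" "s \<odot>\<^bsub>M\<^esub> (r \<odot>\<^bsub>M\<^esub> z) = \<zero>\<^bsub>M\<^esub>"
        by (auto simp: torsion_elements_def)
      then have "(s \<otimes> r) \<odot>\<^bsub>M\<^esub> z = \<zero>\<^bsub>M\<^esub>"
        using Vc(7)[OF z] r by (simp add: M.smult_assoc1)
      then show ?thesis
        using s r integral[of s r] Vc(7)[OF z] unfolding torsion_elements_def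
        by (intro CollectI conjI bexI[of _ "s \<otimes> r"]) auto
    qed
    ultimately show ?thesis by blast
  next
    case False
    obtain \<rho> where \<rho>: "\<And>z. z \<in> V \<Longrightarrow> \<rho> z \<in> carrier R" "\<And>z. z \<in> V \<Longrightarrow> z \<ominus>\<^bsub>M\<^esub> \<rho> z \<odot>\<^bsub>M\<^esub> x \<in> W"
      using V(2) by metis
    have uniq: "\<rho> z = r" if z: "z \<in> V" and r: "r \<in> carrier R" and rW: "z \<ominus>\<^bsub>M\<^esub> r \<odot>\<^bsub>M\<^esub> x \<in> W" for z r
    proof -
      have zM: "z \<in> carrier M" using Vc(7)[OF z] .
      have "(z \<ominus>\<^bsub>M\<^esub> r \<odot>\<^bsub>M\<^esub> x) \<ominus>\<^bsub>M\<^esub> (z \<ominus>\<^bsub>M\<^esub> \<rho> z \<odot>\<^bsub>M\<^esub> x) = (\<rho> z \<ominus> r) \<odot>\<^bsub>M\<^esub> x"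
        using zM r \<rho>(1)[OF z] x
        by (simp add: a_minus_def M.smult_l_distr M.smult_l_minus M.M.minus_add M.M.a_ac M.M.r_neg2 M.M.r_neg1)
      then have "(\<rho> z \<ominus> r) \<odot>\<^bsub>M\<^esub> x \<in> W"
        using Wc(6)[OF rW \<rho>(2)[OF z]] by simp
      then have "\<rho> z \<ominus> r = \<zero>"
        using False \<rho>(1)[OF z] r by auto
      then show ?thesis
        using \<rho>(1)[OF z] r by (simp add: r_right_minus_eq)
    qed
    have \<rho>_add: "\<rho> (y \<oplus>\<^bsub>M\<^esub> z) = \<rho> y \<oplus> \<rho> z" if y: "y \<in> V" and z: "z \<in> V" for y z
    proof (rule uniq)
      have "(y \<oplus>\<^bsub>M\<^esub> z) \<ominus>\<^bsub>M\<^esub> (\<rho> y \<oplus> \<rho> z) \<odot>\<^bsub>M\<^esub> x = (y \<ominus>\<^bsub>M\<^esub> \<rho> y \<odot>\<^bsub>M\<^esub> x) \<oplus>\<^bsub>M\<^esub> (z \<ominus>\<^bsub>M\<^esub> \<rho> z \<odot>\<^bsub>M\<^esub> x)"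
        using Vc(7)[OF y] Vc(7)[OF z] \<rho>(1)[OF y] \<rho>(1)[OF z] x
        by (simp add: a_minus_def M.smult_l_distr M.M.minus_add M.M.a_ac)
      then show "(y \<oplus>\<^bsub>M\<^esub> z) \<ominus>\<^bsub>M\<^esub> (\<rho> y \<oplus> \<rho> z) \<odot>\<^bsub>M\<^esub> x \<in> W"
        using Wc(3)[OF \<rho>(2)[OF y] \<rho>(2)[OF z]] by simp
    qed (use Vc(3) y z \<rho>(1) in auto)
    have \<rho>_mult: "\<rho> (a \<odot>\<^bsub>M\<^esub> z) = a \<otimes> \<rho> z" if a: "a \<in> carrier R" and z: "z \<in> V" for a z
    proof (rule uniq)
      have "(a \<odot>\<^bsub>M\<^esub> z) \<ominus>\<^bsub>M\<^esub> (a \<otimes> \<rho> z) \<odot>\<^bsub>M\<^esub> x = a \<odot>\<^bsub>M\<^esub> (z \<ominus>\<^bsub>M\<^esub> \<rho> z \<odot>\<^bsub>M\<^esub> x)"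
        using Vc(7)[OF z] \<rho>(1)[OF z] x a
        by (simp add: a_minus_def M.smult_r_distr M.smult_r_minus M.smult_assoc1)
      then show "(a \<odot>\<^bsub>M\<^esub> z) \<ominus>\<^bsub>M\<^esub> (a \<otimes> \<rho> z) \<odot>\<^bsub>M\<^esub> x \<in> W"
        using Wc(4)[OF a \<rho>(2)[OF z]] by simp
    qed (use Vc(4) a z \<rho>(1) in auto)
    define \<omega> where "\<omega> z = z \<ominus>\<^bsub>M\<^esub> \<rho> z \<odot>\<^bsub>M\<^esub> x" for z
    have \<rho>_lin: "functional_on R M V \<rho>"
      using \<rho>(1) \<rho>_add \<rho>_mult by (intro linear_onI) simp_all
    have \<omega>_lin: "linear_on R M M V \<omega>"
    proof (rule linear_onI)
      show "\<omega> y \<in> carrier M" if "y \<in> V" for y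
        using Wc(7) \<rho>(2) that by (simp add: \<omega>_def)
      show "\<omega> (y \<oplus>\<^bsub>M\<^esub> z) = \<omega> y \<oplus>\<^bsub>M\<^esub> \<omega> z" if "y \<in> V" "z \<in> V" for y z
        using Vc(7) that \<rho>(1) x \<rho>_add
        by (simp add: \<omega>_def a_minus_def M.smult_l_distr M.M.minus_add M.M.a_ac)
      show "\<omega> (a \<odot>\<^bsub>M\<^esub> z) = a \<odot>\<^bsub>M\<^esub> \<omega> z" if "a \<in> carrier R" "z \<in> V" for a z
        using Vc(7) that \<rho>(1) x \<rho>_mult
        by (simp add: \<omega>_def a_minus_def M.smult_r_distr M.smult_r_minus M.smult_assoc1)
    qed
    have \<omega>W: "\<omega> ` V \<subseteq> W" using \<rho>(2) by (auto simp: \<omega>_def)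
    define gs where "gs = \<rho> # map (\<lambda>f z. f (\<omega> z)) fs"
    have "functional_on R M V g" if g: "g \<in> set gs" for g
    proof -
      have "g = \<rho> \<or> (\<exists>f\<in>set fs. g = (\<lambda>z. f (\<omega> z)))" using g by (auto simp: gs_def)
      then show ?thesis
        using linear_on_comp[OF \<omega>_lin fs \<omega>W] \<rho>_lin by auto
    qed
    moreover have "z \<in> torsion_elements R M" if z: "z \<in> V" and g: "\<forall>g\<in>set gs. g z = \<zero>" for z
    proof -
      have "\<rho> z = \<zero>" using g by (simp add: gs_def)
      then have \<omega>z: "\<omega> z = z" using Vc(7)[OF z] x by (simp add: \<omega>_def a_minus_def)
      then have "z \<in> W" using \<omega>W z by (metis image_subset_iff)
      then show ?thesis
        using g \<omega>z by (intro ker) (auto simp: gs_def)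
    qed
    ultimately show ?thesis by blast
  qed
qed

lemma (in Module.module) finitely_generated_carrier_lincombs:
  assumes "finitely_generated_module R M"
  shows "\<exists>xs. set xs \<subseteq> carrier M \<and> carrier M = {lincomb M rs xs | rs. set rs \<subseteq> carrier R}"
proof -
  obtain A where A: "finite A" "A \<subseteq> carrier M" "carrier M = submodule_span R M A"
    using assms by (auto simp: finitely_generated_module_def)
  obtain xs where xs: "set xs = A"
    using A(1) finite_list by blast
  let ?L = "{lincomb M rs xs | rs. set rs \<subseteq> carrier R}"
  have L: "submodule ?L R M"
    using A xs by (intro submodule_lincombs) auto
  moreover have "A \<subseteq> ?L"
    using lincomb_unit[of _ xs] A xs by blast
  ultimately have "submodule_span R M A \<subseteq> ?L"
    unfolding submodule_span_def by (intro Inter_lower) simp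
  then have "carrier M = ?L"
    using A(3) submodule_closure(1)[OF L] by (intro equalityI) simp_all
  with A(2) xs show ?thesis
    by (intro exI[of _ xs] conjI) simp_all
qed

text \<open>Induction on the number of generators: finitely many functionals embed the module modulo
torsion into a free module.\<close>

lemma (in domain) functionals_detecting_torsion:
  assumes M: "finitely_generated_module R M"
  shows "\<exists>fs. (\<forall>f\<in>set fs. functional_on R M (carrier M) f) \<and>
     (\<forall>z\<in>carrier M. (\<forall>f\<in>set fs. f z = \<zero>) \<longrightarrow> z \<in> torsion_elements R M)"
proof -
  have mod: "Module.module R M" using M by (simp add: finitely_generated_module_def)
  interpret M: Module.module R M by fact
  obtain xs where xs: "set xs \<subseteq> carrier M" "carrier M = {lincomb M rs xs | rs. set rs \<subseteq> carrier R}"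
    using M.finitely_generated_carrier_lincombs[OF M] by blast
  define L where "L ys = {lincomb M rs ys | rs. set rs \<subseteq> carrier R}" for ys
  have L_sub: "submodule (L ys) R M" if "set ys \<subseteq> carrier M" for ys
    unfolding L_def using that by (rule M.submodule_lincombs)
  have "\<exists>fs. (\<forall>f\<in>set fs. functional_on R M (L ys) f) \<and>
     (\<forall>z\<in>L ys. (\<forall>f\<in>set fs. f z = \<zero>) \<longrightarrow> z \<in> torsion_elements R M)" if "set ys \<subseteq> carrier M" for ys
    using that
  proof (induction ys)
    case Nil
    have "L [] \<subseteq> {\<zero>\<^bsub>M\<^esub>}" by (auto simp: L_def)
    then have "L [] \<subseteq> torsion_elements R M"
      using M.submodule_closure(2)[OF submodule_torsion_elements[OF mod]] by auto
    then show ?case by (intro exI[of _ "[]"]) auto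
  next
    case (Cons y ys)
    have y: "y \<in> carrier M" "set ys \<subseteq> carrier M" "set (y # ys) \<subseteq> carrier M" using Cons.prems by auto
    from Cons.IH[OF y(2)] obtain fs where fs': "\<forall>f\<in>set fs. functional_on R M (L ys) f"
      "\<forall>z\<in>L ys. (\<forall>f\<in>set fs. f z = \<zero>) \<longrightarrow> z \<in> torsion_elements R M"
      by (elim exE conjE)
    have fs: "functional_on R M (L ys) f" if "f \<in> set fs" for f
      using fs'(1) that by simp
    have ker: "z \<in> torsion_elements R M" if "z \<in> L ys" "\<And>f. f \<in> set fs \<Longrightarrow> f z = \<zero>" for z
      using fs'(2) that by simp
    show ?case
    proof (rule functionals_on_extension_by_generator[OF mod L_sub[OF y(2)] y(1) fs ker L_sub[OF y(3)]])
      fix z assume "z \<in> L (y # ys)"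
      then obtain rs where rs: "set rs \<subseteq> carrier R" "z = lincomb M rs (y # ys)" by (auto simp: L_def)
      show "\<exists>r\<in>carrier R. z \<ominus>\<^bsub>M\<^esub> r \<odot>\<^bsub>M\<^esub> y \<in> L ys"
      proof (cases rs)
        case Nil
        then have "z \<ominus>\<^bsub>M\<^esub> \<zero> \<odot>\<^bsub>M\<^esub> y = \<zero>\<^bsub>M\<^esub>"
          using rs y by (simp add: a_minus_def)
        then have "z \<ominus>\<^bsub>M\<^esub> \<zero> \<odot>\<^bsub>M\<^esub> y \<in> L ys"
          using M.submodule_closure(2)[OF L_sub[OF y(2)]] by simp
        then show ?thesis by blast
      next
        case (Cons r rs')
        have c: "r \<in> carrier R" "set rs' \<subseteq> carrier R" "lincomb M rs' ys \<in> carrier M"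
          using rs Cons y by auto
        then have "z \<ominus>\<^bsub>M\<^esub> r \<odot>\<^bsub>M\<^esub> y = lincomb M rs' ys"
          using rs(2) Cons y by (simp add: a_minus_def M.M.a_ac M.M.r_neg2 M.M.r_neg1 M.M.r_neg)
        then show ?thesis using c unfolding L_def by blast
      qed
    qed
  qed
  from this[OF xs(1)] show ?thesis
    unfolding L_def xs(2)[symmetric] .
qed

text \<open>Restrict each functional to the common kernel of the earlier ones, and skip those that
become zero there.\<close>

lemma (in domain) peels_of_functionals:
  assumes M: "Module.module R M"
  shows "submodule H R M \<Longrightarrow> (\<And>f. f \<in> set fs \<Longrightarrow> functional_on R M H f) \<Longrightarrow>
    (\<And>z. z \<in> H \<Longrightarrow> (\<And>f. f \<in> set fs \<Longrightarrow> f z = \<zero>) \<Longrightarrow> z \<in> torsion_elements R M) \<Longrightarrow>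
    \<exists>As. peels R M H As"
proof (induction fs arbitrary: H)
  case Nil
  then have "peels R M H []" by auto
  then show ?case by blast
next
  case (Cons f fs)
  have f: "functional_on R M H f" using Cons.prems by simp
  show ?case
  proof (cases "f ` H = {\<zero>}")
    case True
    show ?thesis
    proof (rule Cons.IH)
      show "z \<in> torsion_elements R M" if "z \<in> H" "\<And>f. f \<in> set fs \<Longrightarrow> f z = \<zero>" for z
        using that True by (intro Cons.prems(3)) auto
    qed (use Cons.prems in auto)
  next
    case False
    have "\<exists>As. peels R M {x \<in> H. f x = \<zero>} As"
    proof (rule Cons.IH)
      show "submodule {x \<in> H. f x = \<zero>} R M"
        using submodule_kernel[OF M module_regular_module Cons.prems(1) f] by simp
      show "functional_on R M {x \<in> H. f x = \<zero>} g" if "g \<in> set fs" for g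
        using Cons.prems(2)[of g] that by (auto intro: linear_on_subset)
      show "z \<in> torsion_elements R M" if "z \<in> {x \<in> H. f x = \<zero>}" "\<And>g. g \<in> set fs \<Longrightarrow> g z = \<zero>" for z
        using that by (intro Cons.prems(3)) auto
    qed
    then obtain As where "peels R M {x \<in> H. f x = \<zero>} As" ..
    then have "peels R M H (f ` H # As)"
      using f False by auto
    then show ?thesis by blast
  qed
qed

lemma (in domain) exists_peels:
  assumes M: "finitely_generated_module R M"
  shows "\<exists>As. peels R M (carrier M) As"
proof -
  have mod: "Module.module R M" using M by (simp add: finitely_generated_module_def)
  obtain fs where fs: "\<forall>f\<in>set fs. functional_on R M (carrier M) f"
    "\<forall>z\<in>carrier M. (\<forall>f\<in>set fs. f z = \<zero>) \<longrightarrow> z \<in> torsion_elements R M"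
    using functionals_detecting_torsion[OF M] by (elim exE conjE)
  show ?thesis
  proof (rule peels_of_functionals[OF mod module.carrier_is_submodule[OF mod]])
    show "functional_on R M (carrier M) f" if "f \<in> set fs" for f using fs(1) that by simp
    show "z \<in> torsion_elements R M" if "z \<in> carrier M" "\<And>f. f \<in> set fs \<Longrightarrow> f z = \<zero>" for z
      using fs(2) that by simp
  qed
qed

section \<open>Consequences of projectivity\<close>

context dedekind_domain
begin

lemma functional_splitting:
  assumes M: "Module.module R M" and H: "submodule H R M"
    and f: "functional_on R M H f" and nz: "f ` H \<noteq> {\<zero>}"
  obtains s where "linear_on R (regular_module R) M (f ` H) s" "\<And>a. a \<in> f ` H \<Longrightarrow> s a \<in> H"
    "\<And>a. a \<in> f ` H \<Longrightarrow> f (s a) = a"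
    "linear_on R M M H (\<lambda>x. x \<ominus>\<^bsub>M\<^esub> s (f x))"
    "\<And>x. x \<in> H \<Longrightarrow> x \<ominus>\<^bsub>M\<^esub> s (f x) \<in> {x \<in> H. f x = \<zero>}"
    "\<And>x. x \<in> H \<Longrightarrow> f x = \<zero> \<Longrightarrow> x \<ominus>\<^bsub>M\<^esub> s (f x) = x"
proof -
  interpret M: Module.module R M by fact
  note Hc = M.submodule_closure[OF H] and fD = linear_onD[OF f, simplified]
  obtain s where s: "linear_on R (regular_module R) M (f ` H) s" "s ` f ` H \<subseteq> H" "\<forall>a\<in>f ` H. f (s a) = a"
    using section_of_functional[OF M H f nz] by blast
  have sH: "s a \<in> H" if "a \<in> f ` H" for a using s(2) that by blast
  note sD = linear_onD[OF s(1), simplified]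
  have A: "submodule (f ` H) R (regular_module R)"
    by (rule submodule_image[OF M module_regular_module H f])
  have s0: "s \<zero> = \<zero>\<^bsub>M\<^esub>"
    using linear_on_arith(1)[OF module_regular_module M A s(1)] by simp
  show thesis
  proof (rule that[OF s(1) sH])
    show "f (s a) = a" if "a \<in> f ` H" for a by (rule bspec[OF s(3) that])
    show "linear_on R M M H (\<lambda>x. x \<ominus>\<^bsub>M\<^esub> s (f x))"
    proof (rule linear_onI)
      show "x \<ominus>\<^bsub>M\<^esub> s (f x) \<in> carrier M" if "x \<in> H" for x
        using Hc(7) sH that by simp
      show "(x \<oplus>\<^bsub>M\<^esub> y) \<ominus>\<^bsub>M\<^esub> s (f (x \<oplus>\<^bsub>M\<^esub> y)) = (x \<ominus>\<^bsub>M\<^esub> s (f x)) \<oplus>\<^bsub>M\<^esub> (y \<ominus>\<^bsub>M\<^esub> s (f y))"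
        if "x \<in> H" "y \<in> H" for x y
        using that fD(2)[OF that] sD(2)[of "f x" "f y"] Hc(7) sH
        by (simp add: a_minus_def M.M.minus_add M.M.a_ac)
      show "(r \<odot>\<^bsub>M\<^esub> x) \<ominus>\<^bsub>M\<^esub> s (f (r \<odot>\<^bsub>M\<^esub> x)) = r \<odot>\<^bsub>M\<^esub> (x \<ominus>\<^bsub>M\<^esub> s (f x))"
        if "r \<in> carrier R" "x \<in> H" for r x
        using that fD(3)[OF that] sD(3)[of r "f x"] Hc(7) sH
        by (simp add: a_minus_def M.smult_r_distr M.smult_r_minus)
    qed
    show "x \<ominus>\<^bsub>M\<^esub> s (f x) \<in> {x \<in> H. f x = \<zero>}" if x: "x \<in> H" for x
    proof -
      have sx: "s (f x) \<in> H" using sH x by simp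
      have "f (x \<ominus>\<^bsub>M\<^esub> s (f x)) = f x \<ominus> f (s (f x))"
        using linear_on_arith(3)[OF M module_regular_module H f x sx] by simp
      then show ?thesis
        using s(3) x fD(1)[OF x] Hc(6)[OF x sx] by (simp add: r_right_minus_eq)
    qed
    show "x \<ominus>\<^bsub>M\<^esub> s (f x) = x" if "x \<in> H" "f x = \<zero>" for x
      using that s0 Hc(7) by (simp add: a_minus_def)
  qed
qed

text \<open>Compose the projections to the successive kernels. It follows that the torsion submodule is
finitely generated when the module is.\<close>

lemma peels_torsion_retraction:
  assumes M: "Module.module R M"
  shows "submodule H R M \<Longrightarrow> peels R M H As \<Longrightarrow>
    \<exists>\<rho>. linear_on R M M H \<rho> \<and> \<rho> ` H \<subseteq> H \<inter> torsion_elements R M \<and>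
        (\<forall>x\<in>H \<inter> torsion_elements R M. \<rho> x = x)"
proof (induction As arbitrary: H)
  case Nil
  interpret M: Module.module R M by fact
  note Hc = M.submodule_closure[OF Nil.prems(1)]
  have "linear_on R M M H (\<lambda>x. x)" using Hc(1) by (intro linear_onI) auto
  then show ?case using Nil.prems by (intro exI[of _ "\<lambda>x. x"]) auto
next
  case (Cons A As)
  note H = \<open>submodule H R M\<close>
  obtain f where f: "functional_on R M H f" "f ` H = A" "A \<noteq> {\<zero>}" "peels R M {x \<in> H. f x = \<zero>} As"
    using Cons.prems by auto
  define K where "K = {x \<in> H. f x = \<zero>}"
  have K: "submodule K R M"
    unfolding K_def using submodule_kernel[OF M module_regular_module H f(1)] by simp
  have KT: "K \<inter> torsion_elements R M = H \<inter> torsion_elements R M"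
    unfolding K_def by (rule torsion_of_kernel[OF M H f(1)])
  have nz: "f ` H \<noteq> {\<zero>}" using f by simp
  obtain s where s: "linear_on R (regular_module R) M (f ` H) s" "\<And>a. a \<in> f ` H \<Longrightarrow> s a \<in> H"
    "\<And>a. a \<in> f ` H \<Longrightarrow> f (s a) = a"
    "linear_on R M M H (\<lambda>x. x \<ominus>\<^bsub>M\<^esub> s (f x))"
    "\<And>x. x \<in> H \<Longrightarrow> x \<ominus>\<^bsub>M\<^esub> s (f x) \<in> K"
    "\<And>x. x \<in> H \<Longrightarrow> f x = \<zero> \<Longrightarrow> x \<ominus>\<^bsub>M\<^esub> s (f x) = x"
    by (rule functional_splitting[OF M H f(1) nz, folded K_def]) (rule that)
  obtain \<rho> where \<rho>: "linear_on R M M K \<rho>" "\<rho> ` K \<subseteq> K \<inter> torsion_elements R M"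
    "\<forall>x\<in>K \<inter> torsion_elements R M. \<rho> x = x"
    using Cons.IH[OF K] f(4) unfolding K_def by blast
  show ?case
  proof (intro exI conjI ballI)
    show "linear_on R M M H (\<lambda>x. \<rho> (x \<ominus>\<^bsub>M\<^esub> s (f x)))"
      using s(5) by (intro linear_on_comp[OF s(4) \<rho>(1)]) auto
    show "(\<lambda>x. \<rho> (x \<ominus>\<^bsub>M\<^esub> s (f x))) ` H \<subseteq> H \<inter> torsion_elements R M"
    proof
      fix y assume "y \<in> (\<lambda>x. \<rho> (x \<ominus>\<^bsub>M\<^esub> s (f x))) ` H"
      then obtain x where "x \<in> H" "y = \<rho> (x \<ominus>\<^bsub>M\<^esub> s (f x))" by auto
      then have "y \<in> K \<inter> torsion_elements R M" using \<rho>(2) s(5) by auto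
      then show "y \<in> H \<inter> torsion_elements R M" using KT by simp
    qed
    fix x assume x: "x \<in> H \<inter> torsion_elements R M"
    then have "x \<in> K \<inter> torsion_elements R M" using KT by simp
    then show "\<rho> (x \<ominus>\<^bsub>M\<^esub> s (f x)) = x"
      using \<rho>(3) s(6)[of x] by (auto simp: K_def)
  qed
qed

text \<open>At each step both modules split off the same ideal, so an isomorphism of the kernels
extends; it starts from the given isomorphism \<open>\<theta>\<close> of the torsion submodules. The
torsion submodules lie in all kernels.\<close>

lemma isomorphism_from_peels:
  assumes M: "Module.module R M" and N: "Module.module R N"
  shows "submodule H R M \<Longrightarrow> submodule K R N \<Longrightarrow> peels R M H As \<Longrightarrow> peels R N K As \<Longrightarrow>
    linear_on R M N (H \<inter> torsion_elements R M) \<theta> \<Longrightarrow>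
    bij_betw \<theta> (H \<inter> torsion_elements R M) (K \<inter> torsion_elements R N) \<Longrightarrow>
    \<exists>\<phi>. linear_on R M N H \<phi> \<and> bij_betw \<phi> H K"
proof (induction As arbitrary: H K)
  case Nil
  then have "H \<inter> torsion_elements R M = H" "K \<inter> torsion_elements R N = K" by auto
  with Nil show ?case by auto
next
  case (Cons A As)
  interpret M: Module.module R M by fact
  interpret N: Module.module R N by fact
  note H = \<open>submodule H R M\<close> and K = \<open>submodule K R N\<close>
  note Hc = M.submodule_closure[OF H] and Kc = N.submodule_closure[OF K]
  obtain f where f: "functional_on R M H f" "f ` H = A" "A \<noteq> {\<zero>}" "peels R M {x \<in> H. f x = \<zero>} As"
    using Cons.prems by auto
  obtain g where g: "functional_on R N K g" "g ` K = A" "peels R N {x \<in> K. g x = \<zero>} As"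
    using Cons.prems by auto
  define H' where "H' = {x \<in> H. f x = \<zero>}"
  define K' where "K' = {x \<in> K. g x = \<zero>}"
  have H': "submodule H' R M"
    unfolding H'_def using submodule_kernel[OF M module_regular_module H f(1)] by simp
  have K': "submodule K' R N"
    unfolding K'_def using submodule_kernel[OF N module_regular_module K g(1)] by simp
  have HT: "H' \<inter> torsion_elements R M = H \<inter> torsion_elements R M"
    unfolding H'_def by (rule torsion_of_kernel[OF M H f(1)])
  have KT: "K' \<inter> torsion_elements R N = K \<inter> torsion_elements R N"
    unfolding K'_def by (rule torsion_of_kernel[OF N K g(1)])
  have "\<exists>\<phi>. linear_on R M N H' \<phi> \<and> bij_betw \<phi> H' K'"
    using f(4) g(3) Cons.prems(5,6)
    by (intro Cons.IH[OF H' K']) (simp_all only: HT KT H'_def[symmetric] K'_def[symmetric])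
  then obtain \<phi> where \<phi>: "linear_on R M N H' \<phi>" "bij_betw \<phi> H' K'"
    by (elim exE conjE)
  have \<phi>K: "\<phi> x \<in> K'" if "x \<in> H'" for x using \<phi>(2) that by (auto simp: bij_betw_def)
  have nz: "f ` H \<noteq> {\<zero>}" "g ` K \<noteq> {\<zero>}" using f g by auto
  obtain s where s: "linear_on R (regular_module R) M (f ` H) s" "\<And>a. a \<in> f ` H \<Longrightarrow> s a \<in> H"
    "\<And>a. a \<in> f ` H \<Longrightarrow> f (s a) = a"
    "linear_on R M M H (\<lambda>x. x \<ominus>\<^bsub>M\<^esub> s (f x))"
    "\<And>x. x \<in> H \<Longrightarrow> x \<ominus>\<^bsub>M\<^esub> s (f x) \<in> H'"
    "\<And>x. x \<in> H \<Longrightarrow> f x = \<zero> \<Longrightarrow> x \<ominus>\<^bsub>M\<^esub> s (f x) = x"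
    by (rule functional_splitting[OF M H f(1) nz(1), folded H'_def]) (rule that)
  obtain t where t: "linear_on R (regular_module R) N (g ` K) t" "\<And>a. a \<in> g ` K \<Longrightarrow> t a \<in> K"
    "\<And>a. a \<in> g ` K \<Longrightarrow> g (t a) = a"
    "linear_on R N N K (\<lambda>x. x \<ominus>\<^bsub>N\<^esub> t (g x))"
    "\<And>x. x \<in> K \<Longrightarrow> x \<ominus>\<^bsub>N\<^esub> t (g x) \<in> K'"
    "\<And>x. x \<in> K \<Longrightarrow> g x = \<zero> \<Longrightarrow> x \<ominus>\<^bsub>N\<^esub> t (g x) = x"
    by (rule functional_splitting[OF N K g(1) nz(2), folded K'_def]) (rule that)
  have fA: "f x \<in> g ` K" if "x \<in> H" for x using that f(2) g(2) by auto
  have gA: "g x \<in> f ` H" if "x \<in> K" for x using that f(2) g(2) by auto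
  define \<psi> where "\<psi> x = \<phi> (x \<ominus>\<^bsub>M\<^esub> s (f x)) \<oplus>\<^bsub>N\<^esub> t (f x)" for x
  have lin1: "linear_on R M N H (\<lambda>x. \<phi> (x \<ominus>\<^bsub>M\<^esub> s (f x)))"
    using s(5) by (intro linear_on_comp[OF s(4) \<phi>(1)]) auto
  have lin2: "linear_on R M N H (\<lambda>x. t (f x))"
    using fA by (intro linear_on_comp[OF f(1) t(1)]) auto
  have lin: "linear_on R M N H \<psi>"
    unfolding \<psi>_def using linear_onD[OF lin1] linear_onD[OF lin2]
    by (intro linear_onI) (simp_all add: N.smult_r_distr N.M.a_ac)
  have \<psi>K: "\<psi> x \<in> K" if x: "x \<in> H" for x
    using \<phi>K[OF s(5)[OF x]] t(2)[OF fA[OF x]] Kc(3) unfolding \<psi>_def K'_def by auto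
  have g\<psi>: "g (\<psi> x) = f x" if x: "x \<in> H" for x
  proof -
    have "g (\<psi> x) = g (\<phi> (x \<ominus>\<^bsub>M\<^esub> s (f x))) \<oplus> g (t (f x))"
      using linear_onD(2)[OF g(1), simplified] \<phi>K[OF s(5)[OF x]] t(2)[OF fA[OF x]]
      unfolding \<psi>_def K'_def by auto
    then show ?thesis
      using \<phi>K[OF s(5)[OF x]] t(3)[OF fA[OF x]] linear_onD(1)[OF f(1) x] unfolding K'_def by simp
  qed
  have "inj_on \<psi> H"
  proof (rule inj_onI)
    fix x y assume xy: "x \<in> H" "y \<in> H" "\<psi> x = \<psi> y"
    then have fxy: "f x = f y" using g\<psi> by metis
    have c: "\<phi> (x \<ominus>\<^bsub>M\<^esub> s (f x)) \<in> carrier N" "\<phi> (y \<ominus>\<^bsub>M\<^esub> s (f y)) \<in> carrier N" "t (f y) \<in> carrier N"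
      using linear_onD(1)[OF lin1] linear_onD(1)[OF lin2] xy by auto
    have "\<phi> (x \<ominus>\<^bsub>M\<^esub> s (f x)) = \<phi> (y \<ominus>\<^bsub>M\<^esub> s (f y))"
      using xy(3) c unfolding \<psi>_def fxy by (simp add: N.M.add.r_cancel)
    then have "x \<ominus>\<^bsub>M\<^esub> s (f x) = y \<ominus>\<^bsub>M\<^esub> s (f y)"
      using \<phi>(2) s(5) xy by (auto simp: bij_betw_def inj_on_def)
    moreover have "x \<in> carrier M" "y \<in> carrier M" "s (f y) \<in> carrier M"
      using Hc(7) s(2) xy by auto
    ultimately show "x = y"
      unfolding fxy by (simp add: a_minus_def M.M.add.r_cancel)
  qed
  moreover have "\<psi> ` H = K"
  proof
    show "\<psi> ` H \<subseteq> K" using \<psi>K by auto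
    show "K \<subseteq> \<psi> ` H"
    proof
      fix y assume y: "y \<in> K"
      obtain k where k: "k \<in> H'" "\<phi> k = y \<ominus>\<^bsub>N\<^esub> t (g y)"
        using t(5)[OF y] \<phi>(2) by (metis bij_betw_def imageE)
      have kH: "k \<in> H" "f k = \<zero>" using k by (auto simp: H'_def)
      define x where "x = k \<oplus>\<^bsub>M\<^esub> s (g y)"
      have sg: "s (g y) \<in> H" "f (s (g y)) = g y" using s(2,3) gA[OF y] by auto
      have x: "x \<in> H" unfolding x_def using Hc(3)[OF kH(1) sg(1)] .
      have fx: "f x = g y"
        using linear_onD(2)[OF f(1) kH(1) sg(1)] kH sg linear_onD(1)[OF g(1) y] by (simp add: x_def)
      have "x \<ominus>\<^bsub>M\<^esub> s (f x) = k"
        unfolding fx unfolding x_def using Hc(7)[OF kH(1)] Hc(7)[OF sg(1)]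
        by (simp add: a_minus_def M.M.a_assoc M.M.r_neg)
      then have "\<psi> x = (y \<ominus>\<^bsub>N\<^esub> t (g y)) \<oplus>\<^bsub>N\<^esub> t (g y)"
        unfolding \<psi>_def using k fx by simp
      also have "\<dots> = y"
        using Kc(7)[OF y] Kc(7)[OF t(2)[of "g y"]] y by (simp add: a_minus_def N.M.a_assoc N.M.l_neg)
      finally show "y \<in> \<psi> ` H" using x by auto
    qed
  qed
  ultimately show ?case using lin unfolding bij_betw_def by blast
qed

text \<open>If the rank is at least two, a free summand splits off. Choose \<open>\<alpha>\<close> on
\<open>A\<close> with \<open>\<alpha>(A) + B = R\<close>. The functional \<open>h\<close> that is
\<open>\<alpha>\<close> on the summand \<open>A\<close> and \<open>g\<close> on the kernel of
\<open>f\<close> is onto \<open>R\<close>. On its kernel, \<open>f\<close> still has a nonzero ideal as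
image, and the part of that kernel killed by \<open>f\<close> is the kernel of \<open>g\<close>, so the
rest of the list is unchanged.\<close>

lemma peels_first_ideal_to_ring:
  assumes M: "Module.module R M" and H: "submodule H R M" and peels: "peels R M H (A # B # Cs)"
  shows "\<exists>A'. peels R M H (carrier R # A' # Cs)"
proof -
  interpret M: Module.module R M by fact
  note Hc = M.submodule_closure[OF H]
  obtain f where f: "functional_on R M H f" "f ` H = A" "A \<noteq> {\<zero>}" "peels R M {x \<in> H. f x = \<zero>} (B # Cs)"
    using peels by auto
  define K where "K = {x \<in> H. f x = \<zero>}"
  have K: "submodule K R M"
    unfolding K_def using submodule_kernel[OF M module_regular_module H f(1)] by simp
  obtain g where g: "functional_on R M K g" "g ` K = B" "B \<noteq> {\<zero>}" "peels R M {x \<in> K. g x = \<zero>} Cs"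
    using f(4) unfolding K_def by auto
  have nz: "f ` H \<noteq> {\<zero>}" using f by simp
  obtain s where s: "linear_on R (regular_module R) M (f ` H) s" "\<And>a. a \<in> f ` H \<Longrightarrow> s a \<in> H"
    "\<And>a. a \<in> f ` H \<Longrightarrow> f (s a) = a"
    "linear_on R M M H (\<lambda>x. x \<ominus>\<^bsub>M\<^esub> s (f x))"
    "\<And>x. x \<in> H \<Longrightarrow> x \<ominus>\<^bsub>M\<^esub> s (f x) \<in> K"
    "\<And>x. x \<in> H \<Longrightarrow> f x = \<zero> \<Longrightarrow> x \<ominus>\<^bsub>M\<^esub> s (f x) = x"
    by (rule functional_splitting[OF M H f(1) nz, folded K_def]) (rule that)
  have A: "ideal A R"
    using submodule_image[OF M module_regular_module H f(1)] f(2) by (simp add: submodule_regular_iff)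
  have B: "ideal B R"
    using submodule_image[OF M module_regular_module K g(1)] g(2) by (simp add: submodule_regular_iff)
  note Ac = ideal_closure[OF A] and Bc = ideal_closure[OF B]
  obtain \<alpha> a0 b0 where \<alpha>: "functional_on R (regular_module R) A \<alpha>"
    and ab: "a0 \<in> A" "b0 \<in> B" "\<alpha> a0 \<oplus> b0 = \<one>"
    using functional_with_coprime_image[OF A f(3) B g(3)] by blast
  note \<alpha>D = linear_onD[OF \<alpha>, simplified] and gD = linear_onD[OF g(1), simplified]
    and fD = linear_onD[OF f(1), simplified]
  have \<alpha>0: "\<alpha> \<zero> = \<zero>"
    using linear_on_arith(1)[OF module_regular_module module_regular_module _ \<alpha>] A
    by (simp add: submodule_regular_iff)
  define h where "h x = \<alpha> (f x) \<oplus> g (x \<ominus>\<^bsub>M\<^esub> s (f x))" for x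
  have fA: "f x \<in> A" if "x \<in> H" for x using that f(2) by auto
  have lin1: "functional_on R M H (\<lambda>x. \<alpha> (f x))"
    using fA by (intro linear_on_comp[OF f(1) \<alpha>]) auto
  have lin2: "functional_on R M H (\<lambda>x. g (x \<ominus>\<^bsub>M\<^esub> s (f x)))"
    using s(5) by (intro linear_on_comp[OF s(4) g(1)]) auto
  have h: "functional_on R M H h"
    unfolding h_def using linear_onD[OF lin1] linear_onD[OF lin2]
    by (intro linear_onI) (simp_all add: r_distr a_ac)
  \<comment> \<open>\<open>H\<close> is the direct sum of \<open>A\<close> and \<open>K\<close>, so both components of an element can be prescribed\<close>
  have point: "\<exists>x\<in>H. f x = a \<and> h x = \<alpha> a \<oplus> g k" if a: "a \<in> A" and k: "k \<in> K" for a k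
  proof -
    have kH: "k \<in> H" "f k = \<zero>" using k by (auto simp: K_def)
    have sa: "s a \<in> H" "f (s a) = a" using s(2,3) a f(2) by auto
    have x: "k \<oplus>\<^bsub>M\<^esub> s a \<in> H" by (rule Hc(3)[OF kH(1) sa(1)])
    have fx: "f (k \<oplus>\<^bsub>M\<^esub> s a) = a"
      using fD(2)[OF kH(1) sa(1)] kH sa Ac(1) a by auto
    have "(k \<oplus>\<^bsub>M\<^esub> s a) \<ominus>\<^bsub>M\<^esub> s a = k"
      using Hc(7)[OF kH(1)] Hc(7)[OF sa(1)] by (simp add: a_minus_def M.M.a_assoc M.M.r_neg)
    then show ?thesis
      using x fx by (intro bexI[of _ "k \<oplus>\<^bsub>M\<^esub> s a"]) (simp_all add: h_def)
  qed
  have hH: "h ` H = carrier R"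
  proof -
    have "ideal (h ` H) R"
      using submodule_image[OF M module_regular_module H h] by (simp add: submodule_regular_iff)
    moreover obtain k where "k \<in> K" "b0 = g k" using ab(2) g(2) by auto
    then have "\<one> \<in> h ` H" using point[OF ab(1)] ab(3) by (metis imageI)
    ultimately show ?thesis using ideal.one_imp_carrier by blast
  qed
  define K' where "K' = {x \<in> H. h x = \<zero>}"
  have f': "functional_on R M K' f" by (rule linear_on_subset[OF f(1)]) (auto simp: K'_def)
  have h_K: "h x = g x" if "x \<in> K" for x
    using that s(6)[of x] \<alpha>0 gD(1)[of x] by (simp add: h_def K_def)
  have ker: "{x \<in> K'. f x = \<zero>} = {x \<in> K. g x = \<zero>}"
    using h_K unfolding K'_def K_def by auto
  have "f ` K' \<noteq> {\<zero>}"
  proof -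
    obtain a where a: "a \<in> A" "a \<noteq> \<zero>" using f(3) Ac(2) by blast
    obtain b where b: "b \<in> B" "b \<noteq> \<zero>" using g(3) Bc(2) by blast
    have c: "a \<in> carrier R" "b \<in> carrier R" "\<alpha> a \<in> carrier R" using a b Ac(1) Bc(1) \<alpha>D(1) by auto
    \<comment> \<open>the element with components \<open>b a\<close> and \<open>k\<close>, where \<open>g k = - \<alpha>(a) b\<close>, is killed by \<open>h\<close>\<close>
    have "\<ominus> (\<alpha> a) \<otimes> b \<in> B" using Bc(4)[OF _ b(1)] c by simp
    then obtain k where k: "k \<in> K" "g k = \<ominus> (\<alpha> a) \<otimes> b" using g(2) by auto
    obtain x where x: "x \<in> H" "f x = b \<otimes> a" "h x = \<alpha> (b \<otimes> a) \<oplus> g k"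
      using point[OF Ac(4)[OF c(2) a(1)] k(1)] by blast
    have "\<ominus> (\<alpha> a) \<otimes> b = \<ominus> (b \<otimes> \<alpha> a)"
      using l_minus[OF c(3,2)] m_comm[OF c(2,3)] by simp
    then have "h x = \<zero>"
      using x(3) k(2) \<alpha>D(3)[OF c(2) a(1)] c by (simp add: r_neg)
    then have "x \<in> K'" using x by (simp add: K'_def)
    moreover have "f x \<noteq> \<zero>" using x a b c integral[of b a] by auto
    ultimately show ?thesis by auto
  qed
  then have "peels R M K' (f ` K' # Cs)"
    unfolding peels.simps(2) using f' g(4) ker by (intro exI[of _ f] conjI) simp_all
  moreover have "carrier R \<noteq> {\<zero>}"
    using one_not_zero one_closed by blast
  ultimately have "peels R M H (carrier R # f ` K' # Cs)"
    unfolding peels.simps(2)[of R M H "carrier R"] K'_def using h hH by (intro exI[of _ h] conjI)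
  then show ?thesis by (rule exI)
qed

text \<open>Steinitz normal form: repeated use of \<open>peels_first_ideal_to_ring\<close> moves the
whole nontrivial information into the last ideal.\<close>

lemma peels_steinitz:
  assumes M: "Module.module R M"
  shows "submodule H R M \<Longrightarrow> peels R M H (A # As) \<Longrightarrow>
    \<exists>I. ideal I R \<and> I \<noteq> {\<zero>} \<and> peels R M H (replicate (length As) (carrier R) @ [I])"
proof (induction As arbitrary: H A)
  case Nil
  then obtain f where f: "functional_on R M H f" "f ` H = A" "A \<noteq> {\<zero>}"
    unfolding peels.simps(2) by blast
  have "ideal A R"
    using submodule_image[OF M module_regular_module Nil.prems(1) f(1)] f(2)
    by (simp add: submodule_regular_iff)
  moreover have "peels R M H (replicate (length []) (carrier R) @ [A])"
    using Nil.prems(2) by (simp only: list.size replicate_0 append_Nil)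
  ultimately show ?case using f(3) by blast
next
  case (Cons B Cs)
  obtain A' where "peels R M H (carrier R # A' # Cs)"
    using peels_first_ideal_to_ring[OF M Cons.prems] by blast
  then obtain h where h: "functional_on R M H h" "h ` H = carrier R" "carrier R \<noteq> {\<zero>}"
    "peels R M {x \<in> H. h x = \<zero>} (A' # Cs)"
    unfolding peels.simps(2)[of R M H "carrier R"] by blast
  have "submodule {x \<in> H. h x = \<zero>} R M"
    using submodule_kernel[OF M module_regular_module Cons.prems(1) h(1)] by simp
  from Cons.IH[OF this h(4)] obtain I where I: "ideal I R" "I \<noteq> {\<zero>}"
    "peels R M {x \<in> H. h x = \<zero>} (replicate (length Cs) (carrier R) @ [I])" by blast
  then have "peels R M H (carrier R # replicate (length Cs) (carrier R) @ [I])"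
    unfolding peels.simps(2)[of R M H "carrier R"] using h by blast
  with I show ?case by auto
qed

end

section \<open>Submodules of finite index\<close>

lemma finite_image_factor:
  assumes "finite (\<phi> ` D)" "\<And>x y. x \<in> D \<Longrightarrow> y \<in> D \<Longrightarrow> \<phi> x = \<phi> y \<Longrightarrow> \<psi> x = \<psi> y"
  shows "finite (\<psi> ` D)"
proof -
  have "\<psi> ` D \<subseteq> (\<lambda>c. \<psi> (inv_into D \<phi> c)) ` \<phi> ` D"
  proof
    fix y assume "y \<in> \<psi> ` D"
    then obtain x where x: "x \<in> D" "y = \<psi> x" by auto
    have "inv_into D \<phi> (\<phi> x) \<in> D" "\<phi> (inv_into D \<phi> (\<phi> x)) = \<phi> x"
      using x(1) by (auto intro: inv_into_into f_inv_into_f)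
    then have "\<psi> (inv_into D \<phi> (\<phi> x)) = \<psi> x"
      using x(1) assms(2) by blast
    with x show "y \<in> (\<lambda>c. \<psi> (inv_into D \<phi> c)) ` \<phi> ` D"
      by (intro image_eqI[of _ _ "\<phi> x"]) simp_all
  qed
  with assms(1) show ?thesis by (meson finite_imageI finite_subset)
qed

lemma card_image_eq_if_same_fibres:
  assumes "\<And>x y. x \<in> D \<Longrightarrow> y \<in> D \<Longrightarrow> \<phi> x = \<phi> y \<longleftrightarrow> \<psi> x = \<psi> y"
  shows "card (\<phi> ` D) = card (\<psi> ` D)"
proof (rule bij_betw_same_card)
  define g where "g c = \<psi> (inv_into D \<phi> c)" for c
  have g: "g (\<phi> x) = \<psi> x" if "x \<in> D" for x
    using assms[OF inv_into_into[OF imageI[OF that]] that, of \<phi>] f_inv_into_f[OF imageI[OF that], of \<phi>]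
    by (simp add: g_def)
  show "bij_betw g (\<phi> ` D) (\<psi> ` D)"
    unfolding bij_betw_def
  proof
    show "inj_on g (\<phi> ` D)"
    proof (rule inj_onI)
      fix c d assume "c \<in> \<phi> ` D" "d \<in> \<phi> ` D" and e: "g c = g d"
      then obtain x y where "x \<in> D" "y \<in> D" "c = \<phi> x" "d = \<phi> y" by auto
      with e g assms show "c = d" by metis
    qed
    show "g ` \<phi> ` D = \<psi> ` D"
      using g by (simp add: image_image)
  qed
qed

abbreviation coset_map :: "('b, 'e) ring_scheme \<Rightarrow> 'b set \<Rightarrow> 'b \<Rightarrow> 'b set" where
  "coset_map M H \<equiv> (\<lambda>x. H +>\<^bsub>M\<^esub> x)"

abbreviation cofinite_ideals :: "('a, 'r) ring_scheme \<Rightarrow> 'a set set" where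
  "cofinite_ideals R \<equiv> cofinite_submodules R (regular_module R)"

lemma cofinite_submodules_iff:
  "H \<in> cofinite_submodules R M \<longleftrightarrow> submodule H R M \<and> finite (coset_map M H ` carrier M)"
proof -
  have "a_rcosets\<^bsub>M\<^esub> H = coset_map M H ` carrier M"
    by (auto simp: A_RCOSETS_def')
  then show ?thesis
    by (simp add: cofinite_submodules_def quot_module_sel)
qed

context Module.module
begin

lemma minus_zero_right: "x \<in> carrier M \<Longrightarrow> x \<ominus>\<^bsub>M\<^esub> \<zero>\<^bsub>M\<^esub> = x"
  using M.minus_equality[of "\<zero>\<^bsub>M\<^esub>" "\<zero>\<^bsub>M\<^esub>"] by (simp add: a_minus_def)

lemma eq_if_minus_zero:
  assumes "x \<in> carrier M" "y \<in> carrier M" "x \<ominus>\<^bsub>M\<^esub> y = \<zero>\<^bsub>M\<^esub>"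
  shows "x = y"
  using M.minus_equality[of x "\<ominus>\<^bsub>M\<^esub> y"] assms by (simp add: a_minus_def)

lemma coset_eq_iff:
  assumes H: "submodule H R M" and xy: "x \<in> carrier M" "y \<in> carrier M"
  shows "H +>\<^bsub>M\<^esub> x = H +>\<^bsub>M\<^esub> y \<longleftrightarrow> x \<ominus>\<^bsub>M\<^esub> y \<in> H"
proof -
  interpret H: abelian_subgroup H M
    by (rule submodule_abelian_subgroup[OF module_axioms H])
  note Hc = submodule_closure[OF H]
  have mem: "x \<in> H +>\<^bsub>M\<^esub> y \<longleftrightarrow> x \<ominus>\<^bsub>M\<^esub> y \<in> H"
  proof
    assume "x \<in> H +>\<^bsub>M\<^esub> y"
    then obtain h where h: "h \<in> H" "x = h \<oplus>\<^bsub>M\<^esub> y" by (auto simp: a_r_coset_def')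
    then show "x \<ominus>\<^bsub>M\<^esub> y \<in> H"
      using xy(2) Hc(7)[OF h(1)] by (simp add: a_minus_def M.a_assoc M.r_neg)
  next
    assume "x \<ominus>\<^bsub>M\<^esub> y \<in> H"
    moreover have "x = (x \<ominus>\<^bsub>M\<^esub> y) \<oplus>\<^bsub>M\<^esub> y"
      using xy by (simp add: a_minus_def M.a_assoc M.l_neg)
    ultimately show "x \<in> H +>\<^bsub>M\<^esub> y" by (auto simp: a_r_coset_def')
  qed
  have "x \<in> H +>\<^bsub>M\<^esub> y \<longleftrightarrow> H +>\<^bsub>M\<^esub> x = H +>\<^bsub>M\<^esub> y"
    using H.a_rcos_self[OF xy(1)] M.a_repr_independence[OF _ xy(2) H.a_subgroup] by blast
  with mem show ?thesis by simp
qed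

lemma coset_of_zero:
  assumes H: "submodule H R M" and "x \<in> carrier M"
  shows "H +>\<^bsub>M\<^esub> x = H \<longleftrightarrow> x \<in> H"
  using coset_eq_iff[OF H assms(2) M.zero_closed] M.a_coset_add_zero[OF submodule_closure(1)[OF H]]
    minus_zero_right[OF assms(2)]
  by simp

text \<open>A coset of \<open>K\<close> is determined by a representative of the coset of
\<open>H\<close> and the coset of \<open>K\<close> of the difference.\<close>

lemma finite_index_trans:
  assumes K: "submodule K R M" and H: "submodule H R M"
    and fin: "finite (coset_map M H ` carrier M)" "finite (coset_map M K ` H)"
  shows "finite (coset_map M K ` carrier M)"
proof -
  note Hc = submodule_closure[OF H]
  define rep where "rep x = inv_into (carrier M) (coset_map M H) (H +>\<^bsub>M\<^esub> x)" for x
  have rep: "rep x \<in> carrier M" "x \<ominus>\<^bsub>M\<^esub> rep x \<in> H" if x: "x \<in> carrier M" for x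
  proof -
    have m: "H +>\<^bsub>M\<^esub> x \<in> coset_map M H ` carrier M" using x by auto
    show r: "rep x \<in> carrier M" unfolding rep_def by (rule inv_into_into[OF m])
    have "H +>\<^bsub>M\<^esub> rep x = H +>\<^bsub>M\<^esub> x" unfolding rep_def by (rule f_inv_into_f[OF m])
    then show "x \<ominus>\<^bsub>M\<^esub> rep x \<in> H"
      using coset_eq_iff[OF H x r] by simp
  qed
  have "rep ` carrier M \<subseteq> inv_into (carrier M) (coset_map M H) ` coset_map M H ` carrier M"
    by (auto simp: rep_def)
  then have "finite (rep ` carrier M)"
    using fin(1) by (meson finite_imageI finite_subset)
  then have "finite (rep ` carrier M \<times> coset_map M K ` H)"
    using fin(2) by simp
  moreover have "(\<lambda>x. (rep x, K +>\<^bsub>M\<^esub> (x \<ominus>\<^bsub>M\<^esub> rep x))) ` carrier M \<subseteq> rep ` carrier M \<times> coset_map M K ` H"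
    using rep by auto
  ultimately have "finite ((\<lambda>x. (rep x, K +>\<^bsub>M\<^esub> (x \<ominus>\<^bsub>M\<^esub> rep x))) ` carrier M)"
    using finite_subset by blast
  then show ?thesis
  proof (rule finite_image_factor)
    fix x y assume xy: "x \<in> carrier M" "y \<in> carrier M"
      and e: "(rep x, K +>\<^bsub>M\<^esub> (x \<ominus>\<^bsub>M\<^esub> rep x)) = (rep y, K +>\<^bsub>M\<^esub> (y \<ominus>\<^bsub>M\<^esub> rep y))"
    have r: "rep x \<in> carrier M" "rep y = rep x" using e rep xy by auto
    have "(x \<ominus>\<^bsub>M\<^esub> rep x) \<ominus>\<^bsub>M\<^esub> (y \<ominus>\<^bsub>M\<^esub> rep x) \<in> K"
      using coset_eq_iff[OF K, of "x \<ominus>\<^bsub>M\<^esub> rep x" "y \<ominus>\<^bsub>M\<^esub> rep x"] e r xy by simp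
    moreover have "rep x \<oplus>\<^bsub>M\<^esub> (\<ominus>\<^bsub>M\<^esub> y \<oplus>\<^bsub>M\<^esub> \<ominus>\<^bsub>M\<^esub> rep x) = \<ominus>\<^bsub>M\<^esub> y"
      using r xy M.a_comm[of "\<ominus>\<^bsub>M\<^esub> y" "\<ominus>\<^bsub>M\<^esub> rep x"] by (simp add: M.r_neg2)
    then have "(x \<ominus>\<^bsub>M\<^esub> rep x) \<ominus>\<^bsub>M\<^esub> (y \<ominus>\<^bsub>M\<^esub> rep x) = x \<ominus>\<^bsub>M\<^esub> y"
      using r xy by (simp add: a_minus_def M.minus_add M.a_ac)
    ultimately show "K +>\<^bsub>M\<^esub> x = K +>\<^bsub>M\<^esub> y"
      using coset_eq_iff[OF K xy] by simp
  qed
qed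

text \<open>Induction on the generators: the coset of \<open>r x + w\<close> depends only on
\<open>r\<close> modulo the ideal that kills \<open>x\<close> and on the coset of
\<open>w\<close>.\<close>

lemma finite_quotient_of_lincombs:
  assumes K: "submodule K R M"
  shows "set xs \<subseteq> carrier M \<Longrightarrow>
    (\<And>x. x \<in> set xs \<Longrightarrow> \<exists>J\<in>cofinite_ideals R. \<forall>j\<in>J. j \<odot>\<^bsub>M\<^esub> x \<in> K) \<Longrightarrow>
    finite (coset_map M K ` {lincomb M rs xs | rs. set rs \<subseteq> carrier R})"
proof (induction xs)
  case Nil
  have "coset_map M K ` {lincomb M rs [] | rs. set rs \<subseteq> carrier R} \<subseteq> {K +>\<^bsub>M\<^esub> \<zero>\<^bsub>M\<^esub>}" by auto
  then show ?case using finite_subset by blast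
next
  case (Cons x xs)
  interpret S: Module.module R "regular_module R" by (rule R.module_regular_module)
  define Z where "Z = {lincomb M rs xs | rs. set rs \<subseteq> carrier R}"
  have x: "x \<in> carrier M" "set xs \<subseteq> carrier M" using Cons.prems by auto
  have Z: "submodule Z R M" unfolding Z_def by (rule submodule_lincombs[OF x(2)])
  note Zc = submodule_closure[OF Z]
  have finZ: "finite (coset_map M K ` Z)"
    unfolding Z_def using Cons.IH Cons.prems by auto
  obtain J where J: "J \<in> cofinite_ideals R" "\<forall>j\<in>J. j \<odot>\<^bsub>M\<^esub> x \<in> K"
    using Cons.prems(2)[of x] by auto
  then have J': "submodule J R (regular_module R)" "finite (coset_map (regular_module R) J ` carrier R)"
    by (auto simp: cofinite_submodules_iff)
  let ?\<phi> = "\<lambda>(r, w). (J +>\<^bsub>regular_module R\<^esub> r, K +>\<^bsub>M\<^esub> w)"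
  let ?\<psi> = "\<lambda>(r, w). K +>\<^bsub>M\<^esub> (r \<odot>\<^bsub>M\<^esub> x \<oplus>\<^bsub>M\<^esub> w)"
  have "?\<phi> ` (carrier R \<times> Z) \<subseteq> coset_map (regular_module R) J ` carrier R \<times> coset_map M K ` Z"
    by auto
  then have "finite (?\<phi> ` (carrier R \<times> Z))"
    using J'(2) finZ by (meson finite_SigmaI finite_subset)
  then have fin: "finite (?\<psi> ` (carrier R \<times> Z))"
  proof (rule finite_image_factor)
    fix p q assume "p \<in> carrier R \<times> Z" "q \<in> carrier R \<times> Z" "?\<phi> p = ?\<phi> q"
    then obtain r w s v where *: "p = (r, w)" "q = (s, v)" "r \<in> carrier R" "s \<in> carrier R" "w \<in> Z" "v \<in> Z"
      "J +>\<^bsub>regular_module R\<^esub> r = J +>\<^bsub>regular_module R\<^esub> s" "K +>\<^bsub>M\<^esub> w = K +>\<^bsub>M\<^esub> v" by auto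
    have c: "w \<in> carrier M" "v \<in> carrier M" using * Zc(7) by auto
    have "r \<ominus> s \<in> J" using S.coset_eq_iff[OF J'(1), of r s] * by simp
    then have 1: "(r \<ominus> s) \<odot>\<^bsub>M\<^esub> x \<in> K" using J(2) by simp
    have 2: "w \<ominus>\<^bsub>M\<^esub> v \<in> K" using coset_eq_iff[OF K c] * by simp
    have "(r \<ominus> s) \<odot>\<^bsub>M\<^esub> x \<oplus>\<^bsub>M\<^esub> (w \<ominus>\<^bsub>M\<^esub> v) = (r \<odot>\<^bsub>M\<^esub> x \<oplus>\<^bsub>M\<^esub> w) \<ominus>\<^bsub>M\<^esub> (s \<odot>\<^bsub>M\<^esub> x \<oplus>\<^bsub>M\<^esub> v)"
      using c x * by (simp add: a_minus_def smult_l_distr smult_l_minus M.minus_add M.a_ac)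
    then have "(r \<odot>\<^bsub>M\<^esub> x \<oplus>\<^bsub>M\<^esub> w) \<ominus>\<^bsub>M\<^esub> (s \<odot>\<^bsub>M\<^esub> x \<oplus>\<^bsub>M\<^esub> v) \<in> K"
      using submodule_closure(3)[OF K 1 2] by simp
    then show "?\<psi> p = ?\<psi> q"
      using coset_eq_iff[OF K] c x * by simp
  qed
  have "coset_map M K ` {lincomb M rs (x # xs) | rs. set rs \<subseteq> carrier R} \<subseteq> ?\<psi> ` (carrier R \<times> Z)"
  proof
    fix C assume "C \<in> coset_map M K ` {lincomb M rs (x # xs) | rs. set rs \<subseteq> carrier R}"
    then obtain rs where rs: "set rs \<subseteq> carrier R" "C = K +>\<^bsub>M\<^esub> lincomb M rs (x # xs)" by auto
    have "\<exists>r w. r \<in> carrier R \<and> w \<in> Z \<and> lincomb M rs (x # xs) = r \<odot>\<^bsub>M\<^esub> x \<oplus>\<^bsub>M\<^esub> w"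
    proof (cases rs)
      case Nil
      then show ?thesis
        using Zc(2) x by (intro exI[of _ \<zero>] exI[of _ "\<zero>\<^bsub>M\<^esub>"]) auto
    next
      case (Cons r rs')
      then show ?thesis
        using rs by (intro exI[of _ r] exI[of _ "lincomb M rs' xs"]) (auto simp: Z_def)
    qed
    then obtain r w where "r \<in> carrier R" "w \<in> Z" "lincomb M rs (x # xs) = r \<odot>\<^bsub>M\<^esub> x \<oplus>\<^bsub>M\<^esub> w"
      by blast
    then show "C \<in> ?\<psi> ` (carrier R \<times> Z)"
      using rs(2) by (intro image_eqI[of _ _ "(r, w)"]) simp_all
  qed
  then show ?case using fin finite_subset by blast
qed

text \<open>The element \<open>r\<close> modulo this ideal is determined by the finitely many cosets of
the products \<open>r x\<close>, each taken from a finite set.\<close>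

lemma cofinite_colon:
  assumes H: "H \<in> cofinite_submodules R M" and xs: "set xs \<subseteq> carrier M"
  shows "{r \<in> carrier R. \<forall>x\<in>set xs. r \<odot>\<^bsub>M\<^esub> x \<in> H} \<in> cofinite_ideals R"
proof -
  interpret S: Module.module R "regular_module R" by (rule R.module_regular_module)
  have H': "submodule H R M" "finite (coset_map M H ` carrier M)"
    using H by (auto simp: cofinite_submodules_iff)
  note Hc = submodule_closure[OF H'(1)]
  define J where "J = {r \<in> carrier R. \<forall>x\<in>set xs. r \<odot>\<^bsub>M\<^esub> x \<in> H}"
  have J: "submodule J R (regular_module R)"
    using Hc xs by (intro S.submodule_by_closure)
      (auto simp: J_def smult_l_distr smult_assoc1 subset_iff)
  let ?\<phi> = "\<lambda>r. map (\<lambda>x. H +>\<^bsub>M\<^esub> (r \<odot>\<^bsub>M\<^esub> x)) xs"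
  have "?\<phi> ` carrier R \<subseteq> {ys. set ys \<subseteq> coset_map M H ` carrier M \<and> length ys = length xs}"
    using xs by (auto intro!: imageI simp: subset_iff)
  then have "finite (?\<phi> ` carrier R)"
    using finite_lists_length_eq[OF H'(2)] finite_subset by blast
  then have "finite (coset_map (regular_module R) J ` carrier R)"
  proof (rule finite_image_factor)
    fix r s assume rs: "r \<in> carrier R" "s \<in> carrier R" "?\<phi> r = ?\<phi> s"
    have "(r \<ominus> s) \<odot>\<^bsub>M\<^esub> x \<in> H" if x: "x \<in> set xs" for x
    proof -
      have xM: "x \<in> carrier M" using x xs by auto
      have "H +>\<^bsub>M\<^esub> (r \<odot>\<^bsub>M\<^esub> x) = H +>\<^bsub>M\<^esub> (s \<odot>\<^bsub>M\<^esub> x)" using rs(3) x by simp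
      then have "r \<odot>\<^bsub>M\<^esub> x \<ominus>\<^bsub>M\<^esub> s \<odot>\<^bsub>M\<^esub> x \<in> H"
        using coset_eq_iff[OF H'(1)] rs xM by simp
      then show ?thesis
        using rs xM by (simp add: a_minus_def smult_l_distr smult_l_minus)
    qed
    then have "r \<ominus> s \<in> J" using rs by (simp add: J_def)
    then show "J +>\<^bsub>regular_module R\<^esub> r = J +>\<^bsub>regular_module R\<^esub> s"
      using S.coset_eq_iff[OF J, of r s] rs by simp
  qed
  then show ?thesis
    using J by (simp add: cofinite_submodules_iff J_def)
qed

lemma lincomb_smult_mem:
  assumes H: "submodule H R M" and r: "r \<in> carrier R"
  shows "set xs \<subseteq> carrier M \<Longrightarrow> set rs \<subseteq> carrier R \<Longrightarrow> (\<And>x. x \<in> set xs \<Longrightarrow> r \<odot>\<^bsub>M\<^esub> x \<in> H) \<Longrightarrow>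
    r \<odot>\<^bsub>M\<^esub> lincomb M rs xs \<in> H"
proof (induction rs xs rule: list_induct2')
  case (4 s rs x xs)
  have "r \<odot>\<^bsub>M\<^esub> lincomb M (s # rs) (x # xs) = s \<odot>\<^bsub>M\<^esub> (r \<odot>\<^bsub>M\<^esub> x) \<oplus>\<^bsub>M\<^esub> r \<odot>\<^bsub>M\<^esub> lincomb M rs xs"
    using 4 r by (simp add: smult_r_distr smult_left_commute)
  then show ?case
    using 4 submodule_closure(3,4)[OF H] by simp
qed (use submodule_closure(2)[OF H] r in simp_all)

end

lemma (in noetherian_ring) ideal_generated_by_list:
  assumes "cring R" "ideal I R"
  shows "\<exists>xs. set xs \<subseteq> I \<and> I = {lincomb (regular_module R) rs xs | rs. set rs \<subseteq> carrier R}"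
proof -
  interpret cring R by fact
  interpret S: Module.module R "regular_module R" by (rule module_regular_module)
  obtain A where A: "A \<subseteq> carrier R" "finite A" "I = Idl A"
    using finetely_gen[OF assms(2)] by blast
  obtain xs where xs: "set xs = A"
    using A(2) finite_list by blast
  let ?L = "{lincomb (regular_module R) rs xs | rs. set rs \<subseteq> carrier R}"
  have AI: "A \<subseteq> I" using genideal_self[OF A(1)] A(3) by simp
  have "submodule ?L R (regular_module R)"
    using A xs by (intro S.submodule_lincombs) auto
  moreover have "A \<subseteq> ?L"
    using S.lincomb_unit[of _ xs] A xs by auto
  ultimately have 1: "I \<subseteq> ?L"
    using A genideal_minimal by (simp add: submodule_regular_iff)
  have "lincomb (regular_module R) rs ys \<in> I" if "set rs \<subseteq> carrier R" "set ys \<subseteq> I" for rs ys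
    using that
    by (induction rs ys rule: list_induct2') (simp_all add: ideal_closure[OF assms(2)])
  then have "?L \<subseteq> I" using AI xs by auto
  with 1 AI xs show ?thesis by (intro exI[of _ xs]) auto
qed

section \<open>Torsion in residually finite modules\<close>

context dedekind_domain
begin

text \<open>The hypothesis says that \<open>R / C\<close> is residually finite. Noetherian induction:
if \<open>C\<close> is prime, it is maximal, so an ideal of finite index over \<open>C\<close> without
\<open>\<one>\<close> is \<open>C\<close>. Otherwise take \<open>a \<otimes> b \<in> C\<close> with
\<open>a\<close> and \<open>b\<close> outside \<open>C\<close> and put \<open>J = (C : a)\<close>.
The colon ideals \<open>(C : y)\<close> inherit the hypothesis, because \<open>R / (C : y)\<close>
embeds into \<open>R / C\<close>. By induction \<open>R / J\<close> is finite, and so is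
\<open>J / C\<close>, since each generator \<open>y\<close> of \<open>J\<close> is killed modulo
\<open>C\<close> by the strictly larger ideal \<open>(C : y)\<close>, which contains
\<open>a\<close>.\<close>

lemma cofinite_ideal_if_intersection:
  assumes "ideal C R" "C \<noteq> {\<zero>}"
    "\<And>r. r \<in> carrier R \<Longrightarrow> r \<notin> C \<Longrightarrow> \<exists>J\<in>cofinite_ideals R. C \<subseteq> J \<and> r \<notin> J"
  shows "C \<in> cofinite_ideals R"
  using assms
proof (induction rule: noetherian_induct)
  case (step C)
  interpret S: Module.module R "regular_module R" by (rule module_regular_module)
  note Cc = ideal_closure[OF step(1)]
  have C: "submodule C R (regular_module R)" using step(1) by (simp add: submodule_regular_iff)
  have colon: "{r \<in> carrier R. r \<otimes> y \<in> C} \<in> cofinite_ideals R"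
    if y: "y \<in> carrier R" and a: "a \<in> carrier R" "a \<notin> C" "a \<otimes> y \<in> C" for y a
  proof (rule step(2))
    show id: "ideal {r \<in> carrier R. r \<otimes> y \<in> C} R"
      using Cc y by (intro ideal_by_closure) (simp_all add: subset_iff l_distr m_assoc)
    show "C \<subset> {r \<in> carrier R. r \<otimes> y \<in> C}"
      using Cc(1) Cc(5)[OF y] a by auto
    then show "{r \<in> carrier R. r \<otimes> y \<in> C} \<noteq> {\<zero>}"
      using step.prems(1) Cc(2) by auto
    fix r assume r: "r \<in> carrier R" "r \<notin> {r \<in> carrier R. r \<otimes> y \<in> C}"
    then obtain J where J: "J \<in> cofinite_ideals R" "C \<subseteq> J" "r \<otimes> y \<notin> J"
      using step.prems(2)[of "r \<otimes> y"] y by auto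
    have "{r \<in> carrier R. \<forall>x\<in>set [y]. r \<odot>\<^bsub>regular_module R\<^esub> x \<in> J} \<in> cofinite_ideals R"
      using y by (intro S.cofinite_colon J) simp
    then show "\<exists>J\<in>cofinite_ideals R. {r \<in> carrier R. r \<otimes> y \<in> C} \<subseteq> J \<and> r \<notin> J"
      using J r by (intro bexI[of _ "{r \<in> carrier R. r \<otimes> y \<in> J}"]) auto
  qed
  consider "C = carrier R" | "C \<noteq> carrier R" "primeideal C R" | "C \<noteq> carrier R" "\<not> primeideal C R" by blast
  then show ?case
  proof cases
    case 1
    have "coset_map (regular_module R) C ` carrier R \<subseteq> {C}"
      using S.coset_of_zero[OF C] 1 by auto
    then show ?thesis
      using C finite_subset by (auto simp: cofinite_submodules_iff)
  next
    case 2
    have "maximalideal C R" by (rule nonzero_prime_is_maximal[OF 2(2) step.prems(1)])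
    note Cm = maximalideal_props[OF this]
    obtain J where J: "J \<in> cofinite_ideals R" "C \<subseteq> J" "\<one> \<notin> J"
      using step.prems(2)[OF one_closed Cm(4)] by blast
    have "ideal J R" using J(1) by (simp add: cofinite_submodules_iff submodule_regular_iff)
    then have "J = C" using Cm(6)[OF _ J(2)] J(3) by auto
    with J show ?thesis by simp
  next
    case 3
    then obtain a b where ab: "a \<in> carrier R" "b \<in> carrier R" "a \<otimes> b \<in> C" "a \<notin> C" "b \<notin> C"
      using ideal.primeidealCD[OF step(1) is_cring] by auto
    define J where "J = {r \<in> carrier R. r \<otimes> a \<in> C}"
    have J: "J \<in> cofinite_ideals R"
      unfolding J_def using ab by (intro colon[of a b]) (simp_all add: m_comm)
    then have J': "submodule J R (regular_module R)" "finite (coset_map (regular_module R) J ` carrier R)"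
      by (simp_all add: cofinite_submodules_iff)
    then obtain ys where ys: "set ys \<subseteq> J" "J = {lincomb (regular_module R) rs ys | rs. set rs \<subseteq> carrier R}"
      using ideal_generated_by_list[OF is_cring, of J] by (auto simp: submodule_regular_iff)
    have "finite (coset_map (regular_module R) C ` {lincomb (regular_module R) rs ys | rs. set rs \<subseteq> carrier R})"
    proof (rule S.finite_quotient_of_lincombs[OF C])
      show "set ys \<subseteq> carrier (regular_module R)" using ys(1) by (auto simp: J_def)
      fix y assume "y \<in> set ys"
      then have y: "y \<in> carrier R" "y \<otimes> a \<in> C" using ys(1) by (auto simp: J_def)
      have "{r \<in> carrier R. r \<otimes> y \<in> C} \<in> cofinite_ideals R"
        using ab y by (intro colon[of y a]) (simp_all add: m_comm)
      then show "\<exists>J\<in>cofinite_ideals R. \<forall>j\<in>J. j \<odot>\<^bsub>regular_module R\<^esub> y \<in> C"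
        by (intro bexI[of _ "{r \<in> carrier R. r \<otimes> y \<in> C}"]) simp_all
    qed
    then have "finite (coset_map (regular_module R) C ` J)"
      using ys(2) by simp
    from S.finite_index_trans[OF C J'(1) _ this] show ?thesis
      using J'(2) C by (simp add: cofinite_submodules_iff)
  qed
qed

lemma cofinite_submodule_separating:
  assumes M: "Module.module R M" and rf: "residually_finite R M" and x: "x \<in> carrier M" "x \<noteq> \<zero>\<^bsub>M\<^esub>"
  shows "\<exists>H\<in>cofinite_submodules R M. x \<notin> H"
proof -
  interpret M: Module.module R M by fact
  have "completion_map R M x \<noteq> completion_map R M \<zero>\<^bsub>M\<^esub>"
    using rf x by (auto simp: residually_finite_def inj_on_def)
  then obtain H where H: "H \<in> cofinite_submodules R M" "H +>\<^bsub>M\<^esub> x \<noteq> H +>\<^bsub>M\<^esub> \<zero>\<^bsub>M\<^esub>"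
    by (auto simp: completion_map_def restrict_def fun_eq_iff split: if_splits)
  have "submodule H R M" using H by (simp add: cofinite_submodules_iff)
  then have "x \<notin> H"
    using H(2) M.coset_eq_iff[OF _ x(1) M.M.zero_closed] M.minus_zero_right[OF x(1)] by simp
  with H(1) show ?thesis by blast
qed

text \<open>The annihilator is the intersection of the colon ideals \<open>(H : x)\<close> over the
submodules \<open>H\<close> of finite index, because these intersect in zero.\<close>

lemma annihilator_of_torsion_cofinite:
  assumes M: "Module.module R M" and rf: "residually_finite R M" and x: "x \<in> torsion_elements R M"
  shows "{r \<in> carrier R. r \<odot>\<^bsub>M\<^esub> x = \<zero>\<^bsub>M\<^esub>} \<in> cofinite_ideals R"
proof (rule cofinite_ideal_if_intersection)
  interpret M: Module.module R M by fact
  obtain r0 where x: "x \<in> carrier M" "r0 \<in> carrier R" "r0 \<noteq> \<zero>" "r0 \<odot>\<^bsub>M\<^esub> x = \<zero>\<^bsub>M\<^esub>"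
    using x by (auto simp: torsion_elements_def)
  show "ideal {r \<in> carrier R. r \<odot>\<^bsub>M\<^esub> x = \<zero>\<^bsub>M\<^esub>} R"
    using x(1) by (intro ideal_by_closure) (auto simp: M.smult_l_distr M.smult_assoc1)
  show "{r \<in> carrier R. r \<odot>\<^bsub>M\<^esub> x = \<zero>\<^bsub>M\<^esub>} \<noteq> {\<zero>}" using x by auto
  fix r assume r: "r \<in> carrier R" "r \<notin> {r \<in> carrier R. r \<odot>\<^bsub>M\<^esub> x = \<zero>\<^bsub>M\<^esub>}"
  have rx: "r \<odot>\<^bsub>M\<^esub> x \<in> carrier M" "r \<odot>\<^bsub>M\<^esub> x \<noteq> \<zero>\<^bsub>M\<^esub>" using r x by auto
  then obtain H where H: "H \<in> cofinite_submodules R M" "r \<odot>\<^bsub>M\<^esub> x \<notin> H"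
    using cofinite_submodule_separating[OF M rf rx] by blast
  have Hs: "submodule H R M" using H by (simp add: cofinite_submodules_iff)
  have "{r \<in> carrier R. \<forall>x\<in>set [x]. r \<odot>\<^bsub>M\<^esub> x \<in> H} \<in> cofinite_ideals R"
    using x by (intro M.cofinite_colon H(1)) simp
  then show "\<exists>J\<in>cofinite_ideals R. {r \<in> carrier R. r \<odot>\<^bsub>M\<^esub> x = \<zero>\<^bsub>M\<^esub>} \<subseteq> J \<and> r \<notin> J"
    using M.submodule_closure(2)[OF Hs] H(2)
    by (intro bexI[of _ "{r \<in> carrier R. r \<odot>\<^bsub>M\<^esub> x \<in> H}"]) auto
qed

lemma linear_on_lincomb:
  assumes M: "Module.module R M" and N: "Module.module R N" and f: "linear_on R M N (carrier M) f"
  shows "set rs \<subseteq> carrier R \<Longrightarrow> set xs \<subseteq> carrier M \<Longrightarrow> f (lincomb M rs xs) = lincomb N rs (map f xs)"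
proof (induction rs xs rule: list_induct2')
  case (4 r rs x xs)
  interpret M: Module.module R M by fact
  show ?case using 4 linear_onD[OF f] by simp
qed (use linear_on_arith(1)[OF M N module.carrier_is_submodule[OF M] f] in simp_all)

text \<open>The torsion submodule is a quotient of the module by
\<open>peels_torsion_retraction\<close>, hence finitely generated, and each of its elements has an
annihilator of finite index.\<close>

lemma finite_torsion:
  assumes M: "finitely_generated_module R M" and rf: "residually_finite R M"
  shows "finite (torsion_elements R M)"
proof -
  have mod: "Module.module R M" using M by (simp add: finitely_generated_module_def)
  interpret M: Module.module R M by fact
  note T = submodule_torsion_elements[OF mod]
  obtain As where "peels R M (carrier M) As" using exists_peels[OF M] ..
  then obtain \<rho> where \<rho>: "linear_on R M M (carrier M) \<rho>"
    "\<rho> ` carrier M \<subseteq> carrier M \<inter> torsion_elements R M"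
    "\<forall>x\<in>carrier M \<inter> torsion_elements R M. \<rho> x = x"
    using peels_torsion_retraction[OF mod M.carrier_is_submodule] by blast
  obtain xs where xs: "set xs \<subseteq> carrier M" "carrier M = {lincomb M rs xs | rs. set rs \<subseteq> carrier R}"
    using M.finitely_generated_carrier_lincombs[OF M] by blast
  have zero: "submodule {\<zero>\<^bsub>M\<^esub>} R M" by (rule M.submodule_by_closure) auto
  have fin: "finite (coset_map M {\<zero>\<^bsub>M\<^esub>} ` {lincomb M rs (map \<rho> xs) | rs. set rs \<subseteq> carrier R})"
  proof (rule M.finite_quotient_of_lincombs[OF zero])
    show "set (map \<rho> xs) \<subseteq> carrier M"
      using linear_onD(1)[OF \<rho>(1)] xs(1) by auto
    fix y assume "y \<in> set (map \<rho> xs)"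
    then obtain x where "x \<in> carrier M" "y = \<rho> x" using xs(1) by auto
    then have "y \<in> torsion_elements R M" using \<rho>(2) by blast
    from annihilator_of_torsion_cofinite[OF mod rf this]
    show "\<exists>J\<in>cofinite_ideals R. \<forall>j\<in>J. j \<odot>\<^bsub>M\<^esub> y \<in> {\<zero>\<^bsub>M\<^esub>}"
      by (intro bexI[of _ "{r \<in> carrier R. r \<odot>\<^bsub>M\<^esub> y = \<zero>\<^bsub>M\<^esub>}"]) simp_all
  qed
  have "torsion_elements R M \<subseteq> {lincomb M rs (map \<rho> xs) | rs. set rs \<subseteq> carrier R}"
  proof
    fix t assume t: "t \<in> torsion_elements R M"
    then have tM: "t \<in> carrier M" by (simp add: torsion_elements_def)
    then obtain rs where rs: "set rs \<subseteq> carrier R" "t = lincomb M rs xs"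
      using xs(2) by blast
    have "t = \<rho> t" using \<rho>(3) t tM by simp
    also have "\<dots> = lincomb M rs (map \<rho> xs)"
      unfolding rs(2) by (rule linear_on_lincomb[OF mod mod \<rho>(1) rs(1) xs(1)])
    finally show "t \<in> {lincomb M rs (map \<rho> xs) | rs. set rs \<subseteq> carrier R}" using rs by blast
  qed
  from finite_subset[OF image_mono[OF this] fin]
  have "finite (coset_map M {\<zero>\<^bsub>M\<^esub>} ` torsion_elements R M)" .
  moreover have "inj_on (coset_map M {\<zero>\<^bsub>M\<^esub>}) (torsion_elements R M)"
  proof (rule inj_onI)
    fix x y assume "x \<in> torsion_elements R M" "y \<in> torsion_elements R M"
      and e: "{\<zero>\<^bsub>M\<^esub>} +>\<^bsub>M\<^esub> x = {\<zero>\<^bsub>M\<^esub>} +>\<^bsub>M\<^esub> y"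
    then have xy: "x \<in> carrier M" "y \<in> carrier M" by (auto simp: torsion_elements_def)
    have "x \<ominus>\<^bsub>M\<^esub> y \<in> {\<zero>\<^bsub>M\<^esub>}" by (rule iffD1[OF M.coset_eq_iff[OF zero xy] e])
    then show "x = y" by (intro M.eq_if_minus_zero[OF xy]) (rule singletonD)
  qed
  ultimately show ?thesis by (rule finite_imageD)
qed

end

section \<open>Counting reductions modulo an ideal\<close>

text \<open>The submodule \<open>J H\<close>, built like the product of ideals.\<close>

inductive_set ideal_smult ::
  "('a, 'm, 'e) module_scheme \<Rightarrow> 'a set \<Rightarrow> 'm set \<Rightarrow> 'm set"
  for M and J and H where
    smult: "\<lbrakk> j \<in> J; x \<in> H \<rbrakk> \<Longrightarrow> j \<odot>\<^bsub>M\<^esub> x \<in> ideal_smult M J H"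
  | add: "\<lbrakk> x \<in> ideal_smult M J H; y \<in> ideal_smult M J H \<rbrakk> \<Longrightarrow> x \<oplus>\<^bsub>M\<^esub> y \<in> ideal_smult M J H"

lemma (in Module.module) submodule_ideal_smult:
  assumes J: "ideal J R" and H: "submodule H R M"
  shows "submodule (ideal_smult M J H) R M"
    and "ideal_smult M J H \<subseteq> H"
proof -
  note Jc = R.ideal_closure[OF J] and Hc = submodule_closure[OF H]
  show sub: "ideal_smult M J H \<subseteq> H"
  proof
    fix x assume "x \<in> ideal_smult M J H"
    then show "x \<in> H"
    proof induction
      case (smult j x)
      then show ?case using Hc(4) Jc(1) by auto
    qed (rule Hc(3))
  qed
  show "submodule (ideal_smult M J H) R M"
  proof (rule submodule_by_closure)
    show "ideal_smult M J H \<subseteq> carrier M" using sub Hc(1) by auto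
    have "\<zero> \<odot>\<^bsub>M\<^esub> \<zero>\<^bsub>M\<^esub> \<in> ideal_smult M J H"
      by (rule ideal_smult.smult[OF Jc(2) Hc(2)])
    then show "\<zero>\<^bsub>M\<^esub> \<in> ideal_smult M J H" by simp
    show "x \<oplus>\<^bsub>M\<^esub> y \<in> ideal_smult M J H" if "x \<in> ideal_smult M J H" "y \<in> ideal_smult M J H" for x y
      using that by (rule ideal_smult.add)
    show "r \<odot>\<^bsub>M\<^esub> x \<in> ideal_smult M J H" if r: "r \<in> carrier R" and "x \<in> ideal_smult M J H" for r x
      using that(2)
    proof induction
      case (smult j x)
      have "r \<odot>\<^bsub>M\<^esub> (j \<odot>\<^bsub>M\<^esub> x) = (r \<otimes> j) \<odot>\<^bsub>M\<^esub> x"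
        using r smult Jc(1) Hc(7) by (simp add: smult_assoc1 subset_iff)
      then show ?case
        using ideal_smult.smult[OF Jc(4)[OF r smult(1)] smult(2)] by simp
    next
      case (add x y)
      have "x \<in> carrier M" "y \<in> carrier M" using add sub Hc(1) by auto
      then show ?case
        using ideal_smult.add[OF add.IH] r by (simp add: smult_r_distr)
    qed
  qed
qed

lemma linear_on_ideal_smult:
  assumes J: "J \<subseteq> carrier R" and f: "linear_on R M N H f" and HK: "\<And>x. x \<in> H \<Longrightarrow> f x \<in> K"
    and sub: "ideal_smult M J H \<subseteq> H" and x: "x \<in> ideal_smult M J H"
  shows "f x \<in> ideal_smult N J K"
  using x
proof induction
  case (smult j x)
  then show ?case
    using linear_onD(3)[OF f, of j x] J HK ideal_smult.smult[of j J "f x" K N] by auto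
next
  case (add x y)
  have "x \<in> H" "y \<in> H" using add.hyps sub by auto
  then show ?case
    using linear_onD(2)[OF f, of x y] ideal_smult.add[OF add.IH] by simp
qed

lemma linear_on_inverse:
  assumes M: "Module.module R M" and H: "submodule H R M"
    and f: "linear_on R M N H f" and bij: "bij_betw f H K"
  shows "linear_on R N M K (inv_into H f)"
proof -
  interpret M: Module.module R M by fact
  note Hc = M.submodule_closure[OF H]
  have i: "inv_into H f y \<in> H" "f (inv_into H f y) = y" if "y \<in> K" for y
    using bij that by (auto simp: bij_betw_def inv_into_into f_inv_into_f)
  have inv: "inv_into H f (f x) = x" if "x \<in> H" for x
    using bij that by (auto simp: bij_betw_def)
  show ?thesis
  proof (rule linear_onI)
    show "inv_into H f y \<in> carrier M" if "y \<in> K" for y using i(1)[OF that] Hc(1) by auto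
    show "inv_into H f (x \<oplus>\<^bsub>N\<^esub> y) = inv_into H f x \<oplus>\<^bsub>M\<^esub> inv_into H f y" if "x \<in> K" "y \<in> K" for x y
      using inv[OF Hc(3)[OF i(1)[OF that(1)] i(1)[OF that(2)]]] i that
        linear_onD(2)[OF f i(1)[OF that(1)] i(1)[OF that(2)]] by simp
    show "inv_into H f (r \<odot>\<^bsub>N\<^esub> y) = r \<odot>\<^bsub>M\<^esub> inv_into H f y" if "r \<in> carrier R" "y \<in> K" for r y
      using inv[OF Hc(4)[OF that(1) i(1)[OF that(2)]]] i that
        linear_onD(3)[OF f that(1) i(1)[OF that(2)]] by simp
  qed
qed

text \<open>The set of cosets that makes up \<open>H / J H\<close>; only its cardinality
matters.\<close>

definition reduction :: "('a, 'm, 'e) module_scheme \<Rightarrow> 'a set \<Rightarrow> 'm set \<Rightarrow> 'm set set" where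
  "reduction M J H = coset_map M (ideal_smult M J H) ` H"

lemma card_reduction_iso:
  assumes M: "Module.module R M" and N: "Module.module R N"
    and H: "submodule H R M" and K: "submodule K R N" and J: "ideal J R"
    and f: "linear_on R M N H f" and bij: "bij_betw f H K"
  shows "card (reduction M J H) = card (reduction N J K)"
proof -
  interpret M: Module.module R M by fact
  interpret N: Module.module R N by fact
  note Hc = M.submodule_closure[OF H] and Kc = N.submodule_closure[OF K]
  note JH = M.submodule_ideal_smult[OF J H] and JK = N.submodule_ideal_smult[OF J K]
  have JR: "J \<subseteq> carrier R" using M.R.ideal_closure(1)[OF J] .
  define g where "g = inv_into H f"
  have g: "linear_on R N M K g" unfolding g_def by (rule linear_on_inverse[OF M H f bij])
  have fK: "f x \<in> K" if "x \<in> H" for x using bij that by (auto simp: bij_betw_def)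
  have gH: "g x \<in> H" if "x \<in> K" for x using bij that by (auto simp: g_def bij_betw_def inv_into_into)
  have gf: "g (f x) = x" if "x \<in> H" for x using bij that by (auto simp: g_def bij_betw_def)
  have mem: "f z \<in> ideal_smult N J K \<longleftrightarrow> z \<in> ideal_smult M J H" if z: "z \<in> H" for z
    using linear_on_ideal_smult[OF JR f fK JH(2), of z] linear_on_ideal_smult[OF JR g gH JK(2), of "f z"] gf[OF z]
    by auto
  have "card (coset_map M (ideal_smult M J H) ` H) = card ((\<lambda>x. coset_map N (ideal_smult N J K) (f x)) ` H)"
  proof (rule card_image_eq_if_same_fibres)
    fix x y assume xy: "x \<in> H" "y \<in> H"
    have "f (x \<ominus>\<^bsub>M\<^esub> y) = f x \<ominus>\<^bsub>N\<^esub> f y" by (rule linear_on_arith(3)[OF M N H f xy])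
    then show "ideal_smult M J H +>\<^bsub>M\<^esub> x = ideal_smult M J H +>\<^bsub>M\<^esub> y \<longleftrightarrow>
        ideal_smult N J K +>\<^bsub>N\<^esub> f x = ideal_smult N J K +>\<^bsub>N\<^esub> f y"
      using M.coset_eq_iff[OF JH(1) Hc(7)[OF xy(1)] Hc(7)[OF xy(2)]]
        N.coset_eq_iff[OF JK(1) Kc(7)[OF fK[OF xy(1)]] Kc(7)[OF fK[OF xy(2)]]]
        mem[OF Hc(6)[OF xy]] by simp
  qed
  also have "(\<lambda>x. coset_map N (ideal_smult N J K) (f x)) ` H = coset_map N (ideal_smult N J K) ` f ` H"
    by (simp add: image_image)
  also have "f ` H = K" using bij by (simp add: bij_betw_def)
  finally show ?thesis by (simp add: reduction_def)
qed

context dedekind_domain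
begin

text \<open>A functional \<open>\<alpha>\<close> on \<open>A\<close> with
\<open>\<alpha>(A) + J = R\<close> induces a surjection onto \<open>R / J\<close>. Its kernel is
\<open>J A\<close>: from \<open>\<alpha>(a0) + c = \<one>\<close> one gets
\<open>z = \<alpha>(z) a0 + c z\<close> for every \<open>z \<in> A\<close>.\<close>

lemma card_reduction_ideal:
  assumes A: "ideal A R" "A \<noteq> {\<zero>}" and J: "ideal J R" "J \<noteq> {\<zero>}"
  shows "card (reduction (regular_module R) J A) = card (coset_map (regular_module R) J ` carrier R)"
proof -
  interpret S: Module.module R "regular_module R" by (rule module_regular_module)
  let ?S = "regular_module R"
  note Ac = ideal_closure[OF A(1)] and Jc = ideal_closure[OF J(1)]
  have As: "submodule A R ?S" and Js: "submodule J R ?S"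
    using A J by (simp_all add: submodule_regular_iff)
  note JA = S.submodule_ideal_smult[OF J(1) As]
  note JAc = S.submodule_closure[OF JA(1), simplified]
  obtain \<alpha> a0 c where \<alpha>: "functional_on R ?S A \<alpha>" and a0: "a0 \<in> A" and c: "c \<in> J" and one: "\<alpha> a0 \<oplus> c = \<one>"
    using functional_with_coprime_image[OF A J] by blast
  note \<alpha>D = linear_onD[OF \<alpha>, simplified]
  have cR: "c \<in> carrier R" "a0 \<in> carrier R" "\<alpha> a0 \<in> carrier R" using c a0 Jc(1) Ac(1) \<alpha>D(1) by auto
  have mem: "\<alpha> z \<in> J \<longleftrightarrow> z \<in> ideal_smult ?S J A" if z: "z \<in> A" for z
  proof
    assume "z \<in> ideal_smult ?S J A"
    then show "\<alpha> z \<in> J"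
    proof induction
      case (smult j x)
      then show ?case using \<alpha>D(3)[of j x] \<alpha>D(1)[of x] Jc(1) Jc(5)[of "\<alpha> x" j] by auto
    next
      case (add x y)
      have "x \<in> A" "y \<in> A" using add.hyps JA(2) by auto
      then show ?case using \<alpha>D(2)[of x y] Jc(3)[OF add.IH] by simp
    qed
  next
    assume \<alpha>z: "\<alpha> z \<in> J"
    have zR: "z \<in> carrier R" using z Ac(1) by auto
    have "\<alpha> (z \<otimes> a0) = z \<otimes> \<alpha> a0" "\<alpha> (a0 \<otimes> z) = a0 \<otimes> \<alpha> z"
      using \<alpha>D(3) zR cR a0 z by auto
    then have "z \<otimes> \<alpha> a0 = \<alpha> z \<otimes> a0"
      using zR cR \<alpha>D(1)[OF z] m_comm[of z a0] m_comm[of a0 "\<alpha> z"] by simp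
    then have "z = \<alpha> z \<otimes> a0 \<oplus> c \<otimes> z"
      using r_distr[of "\<alpha> a0" c z] one zR cR m_comm[of z c] by simp
    moreover have "\<alpha> z \<otimes> a0 \<in> ideal_smult ?S J A" "c \<otimes> z \<in> ideal_smult ?S J A"
      using ideal_smult.smult[OF \<alpha>z a0, of ?S] ideal_smult.smult[OF c z, of ?S] by simp_all
    ultimately show "z \<in> ideal_smult ?S J A"
      using JAc(3) by metis
  qed
  have "card (coset_map ?S (ideal_smult ?S J A) ` A) = card ((\<lambda>a. coset_map ?S J (\<alpha> a)) ` A)"
  proof (rule card_image_eq_if_same_fibres)
    fix x y assume xy: "x \<in> A" "y \<in> A"
    have "\<alpha> (x \<ominus> y) = \<alpha> x \<ominus> \<alpha> y"
      using linear_on_arith(3)[OF module_regular_module module_regular_module As \<alpha> xy] by simp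
    then show "ideal_smult ?S J A +>\<^bsub>?S\<^esub> x = ideal_smult ?S J A +>\<^bsub>?S\<^esub> y \<longleftrightarrow>
        J +>\<^bsub>?S\<^esub> \<alpha> x = J +>\<^bsub>?S\<^esub> \<alpha> y"
      using S.coset_eq_iff[OF JA(1), of x y] S.coset_eq_iff[OF Js, of "\<alpha> x" "\<alpha> y"] xy Ac(1) \<alpha>D(1)
        mem[OF Ac(7)[OF xy]] by auto
  qed
  also have "(\<lambda>a. coset_map ?S J (\<alpha> a)) ` A = coset_map ?S J ` carrier R"
  proof
    show "(\<lambda>a. coset_map ?S J (\<alpha> a)) ` A \<subseteq> coset_map ?S J ` carrier R"
      using \<alpha>D(1) by auto
    show "coset_map ?S J ` carrier R \<subseteq> (\<lambda>a. coset_map ?S J (\<alpha> a)) ` A"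
    proof
      fix C assume "C \<in> coset_map ?S J ` carrier R"
      then obtain r where r: "r \<in> carrier R" "C = J +>\<^bsub>?S\<^esub> r" by auto
      have ra: "r \<otimes> a0 \<in> A" by (rule Ac(4)[OF r(1) a0])
      have r_eq: "r = \<alpha> (r \<otimes> a0) \<oplus> r \<otimes> c"
        using \<alpha>D(3)[OF r(1) a0] r_distr[OF cR(3,1) r(1)] one r(1) by simp
      have shift: "(u \<oplus> v) \<ominus> u = v" if "u \<in> carrier R" "v \<in> carrier R" for u v
        using that a_comm[of v "\<ominus> u"] by (simp add: a_minus_def a_assoc r_neg2)
      have "r \<ominus> \<alpha> (r \<otimes> a0) = r \<otimes> c"
        using shift[OF \<alpha>D(1)[OF ra] m_closed[OF r(1) cR(1)]] unfolding r_eq[symmetric] .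
      then have "r \<ominus> \<alpha> (r \<otimes> a0) \<in> J" using Jc(4)[OF r(1) c] by simp
      then have "C = J +>\<^bsub>?S\<^esub> \<alpha> (r \<otimes> a0)"
        using S.coset_eq_iff[OF Js, of r "\<alpha> (r \<otimes> a0)"] r \<alpha>D(1)[OF ra] by simp
      with ra show "C \<in> (\<lambda>a. coset_map ?S J (\<alpha> a)) ` A" by blast
    qed
  qed
  finally show ?thesis by (simp add: reduction_def)
qed

text \<open>Each splitting contributes one factor \<open>card (A / J A) = card (R / J)\<close>;
what remains at the end is the torsion submodule.\<close>

lemma card_reduction_peels:
  assumes M: "Module.module R M" and J: "ideal J R" "J \<noteq> {\<zero>}"
  shows "submodule H R M \<Longrightarrow> peels R M H As \<Longrightarrow>
    card (reduction M J H) = card (reduction M J (H \<inter> torsion_elements R M)) *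
      card (coset_map (regular_module R) J ` carrier R) ^ length As"
proof (induction As arbitrary: H)
  case Nil
  then have "H \<inter> torsion_elements R M = H" by auto
  then show ?case by simp
next
  case (Cons A As)
  interpret M: Module.module R M by fact
  interpret S: Module.module R "regular_module R" by (rule module_regular_module)
  let ?S = "regular_module R"
  note H = \<open>submodule H R M\<close>
  note Hc = M.submodule_closure[OF H]
  obtain f where f: "functional_on R M H f" "f ` H = A" "A \<noteq> {\<zero>}" "peels R M {x \<in> H. f x = \<zero>} As"
    using Cons.prems by auto
  define K where "K = {x \<in> H. f x = \<zero>}"
  have K: "submodule K R M"
    unfolding K_def using submodule_kernel[OF M module_regular_module H f(1)] by simp
  note Kc = M.submodule_closure[OF K]
  have KH: "K \<subseteq> H" by (auto simp: K_def)
  have KT: "K \<inter> torsion_elements R M = H \<inter> torsion_elements R M"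
    unfolding K_def by (rule torsion_of_kernel[OF M H f(1)])
  have As: "submodule A R ?S"
    using submodule_image[OF M module_regular_module H f(1)] f(2) by simp
  then have A: "ideal A R" by (simp add: submodule_regular_iff)
  note Ac = ideal_closure[OF A]
  have JR: "J \<subseteq> carrier R" using ideal_closure(1)[OF J(1)] .
  have nz: "f ` H \<noteq> {\<zero>}" using f by simp
  obtain s where s: "linear_on R (regular_module R) M (f ` H) s" "\<And>a. a \<in> f ` H \<Longrightarrow> s a \<in> H"
    "\<And>a. a \<in> f ` H \<Longrightarrow> f (s a) = a"
    "linear_on R M M H (\<lambda>x. x \<ominus>\<^bsub>M\<^esub> s (f x))"
    "\<And>x. x \<in> H \<Longrightarrow> x \<ominus>\<^bsub>M\<^esub> s (f x) \<in> K"
    "\<And>x. x \<in> H \<Longrightarrow> f x = \<zero> \<Longrightarrow> x \<ominus>\<^bsub>M\<^esub> s (f x) = x"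
    by (rule functional_splitting[OF M H f(1) nz, folded K_def]) (rule that)
  define p where "p x = x \<ominus>\<^bsub>M\<^esub> s (f x)" for x
  have p: "linear_on R M M H p" unfolding p_def by (rule s(4))
  have pK: "p x \<in> K" if "x \<in> H" for x using s(5)[OF that] by (simp add: p_def)
  have fA: "f x \<in> A" if "x \<in> H" for x using f(2) that by auto
  have sH: "s a \<in> H" if "a \<in> A" for a using s(2) f(2) that by auto
  have sA: "linear_on R ?S M A s" using s(1) f(2) by simp
  note JH = M.submodule_ideal_smult[OF J(1) H] and JK = M.submodule_ideal_smult[OF J(1) K]
    and JA = S.submodule_ideal_smult[OF J(1) As]
  have split: "z = p z \<oplus>\<^bsub>M\<^esub> s (f z)" if z: "z \<in> H" for z
    using Hc(7)[OF z] Hc(7)[OF sH[OF fA[OF z]]] by (simp add: p_def a_minus_def M.M.a_assoc M.M.l_neg)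
  have JKH: "ideal_smult M J K \<subseteq> ideal_smult M J H"
  proof
    fix x assume "x \<in> ideal_smult M J K"
    then show "x \<in> ideal_smult M J H"
      by induction (use KH in \<open>auto intro: ideal_smult.intros\<close>)
  qed
  have mem: "z \<in> ideal_smult M J H \<longleftrightarrow> p z \<in> ideal_smult M J K \<and> f z \<in> ideal_smult ?S J A"
    if z: "z \<in> H" for z
  proof
    assume "z \<in> ideal_smult M J H"
    then show "p z \<in> ideal_smult M J K \<and> f z \<in> ideal_smult ?S J A"
      using linear_on_ideal_smult[OF JR p pK JH(2)] linear_on_ideal_smult[OF JR f(1) fA JH(2)] by blast
  next
    assume a: "p z \<in> ideal_smult M J K \<and> f z \<in> ideal_smult ?S J A"
    then have "s (f z) \<in> ideal_smult M J H"
      using linear_on_ideal_smult[OF JR sA sH JA(2)] by blast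
    then have "p z \<oplus>\<^bsub>M\<^esub> s (f z) \<in> ideal_smult M J H"
      using a JKH by (blast intro: ideal_smult.add)
    then show "z \<in> ideal_smult M J H" using split[OF z] by simp
  qed
  let ?\<phi> = "\<lambda>x. (ideal_smult M J K +>\<^bsub>M\<^esub> p x, ideal_smult ?S J A +>\<^bsub>?S\<^esub> f x)"
  have "card (coset_map M (ideal_smult M J H) ` H) = card (?\<phi> ` H)"
  proof (rule card_image_eq_if_same_fibres)
    fix x y assume xy: "x \<in> H" "y \<in> H"
    have 1: "p (x \<ominus>\<^bsub>M\<^esub> y) = p x \<ominus>\<^bsub>M\<^esub> p y" by (rule linear_on_arith(3)[OF M M H p xy])
    have 2: "f (x \<ominus>\<^bsub>M\<^esub> y) = f x \<ominus>\<^bsub>?S\<^esub> f y" by (rule linear_on_arith(3)[OF M module_regular_module H f(1) xy])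
    show "ideal_smult M J H +>\<^bsub>M\<^esub> x = ideal_smult M J H +>\<^bsub>M\<^esub> y \<longleftrightarrow> ?\<phi> x = ?\<phi> y"
      unfolding prod.inject
      using M.coset_eq_iff[OF JH(1) Hc(7)[OF xy(1)] Hc(7)[OF xy(2)]]
        M.coset_eq_iff[OF JK(1) Kc(7)[OF pK[OF xy(1)]] Kc(7)[OF pK[OF xy(2)]]]
        S.coset_eq_iff[OF JA(1) linear_onD(1)[OF f(1) xy(1)] linear_onD(1)[OF f(1) xy(2)]]
        mem[OF Hc(6)[OF xy]] 1 2 by simp
  qed
  also have "?\<phi> ` H = reduction M J K \<times> reduction ?S J A"
  proof
    show "?\<phi> ` H \<subseteq> reduction M J K \<times> reduction ?S J A"
      using pK fA by (auto simp: reduction_def)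
    show "reduction M J K \<times> reduction ?S J A \<subseteq> ?\<phi> ` H"
    proof
      fix q assume "q \<in> reduction M J K \<times> reduction ?S J A"
      then obtain k a where q: "q = (ideal_smult M J K +>\<^bsub>M\<^esub> k, ideal_smult ?S J A +>\<^bsub>?S\<^esub> a)" "k \<in> K" "a \<in> A"
        by (auto simp: reduction_def)
      have kH: "k \<in> H" "f k = \<zero>" using q by (auto simp: K_def)
      have x: "k \<oplus>\<^bsub>M\<^esub> s a \<in> H" by (rule Hc(3)[OF kH(1) sH[OF q(3)]])
      have fs: "f (s a) = a" using s(3) f(2) q(3) by simp
      have fx: "f (k \<oplus>\<^bsub>M\<^esub> s a) = a"
        using linear_onD(2)[OF f(1) kH(1) sH[OF q(3)]] fs kH(2) q(3) Ac(1) by auto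
      have "p (k \<oplus>\<^bsub>M\<^esub> s a) = k"
        unfolding p_def fx using Hc(7)[OF kH(1)] Hc(7)[OF sH[OF q(3)]]
        by (simp add: a_minus_def M.M.a_assoc M.M.r_neg)
      then show "q \<in> ?\<phi> ` H"
        using x fx q(1) by (intro image_eqI[of _ _ "k \<oplus>\<^bsub>M\<^esub> s a"]) simp_all
    qed
  qed
  also have "card (reduction M J K \<times> reduction ?S J A) =
      card (reduction M J K) * card (coset_map ?S J ` carrier R)"
    using card_reduction_ideal[OF A f(3) J] by (simp add: card_cartesian_product)
  also have "card (reduction M J K) = card (reduction M J (H \<inter> torsion_elements R M)) *
      card (coset_map ?S J ` carrier R) ^ length As"
    using Cons.IH[OF K] f(4) KT by (simp add: K_def[symmetric])
  finally show ?case by (simp add: reduction_def)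
qed

end

section \<open>Profinite completions\<close>

lemma mod_iso_iff:
  "h \<in> mod_iso R M N \<longleftrightarrow> linear_on R M N (carrier M) h \<and> bij_betw h (carrier M) (carrier N)"
  unfolding mod_iso_def iso_def hom_def linear_on_def by auto

lemma carrier_completion: "carrier (completion R M) = completion_carrier R M"
  by (simp add: completion_def)

lemma topspace_completion_topology: "topspace (completion_topology R M) = completion_carrier R M"
proof -
  have "completion_carrier R M \<subseteq> (\<Pi>\<^sub>E H\<in>cofinite_submodules R M. carrier (quot_module M H))"
    by (auto simp: completion_carrier_def)
  then show ?thesis
    by (auto simp: completion_topology_def topspace_subtopology)
qed

lemma completions_isomorphic_sym:
  assumes M: "Module.module R M" and iso: "completions_isomorphic R M N"
  shows "completions_isomorphic R N M"
proof -
  let ?C = "completion R M" and ?D = "completion R N"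
  obtain h where h: "linear_on R ?C ?D (carrier ?C) h" "bij_betw h (carrier ?C) (carrier ?D)"
    and hh: "homeomorphic_map (completion_topology R M) (completion_topology R N) h"
    using iso by (auto simp: completions_isomorphic_def mod_iso_iff)
  note C = module_completion(1)[OF M]
  obtain g where g: "homeomorphic_maps (completion_topology R M) (completion_topology R N) h g"
    using hh homeomorphic_map_maps by blast
  have gh: "g (h x) = x" if "x \<in> carrier ?C" for x
    using g that by (simp add: homeomorphic_maps_def topspace_completion_topology carrier_completion)
  let ?i = "inv_into (carrier ?C) h"
  have gi: "g y = ?i y" if y: "y \<in> carrier ?D" for y
  proof -
    obtain x where x: "x \<in> carrier ?C" "y = h x" using h(2) y by (auto simp: bij_betw_def)
    then show ?thesis using gh h(2) by (simp add: bij_betw_def)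
  qed
  have "linear_on R ?D ?C (carrier ?D) ?i"
    by (rule linear_on_inverse[OF C module.carrier_is_submodule[OF C] h])
  moreover have "bij_betw ?i (carrier ?D) (carrier ?C)"
    by (rule bij_betw_inv_into[OF h(2)])
  moreover have "homeomorphic_map (completion_topology R N) (completion_topology R M) ?i"
  proof (rule homeomorphic_map_eq)
    show "homeomorphic_map (completion_topology R N) (completion_topology R M) g"
      using g by (meson homeomorphic_map_maps homeomorphic_maps_sym)
    show "g y = ?i y" if "y \<in> topspace (completion_topology R N)" for y
      using gi that by (simp add: topspace_completion_topology carrier_completion)
  qed
  ultimately show ?thesis
    by (auto simp: completions_isomorphic_def mod_iso_iff)
qed

lemma completions_isomorphic_trans:
  assumes "completions_isomorphic R L M" "completions_isomorphic R M N"
  shows "completions_isomorphic R L N"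
proof -
  obtain g where g: "linear_on R (completion R L) (completion R M) (carrier (completion R L)) g"
    "bij_betw g (carrier (completion R L)) (carrier (completion R M))"
    "homeomorphic_map (completion_topology R L) (completion_topology R M) g"
    using assms(1) by (auto simp: completions_isomorphic_def mod_iso_iff)
  obtain h where h: "linear_on R (completion R M) (completion R N) (carrier (completion R M)) h"
    "bij_betw h (carrier (completion R M)) (carrier (completion R N))"
    "homeomorphic_map (completion_topology R M) (completion_topology R N) h"
    using assms(2) by (auto simp: completions_isomorphic_def mod_iso_iff)
  have "linear_on R (completion R L) (completion R N) (carrier (completion R L)) (\<lambda>x. h (g x))"
    using g(2) by (intro linear_on_comp[OF g(1) h(1)]) (simp add: bij_betw_def)
  then have "linear_on R (completion R L) (completion R N) (carrier (completion R L)) (h \<circ> g)"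
    by (simp add: comp_def)
  with bij_betw_trans[OF g(2) h(2)] homeomorphic_map_compose[OF g(3) h(3)] show ?thesis
    by (auto simp: completions_isomorphic_def mod_iso_iff)
qed

context Module.module
begin

lemma completion_component:
  assumes x: "x \<in> completion_carrier R M" and H: "H \<in> cofinite_submodules R M"
  shows "\<exists>a\<in>carrier M. x H = H +>\<^bsub>M\<^esub> a"
proof -
  have "x H \<in> carrier (quot_module M H)"
    using x H by (auto simp: completion_carrier_def)
  then show ?thesis by (auto simp: quot_module_sel A_RCOSETS_def')
qed

lemma completion_transition:
  assumes x: "x \<in> completion_carrier R M"
    and H: "H \<in> cofinite_submodules R M" and K: "K \<in> cofinite_submodules R M" "H \<subseteq> K"
    and a: "a \<in> carrier M" "x H = H +>\<^bsub>M\<^esub> a"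
  shows "x K = K +>\<^bsub>M\<^esub> a"
proof -
  have "x K = K <+>\<^bsub>M\<^esub> x H" using x H K by (auto simp: completion_carrier_def)
  then show ?thesis
    using transition_map[OF module_axioms _ _ K(2) a(1)] H K(1) a(2) by (simp add: cofinite_submodules_iff)
qed

lemma completion_ext:
  assumes "x \<in> completion_carrier R M" "y \<in> completion_carrier R M"
    "\<And>H. H \<in> cofinite_submodules R M \<Longrightarrow> x H = y H"
  shows "x = y"
  using assms by (intro extensionalityI[of x "cofinite_submodules R M" y])
    (auto simp: completion_carrier_def PiE_def)

lemma completion_map_apply:
  "H \<in> cofinite_submodules R M \<Longrightarrow> completion_map R M a H = H +>\<^bsub>M\<^esub> a"
  by (simp add: completion_map_def)

lemma completion_ops:
  assumes "H \<in> cofinite_submodules R M"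
  shows "(x \<oplus>\<^bsub>completion R M\<^esub> y) H = x H \<oplus>\<^bsub>quot_module M H\<^esub> y H"
    "(r \<odot>\<^bsub>completion R M\<^esub> x) H = r \<odot>\<^bsub>quot_module M H\<^esub> x H"
    "\<zero>\<^bsub>completion R M\<^esub> H = H"
  using assms by (simp_all add: completion_def quot_module_sel)

lemma linear_completion_map: "linear_on R M (completion R M) (carrier M) (completion_map R M)"
proof -
  interpret C: Module.module R "completion R M" by (rule module_completion(1)[OF module_axioms])
  note cc = module_completion(2)[OF module_axioms]
  show ?thesis
  proof (rule linear_onI)
    show "completion_map R M x \<in> carrier (completion R M)" if "x \<in> carrier M" for x
      using cc[OF that] .
    show "completion_map R M (x \<oplus>\<^bsub>M\<^esub> y) = completion_map R M x \<oplus>\<^bsub>completion R M\<^esub> completion_map R M y"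
      if xy: "x \<in> carrier M" "y \<in> carrier M" for x y
    proof (rule completion_ext)
      show "completion_map R M (x \<oplus>\<^bsub>M\<^esub> y) \<in> completion_carrier R M"
        using cc[of "x \<oplus>\<^bsub>M\<^esub> y"] xy by (simp add: carrier_completion)
      show "completion_map R M x \<oplus>\<^bsub>completion R M\<^esub> completion_map R M y \<in> completion_carrier R M"
        using C.M.add.m_closed[OF cc[OF xy(1)] cc[OF xy(2)]] by (simp add: carrier_completion)
      fix H assume H: "H \<in> cofinite_submodules R M"
      then have Hs: "submodule H R M" by (simp add: cofinite_submodules_iff)
      show "completion_map R M (x \<oplus>\<^bsub>M\<^esub> y) H = (completion_map R M x \<oplus>\<^bsub>completion R M\<^esub> completion_map R M y) H"
        using abelian_subgroup.a_rcos_sum[OF submodule_abelian_subgroup[OF module_axioms Hs] xy] H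
        by (simp add: completion_ops completion_map_apply quot_module_sel)
    qed
    show "completion_map R M (r \<odot>\<^bsub>M\<^esub> x) = r \<odot>\<^bsub>completion R M\<^esub> completion_map R M x"
      if r: "r \<in> carrier R" and x: "x \<in> carrier M" for r x
    proof (rule completion_ext)
      show "completion_map R M (r \<odot>\<^bsub>M\<^esub> x) \<in> completion_carrier R M"
        using cc[of "r \<odot>\<^bsub>M\<^esub> x"] r x by (simp add: carrier_completion)
      show "r \<odot>\<^bsub>completion R M\<^esub> completion_map R M x \<in> completion_carrier R M"
        using C.smult_closed[OF r cc[OF x]] by (simp add: carrier_completion)
      fix H assume H: "H \<in> cofinite_submodules R M"
      then have Hs: "submodule H R M" by (simp add: cofinite_submodules_iff)
      show "completion_map R M (r \<odot>\<^bsub>M\<^esub> x) H = (r \<odot>\<^bsub>completion R M\<^esub> completion_map R M x) H"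
        using quot_module_smult[OF module_axioms Hs r x] H
        by (simp add: completion_ops completion_map_apply)
    qed
  qed
qed

lemma cofinite_carrier: "carrier M \<in> cofinite_submodules R M"
proof -
  have "coset_map M (carrier M) ` carrier M \<subseteq> {carrier M}"
    using coset_of_zero[OF carrier_is_submodule] by auto
  then show ?thesis
    using carrier_is_submodule finite_subset by (auto simp: cofinite_submodules_iff)
qed

lemma cofinite_inter:
  assumes "H \<in> cofinite_submodules R M" "K \<in> cofinite_submodules R M"
  shows "H \<inter> K \<in> cofinite_submodules R M"
proof -
  have H: "submodule H R M" "finite (coset_map M H ` carrier M)"
    and K: "submodule K R M" "finite (coset_map M K ` carrier M)"
    using assms by (simp_all add: cofinite_submodules_iff)
  have HK: "submodule (H \<inter> K) R M"
    using submodule_closure[OF H(1)] submodule_closure[OF K(1)] by (intro submodule_by_closure) auto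
  let ?\<phi> = "\<lambda>x. (H +>\<^bsub>M\<^esub> x, K +>\<^bsub>M\<^esub> x)"
  have "?\<phi> ` carrier M \<subseteq> coset_map M H ` carrier M \<times> coset_map M K ` carrier M" by auto
  then have "finite (?\<phi> ` carrier M)"
    using H(2) K(2) by (meson finite_SigmaI finite_subset)
  then have "finite (coset_map M (H \<inter> K) ` carrier M)"
  proof (rule finite_image_factor)
    fix x y assume xy: "x \<in> carrier M" "y \<in> carrier M" "?\<phi> x = ?\<phi> y"
    then show "H \<inter> K +>\<^bsub>M\<^esub> x = H \<inter> K +>\<^bsub>M\<^esub> y"
      using coset_eq_iff[OF H(1) xy(1,2)] coset_eq_iff[OF K(1) xy(1,2)] coset_eq_iff[OF HK xy(1,2)] by simp
  qed
  with HK show ?thesis by (simp add: cofinite_submodules_iff)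
qed

lemma cofinite_below_finite_family:
  assumes "finite F" "F \<subseteq> cofinite_submodules R M"
  shows "\<exists>H\<in>cofinite_submodules R M. \<forall>K\<in>F. H \<subseteq> K"
  using assms
proof induction
  case empty
  then show ?case using cofinite_carrier by auto
next
  case (insert K F)
  then obtain H where H: "H \<in> cofinite_submodules R M" "\<forall>K\<in>F. H \<subseteq> K" by auto
  have "H \<inter> K \<in> cofinite_submodules R M"
    using insert.prems by (intro cofinite_inter H(1)) auto
  with H(2) show ?case by (intro bexI[of _ "H \<inter> K"]) auto
qed

text \<open>A basic open set constrains finitely many components, and these are all determined by the
component at one submodule of finite index below them.\<close>

lemma completion_map_dense:
  assumes V: "openin (completion_topology R M) V" and z: "z \<in> V"
  shows "\<exists>a\<in>carrier M. completion_map R M a \<in> V"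
proof -
  let ?I = "cofinite_submodules R M"
  let ?T = "\<lambda>H. discrete_topology (carrier (quot_module M H))"
  obtain W where W: "openin (product_topology ?T ?I) W" "V = W \<inter> completion_carrier R M"
    using V by (auto simp: completion_topology_def openin_subtopology)
  then have zW: "z \<in> W" "z \<in> completion_carrier R M" using z by auto
  from bspec[OF iffD1[OF openin_product_topology_alt W(1)] zW(1)]
  obtain U where U: "finite {i \<in> ?I. U i \<noteq> topspace (?T i)}" "z \<in> Pi\<^sub>E ?I U" "Pi\<^sub>E ?I U \<subseteq> W"
    by (elim exE conjE)
  define F where "F = {i \<in> ?I. U i \<noteq> topspace (?T i)}"
  obtain H where H: "H \<in> ?I" "\<forall>K\<in>F. H \<subseteq> K"
    using cofinite_below_finite_family[of F] U(1) by (auto simp: F_def)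
  obtain a where a: "a \<in> carrier M" "z H = H +>\<^bsub>M\<^esub> a"
    using completion_component[OF zW(2) H(1)] by auto
  have ca: "completion_map R M a \<in> completion_carrier R M"
    using module_completion(2)[OF module_axioms a(1)] by (simp add: carrier_completion)
  have "completion_map R M a \<in> Pi\<^sub>E ?I U"
  proof (rule PiE_I)
    fix K assume K: "K \<in> ?I"
    show "completion_map R M a K \<in> U K"
    proof (cases "K \<in> F")
      case True
      then have "z K = K +>\<^bsub>M\<^esub> a"
        using completion_transition[OF zW(2) H(1) K _ a] H(2) by simp
      then have "completion_map R M a K = z K" using K by (simp add: completion_map_apply)
      also have "z K \<in> U K" using U(2) K by auto
      finally show ?thesis .
    next
      case False
      then have "U K = carrier (quot_module M K)" using K by (simp add: F_def)
      then show ?thesis using ca K by (auto simp: completion_carrier_def)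
    qed
  next
    fix K assume "K \<notin> ?I"
    then show "completion_map R M a K = undefined" by (simp add: completion_map_def)
  qed
  then show ?thesis using U(3) W(2) ca a(1) by blast
qed

end

text \<open>Compose \<open>M \<rightarrow> completion R M \<rightarrow> completion R N \<rightarrow> N /
J N\<close>. The composite kills \<open>J M\<close>, and it is surjective because \<open>M\<close> is
dense in its completion and the other two maps are continuous and surjective.\<close>

lemma card_reduction_le_if_completions_isomorphic:
  assumes M: "Module.module R M" and N: "Module.module R N" and iso: "completions_isomorphic R M N"
    and J: "ideal J R"
    and fin: "ideal_smult M J (carrier M) \<in> cofinite_submodules R M"
      "ideal_smult N J (carrier N) \<in> cofinite_submodules R N"
  shows "card (reduction N J (carrier N)) \<le> card (reduction M J (carrier M))"
proof -
  interpret M: Module.module R M by fact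
  interpret N: Module.module R N by fact
  let ?C = "completion R M" and ?D = "completion R N"
  interpret C: Module.module R ?C by (rule module_completion(1)[OF M])
  interpret D: Module.module R ?D by (rule module_completion(1)[OF N])
  obtain h where h: "linear_on R ?C ?D (carrier ?C) h" "bij_betw h (carrier ?C) (carrier ?D)"
    and hh: "homeomorphic_map (completion_topology R M) (completion_topology R N) h"
    using iso by (auto simp: completions_isomorphic_def mod_iso_iff)
  define K where "K = ideal_smult N J (carrier N)"
  have K: "K \<in> cofinite_submodules R N" using fin(2) by (simp add: K_def)
  then have Ks: "submodule K R N" by (simp add: cofinite_submodules_iff)
  interpret Q: Module.module R "quot_module N K" by (rule module_quot_module[OF N Ks])
  have JR: "J \<subseteq> carrier R" using M.R.ideal_closure(1)[OF J] .
  define L where "L = ideal_smult M J (carrier M)"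
  have Ls: "submodule L R M" "finite (coset_map M L ` carrier M)"
    using fin(1) by (simp_all add: cofinite_submodules_iff L_def)
  define g where "g x = h (completion_map R M x) K" for x
  have c: "completion_map R M x \<in> carrier ?C" if "x \<in> carrier M" for x
    by (rule module_completion(2)[OF M that])
  have hc: "h (completion_map R M x) \<in> completion_carrier R N" if "x \<in> carrier M" for x
    using linear_onD(1)[OF h(1) c[OF that]] by (simp add: carrier_completion)
  have lin: "linear_on R M ?D (carrier M) (\<lambda>x. h (completion_map R M x))"
    using c by (intro linear_on_comp[OF M.linear_completion_map h(1)]) auto
  have g: "linear_on R M (quot_module N K) (carrier M) g"
  proof (rule linear_onI)
    show "g x \<in> carrier (quot_module N K)" if "x \<in> carrier M" for x
      using hc[OF that] K by (auto simp: g_def completion_carrier_def)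
    show "g (x \<oplus>\<^bsub>M\<^esub> y) = g x \<oplus>\<^bsub>quot_module N K\<^esub> g y" if "x \<in> carrier M" "y \<in> carrier M" for x y
      using linear_onD(2)[OF lin that] N.completion_ops(1)[OF K] by (simp add: g_def)
    show "g (r \<odot>\<^bsub>M\<^esub> x) = r \<odot>\<^bsub>quot_module N K\<^esub> g x" if "r \<in> carrier R" "x \<in> carrier M" for r x
      using linear_onD(3)[OF lin that] N.completion_ops(2)[OF K] by (simp add: g_def)
  qed
  have killed: "g z = \<zero>\<^bsub>quot_module N K\<^esub>" if "z \<in> L" for z
    using that unfolding L_def
  proof induction
    case (smult j x)
    obtain y where y: "y \<in> carrier N" "g x = K +>\<^bsub>N\<^esub> y"
      using N.completion_component[OF hc[OF smult(2)] K] by (auto simp: g_def)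
    have j: "j \<in> carrier R" using smult JR by auto
    have "g (j \<odot>\<^bsub>M\<^esub> x) = j \<odot>\<^bsub>quot_module N K\<^esub> (K +>\<^bsub>N\<^esub> y)"
      using linear_onD(3)[OF g j smult(2)] y(2) by simp
    also have "\<dots> = K +>\<^bsub>N\<^esub> (j \<odot>\<^bsub>N\<^esub> y)"
      by (rule quot_module_smult[OF N Ks j y(1)])
    also have "\<dots> = K"
      using N.coset_of_zero[OF Ks, of "j \<odot>\<^bsub>N\<^esub> y"] ideal_smult.smult[OF smult(1) y(1), of N] j y(1)
      by (simp add: K_def)
    finally show ?case by (simp add: quot_module_sel)
  next
    case (add x y)
    have "x \<in> carrier M" "y \<in> carrier M"
      using add.hyps M.submodule_ideal_smult(2)[OF J M.carrier_is_submodule] by auto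
    then show ?case using linear_onD(2)[OF g, of x y] add.IH by simp
  qed
  have surj: "coset_map N K ` carrier N \<subseteq> g ` carrier M"
  proof
    fix E assume "E \<in> coset_map N K ` carrier N"
    then obtain y where y: "y \<in> carrier N" "E = K +>\<^bsub>N\<^esub> y" by auto
    let ?TM = "completion_topology R M" and ?TN = "completion_topology R N"
    have "continuous_map ?TN (discrete_topology (carrier (quot_module N K))) (\<lambda>z. z K)"
      unfolding completion_topology_def
      by (intro continuous_map_from_subtopology continuous_map_product_projection K)
    moreover have "continuous_map ?TM ?TN h"
      using hh by (rule homeomorphic_imp_continuous_map)
    ultimately have "continuous_map ?TM (discrete_topology (carrier (quot_module N K))) ((\<lambda>z. z K) \<circ> h)"
      by (rule continuous_map_compose[rotated])
    moreover have "openin (discrete_topology (carrier (quot_module N K))) {E}"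
      using y by (auto simp: quot_module_sel A_RCOSETS_def')
    ultimately have V: "openin ?TM {z \<in> topspace ?TM. ((\<lambda>z. z K) \<circ> h) z \<in> {E}}"
      by (rule openin_continuous_map_preimage)
    have "completion_map R N y \<in> h ` carrier ?C"
      using module_completion(2)[OF N y(1)] h(2) by (simp add: bij_betw_def)
    then obtain z where z: "z \<in> carrier ?C" "h z = completion_map R N y"
      by (elim imageE) simp
    have "z \<in> {z \<in> topspace ?TM. ((\<lambda>z. z K) \<circ> h) z \<in> {E}}"
      using z y N.completion_map_apply[OF K] by (simp add: topspace_completion_topology carrier_completion)
    from M.completion_map_dense[OF V this] show "E \<in> g ` carrier M"
      by (auto simp: g_def)
  qed
  have "card (coset_map N K ` carrier N) \<le> card (coset_map M L ` carrier M)"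
  proof -
    have same: "g x = g y" if xy: "x \<in> carrier M" "y \<in> carrier M" "L +>\<^bsub>M\<^esub> x = L +>\<^bsub>M\<^esub> y" for x y
    proof -
      have "x \<ominus>\<^bsub>M\<^esub> y \<in> L" using M.coset_eq_iff[OF Ls(1) xy(1,2)] xy(3) by simp
      then have "g x \<ominus>\<^bsub>quot_module N K\<^esub> g y = \<zero>\<^bsub>quot_module N K\<^esub>"
        using killed linear_on_arith(3)[OF M Q.module_axioms M.carrier_is_submodule g xy(1,2)] by simp
      then show ?thesis
        by (rule Q.eq_if_minus_zero[OF linear_onD(1)[OF g xy(1)] linear_onD(1)[OF g xy(2)]])
    qed
    define i where "i = inv_into (carrier M) (coset_map M L)"
    have "g ` carrier M \<subseteq> (\<lambda>E. g (i E)) ` coset_map M L ` carrier M"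
    proof
      fix E assume "E \<in> g ` carrier M"
      then obtain x where x: "x \<in> carrier M" "E = g x" by auto
      have m: "L +>\<^bsub>M\<^esub> x \<in> coset_map M L ` carrier M" using x(1) by auto
      have "g (i (L +>\<^bsub>M\<^esub> x)) = g x"
        unfolding i_def by (rule same[OF inv_into_into[OF m] x(1) f_inv_into_f[OF m]])
      then show "E \<in> (\<lambda>E. g (i E)) ` coset_map M L ` carrier M"
        using x(2) m by (intro image_eqI[of _ _ "L +>\<^bsub>M\<^esub> x"]) simp_all
    qed
    with surj have "coset_map N K ` carrier N \<subseteq> (\<lambda>E. g (i E)) ` coset_map M L ` carrier M"
      by (rule subset_trans)
    then have "card (coset_map N K ` carrier N) \<le> card ((\<lambda>E. g (i E)) ` coset_map M L ` carrier M)"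
      by (rule card_mono[OF finite_imageI[OF Ls(2)]])
    also have "\<dots> \<le> card (coset_map M L ` carrier M)"
      by (rule card_image_le[OF Ls(2)])
    finally show ?thesis .
  qed
  then show ?thesis by (simp add: reduction_def K_def L_def)
qed

section \<open>Torsion and rank are visible in the completion\<close>

context dedekind_domain
begin

text \<open>\<open>J / J J'\<close> is finitely generated and killed by \<open>J'\<close>.\<close>

lemma cofinite_ideal_prod:
  assumes J: "J \<in> cofinite_ideals R" and J': "J' \<in> cofinite_ideals R"
  shows "J \<cdot> J' \<in> cofinite_ideals R"
proof -
  interpret S: Module.module R "regular_module R" by (rule module_regular_module)
  have Js: "submodule J R (regular_module R)" "finite (coset_map (regular_module R) J ` carrier R)"
    using J by (simp_all add: cofinite_submodules_iff)
  have id: "ideal J R" "ideal J' R"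
    using J J' by (simp_all add: cofinite_submodules_iff submodule_regular_iff)
  have P: "submodule (J \<cdot> J') R (regular_module R)"
    using ideal_prod_is_ideal[OF id] by (simp add: submodule_regular_iff)
  obtain ys where ys: "set ys \<subseteq> J" "J = {lincomb (regular_module R) rs ys | rs. set rs \<subseteq> carrier R}"
    using ideal_generated_by_list[OF is_cring id(1)] by blast
  have "finite (coset_map (regular_module R) (J \<cdot> J') ` {lincomb (regular_module R) rs ys | rs. set rs \<subseteq> carrier R})"
  proof (rule S.finite_quotient_of_lincombs[OF P])
    show "set ys \<subseteq> carrier (regular_module R)" using ys(1) ideal_closure(1)[OF id(1)] by simp
    fix y assume "y \<in> set ys"
    then have y: "y \<in> J" "y \<in> carrier R" using ys(1) ideal_closure(1)[OF id(1)] by auto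
    have "j \<odot>\<^bsub>regular_module R\<^esub> y \<in> J \<cdot> J'" if "j \<in> J'" for j
      using ideal_prod.prod[OF y(1) that, of R] m_comm[OF y(2), of j] that ideal_closure(1)[OF id(2)] by auto
    then show "\<exists>J''\<in>cofinite_ideals R. \<forall>j\<in>J''. j \<odot>\<^bsub>regular_module R\<^esub> y \<in> J \<cdot> J'"
      using J' by blast
  qed
  then have "finite (coset_map (regular_module R) (J \<cdot> J') ` J)"
    unfolding ys(2)[symmetric] .
  from S.finite_index_trans[OF P Js(1) _ this] show ?thesis
    using Js(2) P by (simp add: cofinite_submodules_iff)
qed

lemma cofinite_if_killed_by_cofinite_ideal:
  assumes M: "finitely_generated_module R M" and J: "J \<in> cofinite_ideals R"
    and K: "submodule K R M" and kill: "\<And>j x. j \<in> J \<Longrightarrow> x \<in> carrier M \<Longrightarrow> j \<odot>\<^bsub>M\<^esub> x \<in> K"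
  shows "K \<in> cofinite_submodules R M"
proof -
  have mod: "Module.module R M" using M by (simp add: finitely_generated_module_def)
  interpret M: Module.module R M by fact
  obtain xs where xs: "set xs \<subseteq> carrier M" "carrier M = {lincomb M rs xs | rs. set rs \<subseteq> carrier R}"
    using M.finitely_generated_carrier_lincombs[OF M] by blast
  have "finite (coset_map M K ` {lincomb M rs xs | rs. set rs \<subseteq> carrier R})"
  proof (rule M.finite_quotient_of_lincombs[OF K xs(1)])
    fix x assume "x \<in> set xs"
    then have "x \<in> carrier M" using xs(1) by blast
    then show "\<exists>J\<in>cofinite_ideals R. \<forall>j\<in>J. j \<odot>\<^bsub>M\<^esub> x \<in> K"
      using J kill by (intro bexI[of _ J]) simp_all
  qed
  then have "finite (coset_map M K ` carrier M)" unfolding xs(2)[symmetric] .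
  with K show ?thesis by (simp add: cofinite_submodules_iff)
qed

text \<open>In a residually finite finitely generated module these are all torsion elements. In the
completion, asking for an ideal of finite index instead of a single nonzero element ensures that no new
elements arise: \<open>J\<close> is invertible and multiplying by it preserves finite index.\<close>

definition cofinite_torsion :: "('a, 'm, 'e) module_scheme \<Rightarrow> 'm set" where
  "cofinite_torsion M =
     {x \<in> carrier M. \<exists>J\<in>cofinite_ideals R. J \<noteq> {\<zero>} \<and> (\<forall>j\<in>J. j \<odot>\<^bsub>M\<^esub> x = \<zero>\<^bsub>M\<^esub>)}"

text \<open>Choose \<open>J1\<close> of finite index with \<open>J1 M \<subseteq> H\<close> and look
at the component at \<open>L' = J (J1 M)\<close>, which still has finite index. Its representative
\<open>y\<close> satisfies \<open>J y \<subseteq> J (J1 M)\<close>. Multiplying by the inverse of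
\<open>J\<close> gives \<open>d y \<in> d (J1 M)\<close>, so \<open>y\<close> differs from an
element of \<open>J1 M \<subseteq> H\<close> by torsion.\<close>

lemma completion_torsion_component:
  assumes M: "finitely_generated_module R M"
    and x: "x \<in> cofinite_torsion (completion R M)" and H: "H \<in> cofinite_submodules R M"
  shows "\<exists>t\<in>torsion_elements R M. x H = H +>\<^bsub>M\<^esub> t"
proof -
  have mod: "Module.module R M" using M by (simp add: finitely_generated_module_def)
  interpret M: Module.module R M by fact
  have Hs: "submodule H R M" using H by (simp add: cofinite_submodules_iff)
  note Hc = M.submodule_closure[OF Hs]
  obtain J where xC: "x \<in> completion_carrier R M" and J: "J \<in> cofinite_ideals R" "J \<noteq> {\<zero>}"
    "\<forall>j\<in>J. j \<odot>\<^bsub>completion R M\<^esub> x = \<zero>\<^bsub>completion R M\<^esub>"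
    using x by (auto simp: cofinite_torsion_def carrier_completion)
  have Ji: "ideal J R" using J(1) by (simp add: cofinite_submodules_iff submodule_regular_iff)
  note Jc = ideal_closure[OF Ji]
  obtain xs where xs: "set xs \<subseteq> carrier M" "carrier M = {lincomb M rs xs | rs. set rs \<subseteq> carrier R}"
    using M.finitely_generated_carrier_lincombs[OF M] by blast
  define J1 where "J1 = {r \<in> carrier R. \<forall>x\<in>set xs. r \<odot>\<^bsub>M\<^esub> x \<in> H}"
  have J1: "J1 \<in> cofinite_ideals R"
    unfolding J1_def by (rule M.cofinite_colon[OF H xs(1)])
  then have J1i: "ideal J1 R" by (simp add: cofinite_submodules_iff submodule_regular_iff)
  define L where "L = ideal_smult M J1 (carrier M)"
  have L: "submodule L R M"
    unfolding L_def by (rule M.submodule_ideal_smult(1)[OF J1i M.carrier_is_submodule])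
  note Lc = M.submodule_closure[OF L]
  have LH: "L \<subseteq> H"
  proof
    fix z assume "z \<in> L"
    then show "z \<in> H" unfolding L_def
    proof induction
      case (smult j z)
      then obtain rs where "set rs \<subseteq> carrier R" "z = lincomb M rs xs" using xs(2) by blast
      then show ?case
        using M.lincomb_smult_mem[OF Hs _ xs(1)] smult(1) by (simp add: J1_def)
    qed (rule Hc(3))
  qed
  define L' where "L' = ideal_smult M J L"
  have L': "submodule L' R M" "L' \<subseteq> L"
    unfolding L'_def by (rule M.submodule_ideal_smult[OF Ji L])+
  have L'_cof: "L' \<in> cofinite_submodules R M"
  proof (rule cofinite_if_killed_by_cofinite_ideal[OF M cofinite_ideal_prod[OF J(1) J1] L'(1)])
    fix w z assume "w \<in> J \<cdot> J1" and z: "z \<in> carrier M"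
    then show "w \<odot>\<^bsub>M\<^esub> z \<in> L'"
    proof induction
      case (prod i j)
      have "i \<odot>\<^bsub>M\<^esub> (j \<odot>\<^bsub>M\<^esub> z) \<in> L'"
        unfolding L'_def L_def using prod z by (intro ideal_smult.smult)
      then show ?case
        using prod z Jc(1) ideal_closure(1)[OF J1i] by (simp add: M.smult_assoc1 subset_iff)
    next
      case (sum u v)
      have "u \<in> carrier R" "v \<in> carrier R"
        using sum.hyps ideal_prod_in_carrier[OF Ji J1i] by auto
      then show ?case
        using M.submodule_closure(3)[OF L'(1)] sum z by (simp add: M.smult_l_distr)
    qed
  qed
  obtain y where y: "y \<in> carrier M" "x L' = L' +>\<^bsub>M\<^esub> y"
    using M.completion_component[OF xC L'_cof] by blast
  have Jy: "j \<odot>\<^bsub>M\<^esub> y \<in> L'" if j: "j \<in> J" for j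
  proof -
    have jR: "j \<in> carrier R" using j Jc(1) by blast
    have "(j \<odot>\<^bsub>completion R M\<^esub> x) L' = L'"
      using J(3) j M.completion_ops(3)[OF L'_cof] by simp
    then have "L' +>\<^bsub>M\<^esub> (j \<odot>\<^bsub>M\<^esub> y) = L'"
      using M.completion_ops(2)[OF L'_cof] y quot_module_smult[OF mod L'(1) jR y(1)] by simp
    then show ?thesis
      using M.coset_of_zero[OF L'(1), of "j \<odot>\<^bsub>M\<^esub> y"] jR y(1) by simp
  qed
  obtain B d where B: "ideal B R" and d: "d \<in> carrier R - {\<zero>}" and JB: "J \<cdot> B = PIdl d"
    using nonzero_ideal_invertible[OF Ji J(2)] by blast
  have d': "d \<in> carrier R" "d \<noteq> \<zero>" using d by auto
  have BR: "B \<subseteq> carrier R" using ideal_closure(1)[OF B] .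
  \<comment> \<open>the fraction \<open>b / d\<close> lies in the inverse of \<open>J\<close>, so it maps \<open>J L\<close> into \<open>L\<close>\<close>
  have BL': "\<exists>l\<in>L. b \<odot>\<^bsub>M\<^esub> w = d \<odot>\<^bsub>M\<^esub> l" if "w \<in> L'" and b: "b \<in> B" for w b
    using that(1) unfolding L'_def
  proof induction
    case (smult j l)
    have c: "b \<in> carrier R" "j \<in> carrier R" "l \<in> carrier M" using b BR smult Jc(1) Lc(7) by auto
    obtain r where r: "r \<in> carrier R" "j \<otimes> b = d \<otimes> r"
      using ideal_prod.prod[OF smult(1) b, of R] JB mem_PIdl_iff[OF d'(1)] by auto
    have "b \<odot>\<^bsub>M\<^esub> (j \<odot>\<^bsub>M\<^esub> l) = (j \<otimes> b) \<odot>\<^bsub>M\<^esub> l"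
      using c by (simp add: M.smult_assoc1 M.smult_left_commute)
    also have "\<dots> = d \<odot>\<^bsub>M\<^esub> (r \<odot>\<^bsub>M\<^esub> l)"
      unfolding r(2) using r(1) c d' by (simp add: M.smult_assoc1)
    finally show ?case using Lc(4)[OF r(1) smult(2)] by blast
  next
    case (add u v)
    then obtain l m where lm: "l \<in> L" "b \<odot>\<^bsub>M\<^esub> u = d \<odot>\<^bsub>M\<^esub> l" "m \<in> L" "b \<odot>\<^bsub>M\<^esub> v = d \<odot>\<^bsub>M\<^esub> m" by blast
    have c: "u \<in> carrier M" "v \<in> carrier M" "b \<in> carrier R"
      using add.hyps L'(2) Lc(1) b BR unfolding L'_def by auto
    have "b \<odot>\<^bsub>M\<^esub> (u \<oplus>\<^bsub>M\<^esub> v) = d \<odot>\<^bsub>M\<^esub> (l \<oplus>\<^bsub>M\<^esub> m)"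
      using c lm d' Lc(7) by (simp add: M.smult_r_distr)
    then show ?case using Lc(3)[OF lm(1,3)] by blast
  qed
  \<comment> \<open>used for \<open>e = d\<close>, which lies in \<open>J B\<close>\<close>
  have "\<exists>l\<in>L. e \<odot>\<^bsub>M\<^esub> y = d \<odot>\<^bsub>M\<^esub> l" if "e \<in> J \<cdot> B" for e
    using that
  proof induction
    case (prod j b)
    have "(j \<otimes> b) \<odot>\<^bsub>M\<^esub> y = b \<odot>\<^bsub>M\<^esub> (j \<odot>\<^bsub>M\<^esub> y)"
      using prod Jc(1) BR y(1) by (simp add: M.smult_assoc1 M.smult_left_commute subset_iff)
    then show ?case using BL'[OF Jy[OF prod(1)] prod(2)] by simp
  next
    case (sum u v)
    then obtain l m where lm: "l \<in> L" "u \<odot>\<^bsub>M\<^esub> y = d \<odot>\<^bsub>M\<^esub> l" "m \<in> L" "v \<odot>\<^bsub>M\<^esub> y = d \<odot>\<^bsub>M\<^esub> m" by blast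
    have c: "u \<in> carrier R" "v \<in> carrier R"
      using sum.hyps ideal_prod_in_carrier[OF Ji B] by auto
    have "(u \<oplus> v) \<odot>\<^bsub>M\<^esub> y = d \<odot>\<^bsub>M\<^esub> (l \<oplus>\<^bsub>M\<^esub> m)"
      using c lm d' Lc(7) y(1) by (simp add: M.smult_r_distr M.smult_l_distr)
    then show ?case using Lc(3)[OF lm(1,3)] by blast
  qed
  from this[of d] obtain l where l: "l \<in> L" "d \<odot>\<^bsub>M\<^esub> y = d \<odot>\<^bsub>M\<^esub> l"
    using JB cgenideal_self[OF d'(1)] by auto
  have lM: "l \<in> carrier M" using l Lc(7) by blast
  define t where "t = y \<ominus>\<^bsub>M\<^esub> l"
  have tM: "t \<in> carrier M" using y lM by (simp add: t_def)
  have "d \<odot>\<^bsub>M\<^esub> t = \<zero>\<^bsub>M\<^esub>"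
    using l(2) lM y(1) d' by (simp add: t_def a_minus_def M.smult_r_distr M.smult_r_minus M.M.r_neg)
  then have "t \<in> torsion_elements R M"
    using tM d unfolding torsion_elements_def by blast
  moreover have "x H = H +>\<^bsub>M\<^esub> t"
  proof -
    have "x H = H +>\<^bsub>M\<^esub> y"
      using L'(2) LH by (intro M.completion_transition[OF xC L'_cof H _ y]) auto
    also have "H +>\<^bsub>M\<^esub> y = H +>\<^bsub>M\<^esub> t"
    proof -
      have "y \<ominus>\<^bsub>M\<^esub> t = l"
        using y(1) lM by (simp add: t_def a_minus_def M.M.minus_add M.M.r_neg2)
      then show ?thesis
        using M.coset_eq_iff[OF Hs y(1) tM] l(1) LH by auto
    qed
    finally show ?thesis .
  qed
  ultimately show ?thesis by blast
qed

text \<open>By \<open>completion_torsion_component\<close> each component of \<open>x\<close> is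
represented by a torsion element. The torsion submodule is finite, so some submodule \<open>H0\<close>
of finite index meets it in zero; the representative at \<open>H0\<close> is unique and hence represents
\<open>x\<close> at every \<open>H\<close>, as one sees at \<open>H \<inter> H0\<close>.\<close>

lemma completion_map_torsion:
  assumes M: "finitely_generated_module R M" and rf: "residually_finite R M"
  shows "bij_betw (completion_map R M) (torsion_elements R M) (cofinite_torsion (completion R M))"
proof -
  have mod: "Module.module R M" using M by (simp add: finitely_generated_module_def)
  interpret M: Module.module R M by fact
  interpret C: Module.module R "completion R M" by (rule module_completion(1)[OF mod])
  let ?T = "torsion_elements R M"
  have TM: "?T \<subseteq> carrier M" by (auto simp: torsion_elements_def)
  note lin = linear_onD[OF M.linear_completion_map]
  have "completion_map R M ` ?T = cofinite_torsion (completion R M)"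
  proof
    show "completion_map R M ` ?T \<subseteq> cofinite_torsion (completion R M)"
    proof
      fix z assume "z \<in> completion_map R M ` ?T"
      then obtain t where t: "t \<in> ?T" "z = completion_map R M t" by auto
      have tM: "t \<in> carrier M" using t(1) TM by auto
      define J where "J = {r \<in> carrier R. r \<odot>\<^bsub>M\<^esub> t = \<zero>\<^bsub>M\<^esub>}"
      have J: "J \<in> cofinite_ideals R"
        unfolding J_def by (rule annihilator_of_torsion_cofinite[OF mod rf t(1)])
      have "J \<noteq> {\<zero>}" using t(1) by (auto simp: J_def torsion_elements_def)
      moreover have "j \<odot>\<^bsub>completion R M\<^esub> z = \<zero>\<^bsub>completion R M\<^esub>" if "j \<in> J" for j
        using that lin(3)[of j t] tM t(2)
          linear_on_arith(1)[OF mod C.module_axioms M.carrier_is_submodule M.linear_completion_map]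
        by (simp add: J_def)
      ultimately show "z \<in> cofinite_torsion (completion R M)"
        using J lin(1)[OF tM] t(2) unfolding cofinite_torsion_def by blast
    qed
    show "cofinite_torsion (completion R M) \<subseteq> completion_map R M ` ?T"
    proof
      fix x assume x: "x \<in> cofinite_torsion (completion R M)"
      then have xC: "x \<in> completion_carrier R M" by (simp add: cofinite_torsion_def carrier_completion)
      have fT: "finite ?T" by (rule finite_torsion[OF M rf])
      obtain sep where sep: "\<And>t. t \<in> ?T - {\<zero>\<^bsub>M\<^esub>} \<Longrightarrow> sep t \<in> cofinite_submodules R M"
        "\<And>t. t \<in> ?T - {\<zero>\<^bsub>M\<^esub>} \<Longrightarrow> t \<notin> sep t"
      proof -
        have "\<forall>t\<in>?T - {\<zero>\<^bsub>M\<^esub>}. \<exists>H. H \<in> cofinite_submodules R M \<and> t \<notin> H"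
          using cofinite_submodule_separating[OF mod rf] TM by blast
        from bchoice[OF this] show thesis using that by blast
      qed
      obtain H0 where H0: "H0 \<in> cofinite_submodules R M" "\<forall>K\<in>sep ` (?T - {\<zero>\<^bsub>M\<^esub>}). H0 \<subseteq> K"
        using M.cofinite_below_finite_family[of "sep ` (?T - {\<zero>\<^bsub>M\<^esub>})"] fT sep(1) by auto
      have H0T: "t = \<zero>\<^bsub>M\<^esub>" if "t \<in> H0" "t \<in> ?T" for t
        using that H0(2) sep(2) by blast
      have H0s: "submodule H0 R M" using H0 by (simp add: cofinite_submodules_iff)
      obtain t0 where t0: "t0 \<in> ?T" "x H0 = H0 +>\<^bsub>M\<^esub> t0"
        using completion_torsion_component[OF M x H0(1)] by blast
      have t0M: "t0 \<in> carrier M" using t0 TM by auto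
      have "x = completion_map R M t0"
      proof (rule M.completion_ext[OF xC])
        show "completion_map R M t0 \<in> completion_carrier R M"
          using lin(1)[OF t0M] by (simp add: carrier_completion)
        fix H assume H: "H \<in> cofinite_submodules R M"
        have HH0: "H \<inter> H0 \<in> cofinite_submodules R M" by (rule M.cofinite_inter[OF H H0(1)])
        obtain t where t: "t \<in> ?T" "x (H \<inter> H0) = H \<inter> H0 +>\<^bsub>M\<^esub> t"
          using completion_torsion_component[OF M x HH0] by blast
        have tM: "t \<in> carrier M" using t TM by auto
        have "x H0 = H0 +>\<^bsub>M\<^esub> t"
          by (rule M.completion_transition[OF xC HH0 H0(1) _ tM t(2)]) simp
        then have "t \<ominus>\<^bsub>M\<^esub> t0 \<in> H0"
          using t0(2) M.coset_eq_iff[OF H0s tM t0M] by simp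
        moreover have "t \<ominus>\<^bsub>M\<^esub> t0 \<in> ?T"
          by (rule M.submodule_closure(6)[OF submodule_torsion_elements[OF mod] t(1) t0(1)])
        ultimately have "t = t0"
          using H0T M.eq_if_minus_zero[OF tM t0M] by blast
        moreover have "x H = H +>\<^bsub>M\<^esub> t"
          by (rule M.completion_transition[OF xC HH0 H _ tM t(2)]) simp
        ultimately show "x H = completion_map R M t0 H"
          using H by (simp add: completion_map_def)
      qed
      with t0(1) show "x \<in> completion_map R M ` ?T" by blast
    qed
  qed
  moreover have "inj_on (completion_map R M) ?T"
    using rf TM unfolding residually_finite_def by (rule inj_on_subset)
  ultimately show ?thesis unfolding bij_betw_def by blast
qed

lemma bij_betw_cofinite_torsion:
  assumes C: "Module.module R C" and D: "Module.module R D"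
    and h: "linear_on R C D (carrier C) h" "bij_betw h (carrier C) (carrier D)"
  shows "bij_betw h (cofinite_torsion C) (cofinite_torsion D)"
proof -
  interpret C: Module.module R C by fact
  interpret D: Module.module R D by fact
  have h0: "h \<zero>\<^bsub>C\<^esub> = \<zero>\<^bsub>D\<^esub>" by (rule linear_on_arith(1)[OF C D C.carrier_is_submodule h(1)])
  have kill: "j \<odot>\<^bsub>D\<^esub> h x = \<zero>\<^bsub>D\<^esub> \<longleftrightarrow> j \<odot>\<^bsub>C\<^esub> x = \<zero>\<^bsub>C\<^esub>" if "j \<in> carrier R" "x \<in> carrier C" for j x
  proof -
    have "j \<odot>\<^bsub>C\<^esub> x \<in> carrier C" using that by simp
    then show ?thesis
      using linear_onD(3)[OF h(1) that] h0 inj_onD[OF bij_betw_imp_inj_on[OF h(2)], of "j \<odot>\<^bsub>C\<^esub> x" "\<zero>\<^bsub>C\<^esub>"]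
      by auto
  qed
  have JR: "J \<subseteq> carrier R" if "J \<in> cofinite_ideals R" for J
    using that ideal_closure(1) by (simp add: cofinite_submodules_iff submodule_regular_iff)
  have iff: "h x \<in> cofinite_torsion D \<longleftrightarrow> x \<in> cofinite_torsion C" if x: "x \<in> carrier C" for x
  proof -
    have "(\<forall>j\<in>J. j \<odot>\<^bsub>D\<^esub> h x = \<zero>\<^bsub>D\<^esub>) \<longleftrightarrow> (\<forall>j\<in>J. j \<odot>\<^bsub>C\<^esub> x = \<zero>\<^bsub>C\<^esub>)" if "J \<in> cofinite_ideals R" for J
      using kill[OF _ x] JR[OF that] by (intro ball_cong refl) blast
    then show ?thesis
      using x linear_onD(1)[OF h(1) x] by (simp add: cofinite_torsion_def cong: bex_cong)
  qed
  have sub: "cofinite_torsion C \<subseteq> carrier C" "cofinite_torsion D \<subseteq> carrier D"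
    by (auto simp: cofinite_torsion_def)
  have "h ` cofinite_torsion C = cofinite_torsion D"
  proof
    show "h ` cofinite_torsion C \<subseteq> cofinite_torsion D" using iff sub(1) by auto
    show "cofinite_torsion D \<subseteq> h ` cofinite_torsion C"
    proof
      fix y assume y: "y \<in> cofinite_torsion D"
      then have "y \<in> h ` carrier C" using sub(2) h(2) by (auto simp: bij_betw_def)
      then obtain x where "x \<in> carrier C" "y = h x" by (elim imageE)
      then show "y \<in> h ` cofinite_torsion C" using iff y by simp
    qed
  qed
  with inj_on_subset[OF bij_betw_imp_inj_on[OF h(2)] sub(1)] show ?thesis
    unfolding bij_betw_def by blast
qed

text \<open>An isomorphism of completions respects \<open>cofinite_torsion\<close>, which the
completion maps identify with the torsion submodules.\<close>

lemma torsion_isomorphism_of_completions: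
  assumes M: "finitely_generated_module R M" "residually_finite R M"
    and N: "finitely_generated_module R N" "residually_finite R N"
    and iso: "completions_isomorphic R M N"
  shows "\<exists>\<theta>. linear_on R M N (torsion_elements R M) \<theta> \<and>
     bij_betw \<theta> (torsion_elements R M) (torsion_elements R N)"
proof -
  have mod: "Module.module R M" "Module.module R N"
    using M N by (simp_all add: finitely_generated_module_def)
  interpret M: Module.module R M by (rule mod)
  interpret N: Module.module R N by (rule mod)
  let ?C = "completion R M" and ?D = "completion R N"
  note C = module_completion(1)[OF mod(1)] and D = module_completion(1)[OF mod(2)]
  obtain h where h: "linear_on R ?C ?D (carrier ?C) h" "bij_betw h (carrier ?C) (carrier ?D)"
    using iso by (auto simp: completions_isomorphic_def mod_iso_iff)
  let ?TM = "torsion_elements R M" and ?TN = "torsion_elements R N"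
  have TM: "?TM \<subseteq> carrier M" and TN: "?TN \<subseteq> carrier N" by (auto simp: torsion_elements_def)
  note bM = completion_map_torsion[OF M] and bN = completion_map_torsion[OF N]
  have bh: "bij_betw h (cofinite_torsion ?C) (cofinite_torsion ?D)"
    by (rule bij_betw_cofinite_torsion[OF C D h])
  let ?i = "inv_into ?TN (completion_map R N)"
  have lN: "linear_on R ?D N (cofinite_torsion ?D) ?i"
    by (rule linear_on_inverse[OF mod(2) submodule_torsion_elements[OF mod(2)]
        linear_on_subset[OF N.linear_completion_map TN] bN])
  have lh: "linear_on R M ?D ?TM (\<lambda>x. h (completion_map R M x))"
  proof (rule linear_on_comp[OF linear_on_subset[OF M.linear_completion_map TM] h(1)])
    show "completion_map R M ` ?TM \<subseteq> carrier ?C"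
      using linear_onD(1)[OF M.linear_completion_map] TM by auto
  qed
  have bMh: "bij_betw (h \<circ> completion_map R M) ?TM (cofinite_torsion ?D)"
    by (rule bij_betw_trans[OF bM bh])
  then have "(\<lambda>x. h (completion_map R M x)) ` ?TM \<subseteq> cofinite_torsion ?D"
    by (auto simp: bij_betw_def)
  then have "linear_on R M N ?TM (\<lambda>x. ?i (h (completion_map R M x)))"
    by (rule linear_on_comp[OF lh lN])
  moreover have "bij_betw (?i \<circ> (h \<circ> completion_map R M)) ?TM ?TN"
    by (rule bij_betw_trans[OF bMh bij_betw_inv_into[OF bN]])
  ultimately show ?thesis
    by (intro exI[of _ "\<lambda>x. ?i (h (completion_map R M x))"]) (simp add: comp_def)
qed

text \<open>Take the elements that multiply a nonzero \<open>x\<close> into a submodule of finite index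
that avoids \<open>x\<close>. If this ideal is zero, then \<open>R\<close> is finite and every nonzero
proper ideal works.\<close>

lemma exists_nonzero_proper_cofinite_ideal:
  assumes M: "Module.module R M" and rf: "residually_finite R M" and x: "x \<in> carrier M" "x \<noteq> \<zero>\<^bsub>M\<^esub>"
  shows "\<exists>J\<in>cofinite_ideals R. J \<noteq> {\<zero>} \<and> J \<noteq> carrier R"
proof -
  interpret M: Module.module R M by fact
  interpret S: Module.module R "regular_module R" by (rule module_regular_module)
  obtain H where H: "H \<in> cofinite_submodules R M" "x \<notin> H"
    using cofinite_submodule_separating[OF M rf x] by blast
  define J where "J = {r \<in> carrier R. \<forall>z\<in>set [x]. r \<odot>\<^bsub>M\<^esub> z \<in> H}"
  have J: "J \<in> cofinite_ideals R"
    unfolding J_def using x by (intro M.cofinite_colon[OF H(1)]) simp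
  have "\<one> \<notin> J" using H(2) x by (simp add: J_def)
  show ?thesis
  proof (cases "J = {\<zero>}")
    case False
    then show ?thesis using J \<open>\<one> \<notin> J\<close> one_closed by blast
  next
    case True
    obtain P where P: "ideal P R" "P \<noteq> {\<zero>}" "P \<noteq> carrier R"
      using exists_nonzero_proper_ideal by blast
    have Ps: "submodule P R (regular_module R)" using P by (simp add: submodule_regular_iff)
    have Js: "submodule J R (regular_module R)" "finite (coset_map (regular_module R) J ` carrier R)"
      using J by (simp_all add: cofinite_submodules_iff)
    have "finite (coset_map (regular_module R) P ` carrier R)"
    proof (rule finite_image_factor[OF Js(2)])
      fix r s assume rs: "r \<in> carrier R" "s \<in> carrier R"
        "J +>\<^bsub>regular_module R\<^esub> r = J +>\<^bsub>regular_module R\<^esub> s"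
      have "r \<ominus> s \<in> J" using S.coset_eq_iff[OF Js(1), of r s] rs by simp
      then have "r \<ominus> s \<in> P" using True ideal_closure(2)[OF P(1)] by simp
      then show "P +>\<^bsub>regular_module R\<^esub> r = P +>\<^bsub>regular_module R\<^esub> s"
        using S.coset_eq_iff[OF Ps, of r s] rs by simp
    qed
    with Ps have "P \<in> cofinite_ideals R" by (simp add: cofinite_submodules_iff)
    with P show ?thesis by blast
  qed
qed

text \<open>The number of elements of \<open>M / J M\<close> is visible in the completion and equals
\<open>card (T / J T) * card (R / J) ^ n\<close> with \<open>T\<close> the torsion submodule
and \<open>n\<close> the rank. The first factor is the same for both modules, and it is finite and not
zero.\<close>

lemma peels_length_unique:
  assumes M: "finitely_generated_module R M" "residually_finite R M"
    and N: "finitely_generated_module R N" "residually_finite R N"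
    and iso: "completions_isomorphic R M N"
    and As: "peels R M (carrier M) As" and Bs: "peels R N (carrier N) Bs"
  shows "length As = length Bs"
proof -
  have mod: "Module.module R M" "Module.module R N"
    using M N by (simp_all add: finitely_generated_module_def)
  interpret M: Module.module R M by (rule mod)
  interpret N: Module.module R N by (rule mod)
  interpret S: Module.module R "regular_module R" by (rule module_regular_module)
  have iso': "completions_isomorphic R N M" by (rule completions_isomorphic_sym[OF mod(1) iso])
  show ?thesis
  proof (cases "carrier M = {\<zero>\<^bsub>M\<^esub>} \<and> carrier N = {\<zero>\<^bsub>N\<^esub>}")
    case True
    have nil: "Cs = []" if L: "Module.module R L" "carrier L = {\<zero>\<^bsub>L\<^esub>}" "peels R L (carrier L) Cs"
      for L :: "('a, 'x, 'y) module_scheme" and Cs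
    proof (cases Cs)
      case (Cons A Cs')
      then obtain f where f: "functional_on R L (carrier L) f" "f ` carrier L = A" "A \<noteq> {\<zero>}"
        using L(3) unfolding Cons peels.simps(2) by blast
      have "f \<zero>\<^bsub>L\<^esub> = \<zero>"
        using linear_on_arith(1)[OF L(1) module_regular_module module.carrier_is_submodule[OF L(1)] f(1)] by simp
      then show ?thesis using f(2,3) L(2) by simp
    qed simp
    show ?thesis using nil[OF mod(1) _ As] nil[OF mod(2) _ Bs] True by simp
  next
    case False
    have "\<exists>J\<in>cofinite_ideals R. J \<noteq> {\<zero>} \<and> J \<noteq> carrier R"
    proof (cases "carrier M = {\<zero>\<^bsub>M\<^esub>}")
      case True
      then obtain x where "x \<in> carrier N" "x \<noteq> \<zero>\<^bsub>N\<^esub>"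
        using False N.M.zero_closed by blast
      then show ?thesis by (rule exists_nonzero_proper_cofinite_ideal[OF mod(2) N(2)])
    next
      case False
      then obtain x where "x \<in> carrier M" "x \<noteq> \<zero>\<^bsub>M\<^esub>"
        using M.M.zero_closed by blast
      then show ?thesis by (rule exists_nonzero_proper_cofinite_ideal[OF mod(1) M(2)])
    qed
    then obtain J where J: "J \<in> cofinite_ideals R" "J \<noteq> {\<zero>}" "J \<noteq> carrier R" by blast
    have Js: "submodule J R (regular_module R)" "finite (coset_map (regular_module R) J ` carrier R)"
      using J by (simp_all add: cofinite_submodules_iff)
    then have Ji: "ideal J R" by (simp add: submodule_regular_iff)
    define q where "q = card (coset_map (regular_module R) J ` carrier R)"
    have "q > 1"
    proof -
      have "\<one> \<notin> J" using J(3) Ji ideal.one_imp_carrier by blast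
      then have "\<one> \<ominus> \<zero> \<notin> J" by (simp add: a_minus_def)
      then have "J +>\<^bsub>regular_module R\<^esub> \<one> \<noteq> J +>\<^bsub>regular_module R\<^esub> \<zero>"
        using S.coset_eq_iff[OF Js(1), of \<one> \<zero>] by simp
      moreover have "{J +>\<^bsub>regular_module R\<^esub> \<one>, J +>\<^bsub>regular_module R\<^esub> \<zero>}
          \<subseteq> coset_map (regular_module R) J ` carrier R" by auto
      ultimately show ?thesis
        using card_mono[OF Js(2), of "{J +>\<^bsub>regular_module R\<^esub> \<one>, J +>\<^bsub>regular_module R\<^esub> \<zero>}"]
        by (simp add: q_def)
    qed
    have cof: "ideal_smult M J (carrier M) \<in> cofinite_submodules R M"
      by (rule cofinite_if_killed_by_cofinite_ideal[OF M(1) J(1)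
          M.submodule_ideal_smult(1)[OF Ji M.carrier_is_submodule] ideal_smult.smult])
    have cof': "ideal_smult N J (carrier N) \<in> cofinite_submodules R N"
      by (rule cofinite_if_killed_by_cofinite_ideal[OF N(1) J(1)
          N.submodule_ideal_smult(1)[OF Ji N.carrier_is_submodule] ideal_smult.smult])
    have eq: "card (reduction M J (carrier M)) = card (reduction N J (carrier N))"
      using card_reduction_le_if_completions_isomorphic[OF mod iso Ji cof cof']
        card_reduction_le_if_completions_isomorphic[OF mod(2,1) iso' Ji cof' cof] by simp
    obtain \<theta> where \<theta>: "linear_on R M N (torsion_elements R M) \<theta>"
      "bij_betw \<theta> (torsion_elements R M) (torsion_elements R N)"
      using torsion_isomorphism_of_completions[OF M N iso] by blast
    note T = submodule_torsion_elements[OF mod(1)] submodule_torsion_elements[OF mod(2)]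
    have T_eq: "card (reduction M J (torsion_elements R M)) = card (reduction N J (torsion_elements R N))"
      by (rule card_reduction_iso[OF mod T Ji \<theta>])
    have int: "carrier M \<inter> torsion_elements R M = torsion_elements R M"
      "carrier N \<inter> torsion_elements R N = torsion_elements R N" by (auto simp: torsion_elements_def)
    have cM: "card (reduction M J (carrier M)) = card (reduction M J (torsion_elements R M)) * q ^ length As"
      using card_reduction_peels[OF mod(1) Ji J(2) M.carrier_is_submodule As] unfolding int q_def .
    have cN: "card (reduction N J (carrier N)) = card (reduction N J (torsion_elements R N)) * q ^ length Bs"
      using card_reduction_peels[OF mod(2) Ji J(2) N.carrier_is_submodule Bs] unfolding int q_def .
    have "card (reduction M J (torsion_elements R M)) * q ^ length As =
        card (reduction M J (torsion_elements R M)) * q ^ length Bs"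
      using cM cN eq T_eq by metis
    moreover have "card (reduction M J (torsion_elements R M)) \<noteq> 0"
    proof -
      have "finite (reduction M J (torsion_elements R M))"
        using finite_torsion[OF M] by (simp add: reduction_def)
      moreover have "reduction M J (torsion_elements R M) \<noteq> {}"
        using M.submodule_closure(2)[OF T(1)] by (auto simp: reduction_def)
      ultimately show ?thesis by simp
    qed
    ultimately have "q ^ length As = q ^ length Bs" by simp
    then show ?thesis using \<open>q > 1\<close> by (simp add: power_inject_exp)
  qed
qed

section \<open>Ideal classes\<close>

lemma frac_embed_facts:
  assumes "a \<in> carrier R" "b \<in> carrier R"
  shows "frac_embed R a \<in> carrier (frac_field R)"
    "frac_embed R (a \<oplus> b) = frac_embed R a \<oplus>\<^bsub>frac_field R\<^esub> frac_embed R b"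
    "frac_embed R (a \<otimes> b) = frac_embed R a \<otimes>\<^bsub>frac_field R\<^esub> frac_embed R b"
    "frac_embed R a = frac_embed R b \<longleftrightarrow> a = b"
  using ring_hom_closed[OF frac_embed_hom assms(1)] ring_hom_add[OF frac_embed_hom assms]
    ring_hom_mult[OF frac_embed_hom assms] inj_on_eq_iff[OF inj_frac_embed assms] by auto

lemma frac_embed_zero: "frac_embed R \<zero> = \<zero>\<^bsub>frac_field R\<^esub>"
  by (simp add: frac_embed_def frac_field_zero_one)

lemma frac_embed_one: "frac_embed R \<one> = \<one>\<^bsub>frac_field R\<^esub>"
  by (simp add: frac_embed_def frac_field_zero_one)

lemma ideal_fractional:
  assumes I: "ideal I R" "I \<noteq> {\<zero>}"
  shows "frac_embed R ` I \<in> fractional_ideals R"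
proof -
  interpret K: field "frac_field R" by (rule field_frac_field)
  note Ic = ideal_closure[OF I(1)]
  note e = frac_embed_facts
  have e1: "frac_embed R a \<in> carrier (frac_field R)" if "a \<in> carrier R" for a
    using e(1)[OF that that] .
  have "additive_subgroup (frac_embed R ` I) (frac_field R)"
  proof (rule additive_subgroup.intro, rule subgroup.intro)
    show "frac_embed R ` I \<subseteq> carrier (add_monoid (frac_field R))"
      using e1 Ic(1) by auto
    show "x \<otimes>\<^bsub>add_monoid (frac_field R)\<^esub> y \<in> frac_embed R ` I"
      if xy: "x \<in> frac_embed R ` I" "y \<in> frac_embed R ` I" for x y
    proof -
      obtain a b where ab: "a \<in> I" "b \<in> I" "x = frac_embed R a" "y = frac_embed R b" using xy by auto
      then have "x \<oplus>\<^bsub>frac_field R\<^esub> y = frac_embed R (a \<oplus> b)"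
        using e(2)[of a b] Ic(1) by auto
      then show ?thesis using imageI[OF Ic(3)[OF ab(1,2)], of "frac_embed R"] by simp
    qed
    show "\<one>\<^bsub>add_monoid (frac_field R)\<^esub> \<in> frac_embed R ` I"
      using imageI[OF Ic(2), of "frac_embed R"] frac_embed_zero by simp
    show "inv\<^bsub>add_monoid (frac_field R)\<^esub> x \<in> frac_embed R ` I" if x: "x \<in> frac_embed R ` I" for x
    proof -
      obtain a where a: "a \<in> I" "x = frac_embed R a" using x by auto
      have c: "a \<in> carrier R" "\<ominus> a \<in> carrier R" using a Ic(1) by auto
      have "frac_embed R (\<ominus> a) \<oplus>\<^bsub>frac_field R\<^esub> x = \<zero>\<^bsub>frac_field R\<^esub>"
        using e(2)[OF c(2,1)] c frac_embed_zero a(2) by (simp add: l_neg)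
      then have "\<ominus>\<^bsub>frac_field R\<^esub> x = frac_embed R (\<ominus> a)"
        using a c e1 by (intro K.minus_equality) auto
      then show ?thesis
        using imageI[OF Ic(6)[OF a(1)], of "frac_embed R"] by (simp add: a_inv_def)
    qed
  qed
  moreover have "\<forall>r\<in>carrier R. \<forall>x\<in>frac_embed R ` I.
      frac_embed R r \<otimes>\<^bsub>frac_field R\<^esub> x \<in> frac_embed R ` I"
  proof (intro ballI)
    fix r x assume r: "r \<in> carrier R" and "x \<in> frac_embed R ` I"
    then obtain a where a: "a \<in> I" "x = frac_embed R a" by auto
    have "frac_embed R r \<otimes>\<^bsub>frac_field R\<^esub> x = frac_embed R (r \<otimes> a)"
      using e(3)[OF r, of a] a Ic(1) by auto
    then show "frac_embed R r \<otimes>\<^bsub>frac_field R\<^esub> x \<in> frac_embed R ` I"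
      using imageI[OF Ic(4)[OF r a(1)], of "frac_embed R"] by simp
  qed
  moreover have "frac_embed R ` I \<noteq> {\<zero>\<^bsub>frac_field R\<^esub>}"
  proof -
    obtain a where "a \<in> I" "a \<noteq> \<zero>" using I Ic(2) by blast
    then have "frac_embed R a \<noteq> \<zero>\<^bsub>frac_field R\<^esub>"
      using e(4)[of a \<zero>] Ic(1) frac_embed_zero by auto
    with \<open>a \<in> I\<close> show ?thesis by auto
  qed
  moreover have "\<exists>d\<in>carrier R - {\<zero>}. \<forall>x\<in>frac_embed R ` I.
      frac_embed R d \<otimes>\<^bsub>frac_field R\<^esub> x \<in> frac_embed R ` carrier R"
    using Ic(1) e1 frac_embed_one by (intro bexI[of _ \<one>]) auto
  ultimately show ?thesis by (simp add: fractional_ideals_def)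
qed

lemma principal_times_ideal:
  assumes I: "ideal I R" and x: "x \<in> carrier (frac_field R)"
  shows "ideal_prod (frac_field R) ((\<lambda>r. frac_embed R r \<otimes>\<^bsub>frac_field R\<^esub> x) ` carrier R) (frac_embed R ` I)
    = (\<lambda>a. x \<otimes>\<^bsub>frac_field R\<^esub> frac_embed R a) ` I"
    (is "ideal_prod ?K ?P ?I = ?X")
proof -
  interpret K: field ?K by (rule field_frac_field)
  note Ic = ideal_closure[OF I]
  note e = frac_embed_facts
  have e1: "frac_embed R a \<in> carrier ?K" if "a \<in> carrier R" for a using e(1)[OF that that] .
  show ?thesis
  proof
    show "ideal_prod ?K ?P ?I \<subseteq> ?X"
    proof
      fix z assume "z \<in> ideal_prod ?K ?P ?I"
      then show "z \<in> ?X"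
      proof induction
        case (prod i j)
        then obtain r a where ra: "r \<in> carrier R" "a \<in> I" "i = frac_embed R r \<otimes>\<^bsub>?K\<^esub> x" "j = frac_embed R a"
          by auto
        have aR: "a \<in> carrier R" using ra Ic(1) by auto
        have "i \<otimes>\<^bsub>?K\<^esub> j = x \<otimes>\<^bsub>?K\<^esub> frac_embed R (r \<otimes> a)"
          unfolding ra e(3)[OF ra(1) aR] using e1[OF ra(1)] e1[OF aR] x by (simp add: K.m_ac)
        then show ?case using Ic(4)[OF ra(1,2)] by blast
      next
        case (sum u v)
        then obtain a b where ab: "a \<in> I" "b \<in> I" "u = x \<otimes>\<^bsub>?K\<^esub> frac_embed R a" "v = x \<otimes>\<^bsub>?K\<^esub> frac_embed R b"
          by auto
        have c: "a \<in> carrier R" "b \<in> carrier R" using ab Ic(1) by auto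
        have "u \<oplus>\<^bsub>?K\<^esub> v = x \<otimes>\<^bsub>?K\<^esub> frac_embed R (a \<oplus> b)"
          unfolding ab e(2)[OF c] using e1[OF c(1)] e1[OF c(2)] x by (simp add: K.r_distr)
        then show ?case using Ic(3)[OF ab(1,2)] by blast
      qed
    qed
    show "?X \<subseteq> ideal_prod ?K ?P ?I"
    proof
      fix z assume "z \<in> ?X"
      then obtain a where a: "a \<in> I" "z = x \<otimes>\<^bsub>?K\<^esub> frac_embed R a" by auto
      have "frac_embed R \<one> \<otimes>\<^bsub>?K\<^esub> x \<in> ?P" by blast
      then have "x \<in> ?P" using x frac_embed_one by simp
      then show "z \<in> ideal_prod ?K ?P ?I"
        unfolding a(2) using a(1) by (intro ideal_prod.prod) auto
    qed
  qed
qed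

definition class_of_ideal :: "'a set \<Rightarrow> ('a \<times> 'a) set set set" where
  "class_of_ideal I =
     principal_fractional_ideals R #>\<^bsub>fractional_ideal_group R\<^esub> (frac_embed R ` I)"

lemma class_of_ideal_in_class_group:
  assumes "ideal I R" "I \<noteq> {\<zero>}"
  shows "class_of_ideal I \<in> carrier (ideal_class_group R)"
  using ideal_fractional[OF assms]
  by (auto simp: class_of_ideal_def ideal_class_group_def FactGroup_def RCOSETS_def fractional_ideal_group_def)

text \<open>Ideals in the same class differ by a factor \<open>x\<close> in the fraction field, and
multiplication by \<open>x\<close> is the isomorphism.\<close>

lemma isomorphism_of_equal_class:
  assumes I: "ideal I R" and J: "ideal J R" and eq: "class_of_ideal I = class_of_ideal J"
  shows "\<exists>\<mu>. functional_on R (regular_module R) I \<mu> \<and> \<mu> ` I = J \<and> (\<forall>a\<in>I. \<mu> a = \<zero> \<longrightarrow> a = \<zero>)"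
proof -
  let ?K = "frac_field R"
  interpret K: field ?K by (rule field_frac_field)
  note Ic = ideal_closure[OF I] and Jc = ideal_closure[OF J]
  note e = frac_embed_facts
  have e1: "frac_embed R a \<in> carrier ?K" if "a \<in> carrier R" for a using e(1)[OF that that] .
  have cls: "class_of_ideal L = {ideal_prod ?K Q (frac_embed R ` L) | Q. Q \<in> principal_fractional_ideals R}" for L
    by (auto simp: class_of_ideal_def r_coset_def fractional_ideal_group_def)
  have "(\<lambda>r. frac_embed R r \<otimes>\<^bsub>?K\<^esub> \<one>\<^bsub>?K\<^esub>) ` carrier R \<in> principal_fractional_ideals R"
    unfolding principal_fractional_ideals_def by (intro CollectI exI[of _ "\<one>\<^bsub>?K\<^esub>"]) simp
  moreover have "ideal_prod ?K ((\<lambda>r. frac_embed R r \<otimes>\<^bsub>?K\<^esub> \<one>\<^bsub>?K\<^esub>) ` carrier R) (frac_embed R ` J) = frac_embed R ` J"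
  proof -
    have "(\<lambda>a. \<one>\<^bsub>?K\<^esub> \<otimes>\<^bsub>?K\<^esub> frac_embed R a) ` J = frac_embed R ` J"
      using Jc(1) e1 by (intro image_cong) auto
    then show ?thesis using principal_times_ideal[OF J K.one_closed] by simp
  qed
  ultimately have "frac_embed R ` J \<in> class_of_ideal J" unfolding cls by blast
  then have "frac_embed R ` J \<in> class_of_ideal I" using eq by simp
  then obtain Q where Q: "Q \<in> principal_fractional_ideals R" "frac_embed R ` J = ideal_prod ?K Q (frac_embed R ` I)"
    unfolding cls by blast
  obtain x where x: "x \<in> carrier ?K" "x \<noteq> \<zero>\<^bsub>?K\<^esub>" "Q = (\<lambda>r. frac_embed R r \<otimes>\<^bsub>?K\<^esub> x) ` carrier R"
    using Q(1) by (auto simp: principal_fractional_ideals_def)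
  have JI: "frac_embed R ` J = (\<lambda>a. x \<otimes>\<^bsub>?K\<^esub> frac_embed R a) ` I"
    using Q(2) principal_times_ideal[OF I x(1)] x(3) by simp
  have "\<forall>a\<in>I. \<exists>b. b \<in> J \<and> frac_embed R b = x \<otimes>\<^bsub>?K\<^esub> frac_embed R a"
  proof
    fix a assume "a \<in> I"
    then have "x \<otimes>\<^bsub>?K\<^esub> frac_embed R a \<in> frac_embed R ` J" unfolding JI by (rule imageI)
    then show "\<exists>b. b \<in> J \<and> frac_embed R b = x \<otimes>\<^bsub>?K\<^esub> frac_embed R a" by auto
  qed
  from bchoice[OF this] obtain \<mu> where
    \<mu>: "\<And>a. a \<in> I \<Longrightarrow> \<mu> a \<in> J" "\<And>a. a \<in> I \<Longrightarrow> frac_embed R (\<mu> a) = x \<otimes>\<^bsub>?K\<^esub> frac_embed R a" by blast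
  have \<mu>R: "\<mu> a \<in> carrier R" if "a \<in> I" for a using \<mu>(1)[OF that] Jc(1) by auto
  have IR: "a \<in> carrier R" if "a \<in> I" for a using that Ic(1) by auto
  have "functional_on R (regular_module R) I \<mu>"
  proof (rule linear_onI)
    show "\<mu> a \<in> carrier (regular_module R)" if "a \<in> I" for a using \<mu>R[OF that] by simp
    show "\<mu> (a \<oplus>\<^bsub>regular_module R\<^esub> b) = \<mu> a \<oplus>\<^bsub>regular_module R\<^esub> \<mu> b" if ab: "a \<in> I" "b \<in> I" for a b
    proof -
      have "frac_embed R (\<mu> (a \<oplus> b)) = frac_embed R (\<mu> a \<oplus> \<mu> b)"
        using \<mu>(2)[OF Ic(3)[OF ab]] \<mu>(2)[OF ab(1)] \<mu>(2)[OF ab(2)] e(2)[OF IR[OF ab(1)] IR[OF ab(2)]]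
          e(2)[OF \<mu>R[OF ab(1)] \<mu>R[OF ab(2)]] K.r_distr[OF e1[OF IR[OF ab(1)]] e1[OF IR[OF ab(2)]] x(1)] by simp
      then show ?thesis
        using e(4)[OF \<mu>R[OF Ic(3)[OF ab]], of "\<mu> a \<oplus> \<mu> b"] \<mu>R ab by simp
    qed
    show "\<mu> (r \<odot>\<^bsub>regular_module R\<^esub> a) = r \<odot>\<^bsub>regular_module R\<^esub> \<mu> a" if r: "r \<in> carrier R" and a: "a \<in> I" for r a
    proof -
      have "frac_embed R (\<mu> (r \<otimes> a)) = frac_embed R (r \<otimes> \<mu> a)"
        using \<mu>(2)[OF Ic(4)[OF r a]] \<mu>(2)[OF a] e(3)[OF r IR[OF a]] e(3)[OF r \<mu>R[OF a]]
          K.m_lcomm[OF x(1) e1[OF r] e1[OF IR[OF a]]] by simp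
      then show ?thesis
        using e(4)[OF \<mu>R[OF Ic(4)[OF r a]], of "r \<otimes> \<mu> a"] \<mu>R[OF a] r by simp
    qed
  qed
  moreover have "\<mu> ` I = J"
  proof
    show "\<mu> ` I \<subseteq> J" using \<mu>(1) by auto
    show "J \<subseteq> \<mu> ` I"
    proof
      fix b assume b: "b \<in> J"
      then have "frac_embed R b \<in> (\<lambda>a. x \<otimes>\<^bsub>?K\<^esub> frac_embed R a) ` I" unfolding JI[symmetric] by (rule imageI)
      then obtain a where a: "a \<in> I" "frac_embed R b = frac_embed R (\<mu> a)" using \<mu>(2) by auto
      then have "b = \<mu> a" using e(4)[of b "\<mu> a"] b Jc(1) \<mu>R[OF a(1)] by auto
      with a(1) show "b \<in> \<mu> ` I" by blast
    qed
  qed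
  moreover have "a = \<zero>" if a: "a \<in> I" "\<mu> a = \<zero>" for a
  proof -
    have "x \<otimes>\<^bsub>?K\<^esub> frac_embed R a = \<zero>\<^bsub>?K\<^esub>" using \<mu>(2)[OF a(1)] a(2) frac_embed_zero by simp
    then have "frac_embed R a = frac_embed R \<zero>"
      using K.integral[of x "frac_embed R a"] x e1[OF IR[OF a(1)]] frac_embed_zero by simp
    then show ?thesis using e(4)[OF IR[OF a(1)] zero_closed] by simp
  qed
  ultimately show ?thesis by blast
qed

lemma peels_replace_last:
  assumes M: "Module.module R M" and \<mu>: "functional_on R (regular_module R) I \<mu>" "\<mu> ` I = J"
    "\<And>a. a \<in> I \<Longrightarrow> \<mu> a = \<zero> \<Longrightarrow> a = \<zero>" and I: "ideal I R"
  shows "peels R M H (As @ [I]) \<Longrightarrow> peels R M H (As @ [J])"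
proof (induction As arbitrary: H)
  case Nil
  then obtain f where f: "functional_on R M H f" "f ` H = I" "I \<noteq> {\<zero>}" "peels R M {x \<in> H. f x = \<zero>} []"
    unfolding append_Nil peels.simps(2) by blast
  have \<mu>0: "\<mu> \<zero> = \<zero>"
    using linear_on_arith(1)[OF module_regular_module module_regular_module _ \<mu>(1)] I
    by (simp add: submodule_regular_iff)
  have "{x \<in> H. \<mu> (f x) = \<zero>} = {x \<in> H. f x = \<zero>}" using \<mu>(3) \<mu>0 f(2) by auto
  moreover have "functional_on R M H (\<lambda>x. \<mu> (f x))"
    using f(2) by (intro linear_on_comp[OF f(1) \<mu>(1)]) simp
  moreover have "(\<lambda>x. \<mu> (f x)) ` H = J" using f(2) \<mu>(2) by (simp add: image_image[symmetric])
  moreover have "J \<noteq> {\<zero>}"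
  proof -
    obtain a where "a \<in> I" "a \<noteq> \<zero>" using f(3) ideal_closure(2)[OF I] by blast
    then show ?thesis using \<mu>(2,3) by auto
  qed
  ultimately show ?case
    unfolding append_Nil peels.simps(2) using f(4) by (intro exI[of _ "\<lambda>x. \<mu> (f x)"]) simp
next
  case (Cons A As)
  then show ?case unfolding append_Cons peels.simps(2) by blast
qed

lemma mod_isomorphic_if_same_peels:
  assumes N: "finitely_generated_module R N" "residually_finite R N"
    and N': "finitely_generated_module R N'" "residually_finite R N'"
    and iso: "completions_isomorphic R N N'"
    and As: "peels R N (carrier N) As" "peels R N' (carrier N') As"
  shows "mod_isomorphic R N N'"
proof -
  have mod: "Module.module R N" "Module.module R N'"
    using N N' by (simp_all add: finitely_generated_module_def)
  obtain \<theta> where \<theta>: "linear_on R N N' (torsion_elements R N) \<theta>"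
    "bij_betw \<theta> (torsion_elements R N) (torsion_elements R N')"
    using torsion_isomorphism_of_completions[OF N N' iso] by blast
  have int: "carrier N \<inter> torsion_elements R N = torsion_elements R N"
      "carrier N' \<inter> torsion_elements R N' = torsion_elements R N'" by (auto simp: torsion_elements_def)
  have "\<exists>\<phi>. linear_on R N N' (carrier N) \<phi> \<and> bij_betw \<phi> (carrier N) (carrier N')"
    by (rule isomorphism_from_peels[OF mod module.carrier_is_submodule[OF mod(1)]
          module.carrier_is_submodule[OF mod(2)] As, of \<theta>]) (simp_all only: int \<theta>)
  then show ?thesis
    unfolding mod_isomorphic_def using mod_iso_iff by blast
qed

section \<open>The Steinitz class determines the module within its genus\<close>

text \<open>For rank \<open>n > 0\<close> the module is its torsion submodule plus
\<open>R\<^sup>n\<^sup>-\<^sup>1\<close> plus \<open>I\<close>. For \<open>n = 0\<close> the module is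
torsion and \<open>I\<close> may be any nonzero ideal, so that both cases can be treated alike.\<close>

definition steinitz_ideal :: "nat \<Rightarrow> ('a, 'm, 'e) module_scheme \<Rightarrow> 'a set \<Rightarrow> bool" where
  "steinitz_ideal n N I \<longleftrightarrow> ideal I R \<and> I \<noteq> {\<zero>} \<and>
     peels R N (carrier N) (if n = 0 then [] else replicate (n - 1) (carrier R) @ [I])"

lemma exists_steinitz_ideal:
  assumes N: "Module.module R N" and As: "peels R N (carrier N) As"
  shows "\<exists>I. steinitz_ideal (length As) N I"
proof (cases As)
  case Nil
  have "carrier R \<noteq> {\<zero>}" using one_not_zero one_closed by blast
  then have "steinitz_ideal (length As) N (carrier R)"
    using As Nil oneideal by (simp add: steinitz_ideal_def)
  then show ?thesis by blast
next
  case (Cons A As')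
  obtain I where "ideal I R" "I \<noteq> {\<zero>}"
    "peels R N (carrier N) (replicate (length As') (carrier R) @ [I])"
    using peels_steinitz[OF N module.carrier_is_submodule[OF N] As[unfolded Cons]] by blast
  then have "steinitz_ideal (length As) N I"
    unfolding steinitz_ideal_def by (simp add: Cons)
  then show ?thesis by blast
qed

text \<open>The torsion submodules are isomorphic by \<open>torsion_isomorphism_of_completions\<close>,
and a factor \<open>x\<close> that carries \<open>I\<close> to \<open>J\<close> turns the normal form of
\<open>N\<close> into that of \<open>N'\<close>.\<close>

lemma mod_isomorphic_if_same_steinitz_class:
  assumes N: "finitely_generated_module R N" "residually_finite R N"
    and N': "finitely_generated_module R N'" "residually_finite R N'"
    and iso: "completions_isomorphic R N N'"
    and I: "steinitz_ideal n N I" and J: "steinitz_ideal n N' J"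
    and cls: "class_of_ideal I = class_of_ideal J"
  shows "mod_isomorphic R N N'"
proof -
  have mod: "Module.module R N" using N by (simp add: finitely_generated_module_def)
  have id: "ideal I R" "ideal J R" using I J by (simp_all add: steinitz_ideal_def)
  obtain \<mu> where \<mu>: "functional_on R (regular_module R) I \<mu>" "\<mu> ` I = J"
    "\<forall>a\<in>I. \<mu> a = \<zero> \<longrightarrow> a = \<zero>"
    using isomorphism_of_equal_class[OF id cls] by blast
  have "peels R N (carrier N) (if n = 0 then [] else replicate (n - 1) (carrier R) @ [J])"
    using I peels_replace_last[OF mod \<mu>(1,2) _ id(1), of "carrier N" "replicate (n - 1) (carrier R)"] \<mu>(3)
    by (simp add: steinitz_ideal_def split: if_splits)
  moreover have "peels R N' (carrier N') (if n = 0 then [] else replicate (n - 1) (carrier R) @ [J])"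
    using J by (simp add: steinitz_ideal_def)
  ultimately show ?thesis
    by (rule mod_isomorphic_if_same_peels[OF N N' iso])
qed

end

theorem theoremD:
  fixes R :: "('a, 'r) ring_scheme"
    and M :: "('a, 'm, 'e) module_scheme"
  assumes "dedekind_domain R"
    and "finitely_generated_ring R"
    and "finitely_generated_module R M"
  shows "\<exists>Y :: ('a, 'n) module set \<Rightarrow> ('a \<times> 'a) set set set.
           Y \<in> profinite_genus R M \<rightarrow> carrier (ideal_class_group R) \<and>
           inj_on Y (profinite_genus R M)"
proof -
  interpret dedekind_domain R by fact
  have M: "Module.module R M" using assms(3) by (simp add: finitely_generated_module_def)
  let ?G = "genus_modules R M :: ('a, 'n) module set"
  let ?E = "{(N, N'). N \<in> ?G \<and> N' \<in> ?G \<and> mod_isomorphic R N N'}"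
  have G: "finitely_generated_module R N" "residually_finite R N" "completions_isomorphic R M N"
    if "N \<in> ?G" for N
    using that by (auto simp: genus_modules_def)
  have iso: "completions_isomorphic R N N'" if N: "N \<in> ?G" "N' \<in> ?G" for N N'
    by (rule completions_isomorphic_trans[OF completions_isomorphic_sym[OF M G(3)[OF N(1)]] G(3)[OF N(2)]])
  have mod: "Module.module R N" if "N \<in> ?G" for N
    using G(1)[OF that] by (simp add: finitely_generated_module_def)
  have "\<exists>n. \<forall>N\<in>?G. \<exists>I. steinitz_ideal n N I"
  proof (cases "?G = {}")
    case True
    then show ?thesis by simp
  next
    case False
    then obtain N0 where N0: "N0 \<in> ?G" by blast
    obtain As where As: "peels R N0 (carrier N0) As" using exists_peels[OF G(1)[OF N0]] ..
    have "\<exists>I. steinitz_ideal (length As) N I" if N: "N \<in> ?G" for N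
    proof -
      obtain Bs where Bs: "peels R N (carrier N) Bs" using exists_peels[OF G(1)[OF N]] ..
      have "length As = length Bs"
        by (rule peels_length_unique[OF G(1,2)[OF N0] G(1,2)[OF N] iso[OF N0 N] As Bs])
      then show ?thesis using exists_steinitz_ideal[OF mod[OF N] Bs] by simp
    qed
    then show ?thesis by blast
  qed
  then obtain n where "\<forall>N\<in>?G. \<exists>I. steinitz_ideal n N I" ..
  from bchoice[OF this] obtain \<iota> where \<iota>: "\<forall>N\<in>?G. steinitz_ideal n N (\<iota> N)" ..
  define rep where "rep C = (SOME N. N \<in> C)" for C :: "('a, 'n) module set"
  have rep: "rep C \<in> ?G" "C = ?E `` {rep C}" if C: "C \<in> profinite_genus R M" for C
  proof -
    obtain N where N: "N \<in> ?G" "C = ?E `` {N}"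
      using C unfolding profinite_genus_def by (elim quotientE)
    have "N \<in> C" using equiv_class_self[OF equiv_genus N(1)] N(2) by simp
    then have r: "rep C \<in> C" unfolding rep_def by (rule someI)
    then have "rep C \<in> ?E `` {N}" by (simp only: N(2)[symmetric])
    then have NC: "(N, rep C) \<in> ?E" by (simp only: Image_singleton_iff)
    from NC have "?E `` {N} = ?E `` {rep C}" by (rule equiv_class_eq[OF equiv_genus])
    then show "C = ?E `` {rep C}" using N(2) by (rule trans[rotated])
    show "rep C \<in> ?G" using NC by blast
  qed
  define Y where "Y C = class_of_ideal (\<iota> (rep C))" for C
  have "Y \<in> profinite_genus R M \<rightarrow> carrier (ideal_class_group R)"
    unfolding Y_def using \<iota> rep(1)
    by (intro Pi_I class_of_ideal_in_class_group) (simp_all add: steinitz_ideal_def)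
  moreover have "inj_on Y (profinite_genus R M)"
  proof (rule inj_onI)
    fix C D assume CD: "C \<in> profinite_genus R M" "D \<in> profinite_genus R M" and eq: "Y C = Y D"
    note r = rep(1)[OF CD(1)] rep(1)[OF CD(2)]
    have "mod_isomorphic R (rep C) (rep D)"
      by (rule mod_isomorphic_if_same_steinitz_class[OF G(1,2)[OF r(1)] G(1,2)[OF r(2)] iso[OF r]
          bspec[OF \<iota> r(1)] bspec[OF \<iota> r(2)] eq[unfolded Y_def]])
    then have "(rep C, rep D) \<in> ?E" using r by simp
    then have "?E `` {rep C} = ?E `` {rep D}" by (rule equiv_class_eq[OF equiv_genus])
    then show "C = D" using rep(2)[OF CD(1)] rep(2)[OF CD(2)] by simp
  qed
  ultimately show ?thesis by blast
qed

end
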